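(* Let $c_0\in(0,\tfrac12)$ and let $\tilde\omega\in C^2[0,\infty)$ be a function independent of $\Lambda$ with $\tilde\omega(0)=0$. For $\Lambda>1$ define $\omega=\omega(\Lambda)$ by $$\frac{\omega}{\Lambda-1}=c_0+\tilde\omega\left(\sqrt{\Lambda-1}\right).$$ Then, for every $\Lambda>1$ sufficiently close to $1$, there exists a positive solution $(u_\Lambda,v_\Lambda)$ on $\mathbb R$ of $$u''=u^3-u+\Lambda v^2u-\omega v,\qquad v''=v^3-v+\Lambda u^2v-\omega u,$$ with $$(u,v)\to(\bar u,\bar v)\ \text{as } x\to-\infty,\qquad (u,v)\to(\bar v,\bar u)\ \text{as } x\to+\infty,$$ where $$\bar u=\sqrt{\frac{1-\sqrt{1-\frac{4\omega^2}{(\Lambda-1)^2}}}{2}},\qquad \bar v=\sqrt{\frac{1+\sqrt{1-\frac{4\omega^2}{(\Lambda-1)^2}}}{2}},$$ such that $u_\Lambda(-x)=v_\Lambda(x)$ for all $x\in\mathbb R$, and $$u_\Lambda^2(x)+v_\Lambda^2(x)=1+O(\Lambda-1)\,e^{-\left(\sqrt{1-4c_0^2}\sqrt{\Lambda-1}+O(\Lambda-1)\right)|x|}$$ uniformly in $x\in\mathbb R$ as $\Lambda\to1^+$. Furthermore, the angle $\varphi_\Lambda$ defined by $$\frac{\varphi_\Lambda}{2}=\tan^{-1}\left(\frac{v_\Lambda}{u_\Lambda}\right)$$ satisfies $$\varphi_\Lambda(x)-\varphi_0\left(x\sqrt{\Lambda-1}\right)=O\left(\sqrt{\Lambda-1}\right)$$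 uniformly in $x\in\mathbb R$ as $\Lambda\to1^+$, where $\varphi_0$ is the heteroclinic solution of $$\varphi_0'=2c_0-\sin\varphi_0,\quad x\in\mathbb R,$$ such that $\varphi_0'<0$, $\varphi_0(0)=\frac\pi2$ and $\varphi_0(-x)+\varphi_0(x)=\pi$ for all $x$. Moreover, $\varphi_\Lambda'<0$ on $\mathbb R$, and $$|u_\Lambda(x)-\bar u|+|v_\Lambda(x)-\bar v|=O\left(e^{\left(\sqrt{1-4c_0^2}\sqrt{\Lambda-1}+O(\Lambda-1)\right)x}\right)$$ uniformly in $x<0$ as $\Lambda\to1^+$.
   Context: Primes denote derivatives with respect to the independent variable in $\mathbb R$. All $O(\cdot)$ constants depend only on $c_0$ and $\tilde\omega$, not on $x$ or $\Lambda$. A bound of the form $f(x)=O(a_\Lambda)e^{-(\kappa_\Lambda+O(\delta_\Lambda))|x|}$ means that there is a constant $C>0$ such that $|f(x)|\le C a_\Lambda e^{-(\kappa_\Lambda-C\delta_\Lambda)|x|}$ for all the $x$ considered and all $\Lambda>1$ sufficiently close to $1$ (for $x<0$, $e^{(\cdot)x}$ is $e^{-(\cdot)|x|}$). *)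

theory Defs
  imports "HOL-Analysis.Analysis"
begin

text \<open>Derivatives are taken within \<open>S\<close>, hence one-sided at an endpoint of a half-line.\<close>

definition C2_within :: "(real \<Rightarrow> real) \<Rightarrow> real set \<Rightarrow> bool" where
  "C2_within f S \<longleftrightarrow>
     (\<exists>f' f''. (\<forall>x\<in>S. (f has_real_derivative f' x) (at x within S)
                    \<and> (f' has_real_derivative f'' x) (at x within S))
              \<and> continuous_on S f'')"

definition coupled_system :: "real \<Rightarrow> real \<Rightarrow> (real \<Rightarrow> real) \<Rightarrow> (real \<Rightarrow> real) \<Rightarrow> bool" where
  "coupled_system \<Lambda> \<omega> u v \<longleftrightarrow>
     (\<exists>u' v'. \<forall>x.
        (u has_real_derivative u' x) (at x) \<and>
        (v has_real_derivative v' x) (at x) \<and>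
        (u' has_real_derivative (u x ^ 3 - u x + \<Lambda> * (v x)\<^sup>2 * u x - \<omega> * v x)) (at x) \<and>
        (v' has_real_derivative (v x ^ 3 - v x + \<Lambda> * (u x)\<^sup>2 * v x - \<omega> * u x)) (at x))"

definition u_bar :: "real \<Rightarrow> real \<Rightarrow> real" where
  "u_bar \<Lambda> \<omega> = sqrt ((1 - sqrt (1 - 4 * \<omega>\<^sup>2 / (\<Lambda> - 1)\<^sup>2)) / 2)"

definition v_bar :: "real \<Rightarrow> real \<Rightarrow> real" where
  "v_bar \<Lambda> \<omega> = sqrt ((1 + sqrt (1 - 4 * \<omega>\<^sup>2 / (\<Lambda> - 1)\<^sup>2)) / 2)"

definition phase_angle :: "(real \<Rightarrow> real) \<Rightarrow> (real \<Rightarrow> real) \<Rightarrow> real \<Rightarrow> real" where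
  "phase_angle u v x = 2 * arctan (v x / u x)"

text \<open>Heteroclinic: the limits at \<open>-\<infinity>\<close> and \<open>+\<infinity>\<close> are distinct equilibria
  of the equation.\<close>

definition heteroclinic :: "real \<Rightarrow> (real \<Rightarrow> real) \<Rightarrow> bool" where
  "heteroclinic c\<^sub>0 \<phi> \<longleftrightarrow>
     (\<forall>x. (\<phi> has_real_derivative (2 * c\<^sub>0 - sin (\<phi> x))) (at x)) \<and>
     (\<exists>a b. a \<noteq> b \<and> sin a = 2 * c\<^sub>0 \<and> sin b = 2 * c\<^sub>0 \<and>
            (\<phi> \<longlongrightarrow> a) at_bot \<and> (\<phi> \<longlongrightarrow> b) at_top)"

definition normalized_heteroclinic :: "real \<Rightarrow> (real \<Rightarrow> real) \<Rightarrow> bool" where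
  "normalized_heteroclinic c\<^sub>0 \<phi> \<longleftrightarrow>
     heteroclinic c\<^sub>0 \<phi> \<and>
     (\<forall>x. \<exists>D<0. (\<phi> has_real_derivative D) (at x)) \<and>
     \<phi> 0 = pi / 2 \<and>
     (\<forall>x. \<phi> (- x) + \<phi> x = pi)"

text \<open>The definite description is justified by \<open>ex1_normalized_heteroclinic\<close> below.\<close>

definition phi0 :: "real \<Rightarrow> real \<Rightarrow> real" where
  "phi0 c\<^sub>0 = (THE \<phi>. normalized_heteroclinic c\<^sub>0 \<phi>)"

text \<open>The meaning of \<open>f\<^sub>\<Lambda>(x) = O(a\<^sub>\<Lambda>) exp (- (\<kappa>\<^sub>\<Lambda> + O(\<delta>\<^sub>\<Lambda>)) \<bar>x\<bar>)\<close>, uniformly for \<open>x \<in> X\<close> as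
  \<open>\<Lambda> \<rightarrow> 1\<^sup>+\<close>: the same constant \<open>C\<close> serves in both places, and depends on neither \<open>x\<close> nor
  \<open>\<Lambda>\<close>.\<close>

definition exp_decay_bound ::
  "real set \<Rightarrow> (real \<Rightarrow> real) \<Rightarrow> (real \<Rightarrow> real) \<Rightarrow> (real \<Rightarrow> real) \<Rightarrow> (real \<Rightarrow> real \<Rightarrow> real) \<Rightarrow> bool"
where
  "exp_decay_bound X a \<kappa> \<delta> f \<longleftrightarrow>
     (\<exists>C>0. \<forall>\<^sub>F \<Lambda> in at_right 1. \<forall>x\<in>X.
        \<bar>f \<Lambda> x\<bar> \<le> C * a \<Lambda> * exp (- (\<kappa> \<Lambda> - C * \<delta> \<Lambda>) * \<bar>x\<bar>))"

lemma ex1_normalized_heteroclinic: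
  fixes c\<^sub>0 :: real
  assumes c: "0 < c\<^sub>0" "c\<^sub>0 < 1 / 2"
  shows "\<exists>!\<phi>. normalized_heteroclinic c\<^sub>0 \<phi>"
proof (rule ex_ex1I)
  define k where "k = sqrt (1 - 4 * c\<^sub>0\<^sup>2)"
  define a where "a = sqrt ((1 - 2 * c\<^sub>0) / (1 + 2 * c\<^sub>0))"
  define \<phi> where "\<phi> = (\<lambda>x. pi / 2 - 2 * arctan (a * tanh (k * x / 2)))"
  have fac: "1 - 4 * c\<^sub>0\<^sup>2 = (1 - 2 * c\<^sub>0) * (1 + 2 * c\<^sub>0)"
    by (simp add: algebra_simps power2_eq_square)
  have k: "k > 0" unfolding k_def fac using c by simp
  have a: "a > 0" unfolding a_def using c by simp
  have a2: "a\<^sup>2 * (1 + 2 * c\<^sub>0) = 1 - 2 * c\<^sub>0"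
    unfolding a_def using c by simp
  have ak: "a * k = 1 - 2 * c\<^sub>0"
  proof -
    have "a * k = sqrt (((1 - 2 * c\<^sub>0) / (1 + 2 * c\<^sub>0)) * ((1 - 2 * c\<^sub>0) * (1 + 2 * c\<^sub>0)))"
      unfolding a_def k_def fac by (simp only: real_sqrt_mult)
    also have "((1 - 2 * c\<^sub>0) / (1 + 2 * c\<^sub>0)) * ((1 - 2 * c\<^sub>0) * (1 + 2 * c\<^sub>0)) = (1 - 2 * c\<^sub>0)\<^sup>2"
      using c by (simp add: divide_simps power2_eq_square)
    finally show ?thesis using c by simp
  qed
  have sin\<phi>: "sin (pi / 2 - 2 * arctan t) = (1 - t\<^sup>2) / (1 + t\<^sup>2)" for t :: real
  proof -
    have "sin (pi / 2 - 2 * arctan t) = cos (2 * arctan t)"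
      by (simp add: sin_diff)
    also have "\<dots> = 2 * (cos (arctan t))\<^sup>2 - 1" by (rule cos_double_cos)
    also have "(cos (arctan t))\<^sup>2 = 1 / (1 + t\<^sup>2)"
      by (simp add: cos_arctan power_divide add_nonneg_nonneg)
    finally show ?thesis
      by (simp add: divide_simps sum_power2_gt_zero_iff add_pos_nonneg)
         (smt (verit) zero_le_power2)
  qed
  have D0: "(\<phi> has_real_derivative (- (a * k) * (1 - (tanh (k * x / 2))\<^sup>2) / (1 + (a * tanh (k * x / 2))\<^sup>2))) (at x)"
    for x
    unfolding \<phi>_def
    by (auto intro!: derivative_eq_intros simp: divide_simps power2_eq_square)
  have D: "(\<phi> has_real_derivative (2 * c\<^sub>0 - sin (\<phi> x))) (at x)" for x
  proof -
    define s where "s = tanh (k * x / 2)"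
    have p: "1 + a\<^sup>2 * s\<^sup>2 > 0" by (smt (verit) mult_nonneg_nonneg zero_le_power2)
    have "2 * c\<^sub>0 - sin (\<phi> x) = 2 * c\<^sub>0 - (1 - (a * s)\<^sup>2) / (1 + (a * s)\<^sup>2)"
      unfolding \<phi>_def s_def sin\<phi> ..
    also have "\<dots> = ((2 * c\<^sub>0 - 1) + (a\<^sup>2 * (1 + 2 * c\<^sub>0)) * s\<^sup>2) / (1 + a\<^sup>2 * s\<^sup>2)"
      using p by (simp add: power_mult_distrib divide_simps) (simp add: algebra_simps)
    also have "\<dots> = - (a * k) * (1 - s\<^sup>2) / (1 + (a * s)\<^sup>2)"
      unfolding a2 ak by (simp add: power_mult_distrib algebra_simps)
    finally show ?thesis using D0[of x] unfolding s_def by simp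
  qed
  have neg: "\<exists>D<0. (\<phi> has_real_derivative D) (at x)" for x
  proof (intro exI conjI)
    show "(\<phi> has_real_derivative (- (a * k) * (1 - (tanh (k * x / 2))\<^sup>2) / (1 + (a * tanh (k * x / 2))\<^sup>2))) (at x)"
      by (rule D0)
    have "\<bar>tanh (k * x / 2)\<bar> < 1"
      using tanh_real_bounds[of "k * x / 2"] by auto
    then have "(tanh (k * x / 2))\<^sup>2 < 1" by (simp add: abs_square_less_1)
    moreover have "1 + (a * tanh (k * x / 2))\<^sup>2 > 0" by (smt (verit) zero_le_power2)
    ultimately show "- (a * k) * (1 - (tanh (k * x / 2))\<^sup>2) / (1 + (a * tanh (k * x / 2))\<^sup>2) < 0"
      using a k by (simp add: divide_less_0_iff mult_less_0_iff mult_pos_pos)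
  qed
  have ft: "filterlim (\<lambda>x. k * x / 2) at_top at_top"
    using filterlim_tendsto_pos_mult_at_top[OF tendsto_const, of "k / 2" "\<lambda>x. x" at_top] k
    by (simp add: filterlim_ident)
  have fb: "filterlim (\<lambda>x. k * x / 2) at_bot at_bot"
    using filterlim_tendsto_pos_mult_at_bot[OF tendsto_const, of "k / 2" "\<lambda>x. x" at_bot] k
    by (simp add: filterlim_ident)
  have lt: "(\<phi> \<longlongrightarrow> pi / 2 - 2 * arctan (a * 1)) at_top"
    unfolding \<phi>_def
    by (intro tendsto_intros filterlim_compose[OF tanh_real_at_top ft])
  have lb: "(\<phi> \<longlongrightarrow> pi / 2 - 2 * arctan (a * (-1))) at_bot"
    unfolding \<phi>_def
    by (intro tendsto_intros filterlim_compose[OF tanh_real_at_bot fb])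
  have eq: "(1 - a\<^sup>2) / (1 + a\<^sup>2) = 2 * c\<^sub>0"
  proof -
    have "1 + a\<^sup>2 > 0" by (smt (verit) zero_le_power2)
    then show ?thesis using a2 by (simp add: divide_simps) (simp add: algebra_simps)
  qed
  have "heteroclinic c\<^sub>0 \<phi>"
    unfolding heteroclinic_def
  proof (intro conjI allI exI)
    show "(\<phi> \<longlongrightarrow> pi / 2 - 2 * arctan (a * 1)) at_top" by (rule lt)
    show "(\<phi> \<longlongrightarrow> pi / 2 - 2 * arctan (a * (-1))) at_bot" by (rule lb)
    show "pi / 2 - 2 * arctan (a * (-1)) \<noteq> pi / 2 - 2 * arctan (a * 1)"
      using a by (simp add: arctan_minus)
    show "sin (pi / 2 - 2 * arctan (a * 1)) = 2 * c\<^sub>0" "sin (pi / 2 - 2 * arctan (a * (-1))) = 2 * c\<^sub>0"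
      unfolding sin\<phi> using eq by simp_all
  qed (rule D)
  moreover have "\<phi> 0 = pi / 2" "\<forall>x. \<phi> (- x) + \<phi> x = pi"
    by (simp_all add: \<phi>_def arctan_minus)
  ultimately show "\<exists>\<phi>. normalized_heteroclinic c\<^sub>0 \<phi>"
    unfolding normalized_heteroclinic_def using neg by blast
next
  fix f g
  assume "normalized_heteroclinic c\<^sub>0 f" "normalized_heteroclinic c\<^sub>0 g"
  then have f: "(f has_real_derivative (2 * c\<^sub>0 - sin (f x))) (at x)" "f 0 = pi / 2"
    and g: "(g has_real_derivative (2 * c\<^sub>0 - sin (g x))) (at x)" "g 0 = pi / 2" for x
    unfolding normalized_heteroclinic_def heteroclinic_def by auto
  have lip: "\<bar>sin x - sin y\<bar> \<le> \<bar>x - y\<bar>" for x y :: real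
  proof -
    have "sin x - sin y = 2 * sin ((x - y) / 2) * cos ((x + y) / 2)" by (rule sin_diff_sin)
    then have "\<bar>sin x - sin y\<bar> = 2 * \<bar>sin ((x - y) / 2)\<bar> * \<bar>cos ((x + y) / 2)\<bar>"
      by (simp add: abs_mult)
    also have "\<dots> \<le> 2 * \<bar>sin ((x - y) / 2)\<bar> * 1"
      by (intro mult_left_mono) auto
    also have "\<dots> \<le> \<bar>x - y\<bar>" using abs_sin_x_le_abs_x[of "(x - y) / 2"] by simp
    finally show ?thesis .
  qed
  define w where "w = (\<lambda>x. (f x - g x)\<^sup>2)"
  define w' where "w' = (\<lambda>x. 2 * (f x - g x) * (sin (g x) - sin (f x)))"
  have w0: "w 0 = 0" and wpos: "w x \<ge> 0" for x by (auto simp: w_def f g)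
  have dw: "(w has_real_derivative w' x) (at x)" for x
    unfolding w_def w'_def by (auto intro!: derivative_eq_intros f(1) g(1))
  have bw: "\<bar>w' x\<bar> \<le> 2 * w x" for x
  proof -
    have "\<bar>w' x\<bar> = 2 * \<bar>f x - g x\<bar> * \<bar>sin (g x) - sin (f x)\<bar>"
      unfolding w'_def abs_mult by simp
    also have "\<dots> \<le> 2 * \<bar>f x - g x\<bar> * \<bar>f x - g x\<bar>"
      using lip[of "g x" "f x"] by (intro mult_left_mono) (auto simp: abs_minus_commute)
    also have "\<dots> = 2 * w x" by (simp add: w_def power2_eq_square)
    finally show ?thesis .
  qed
  have "w x = 0" for x
  proof (cases "x \<ge> 0")
    case True
    have "w x * exp (- 2 * x) \<le> w 0 * exp (- 2 * 0)"
    proof (rule DERIV_nonpos_imp_nonincreasing[OF True])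
      fix t
      have "((\<lambda>x. w x * exp (- 2 * x)) has_real_derivative (w' t - 2 * w t) * exp (- 2 * t)) (at t)"
        by (auto intro!: derivative_eq_intros dw simp: algebra_simps)
      moreover have "(w' t - 2 * w t) * exp (- 2 * t) \<le> 0"
        using bw[of t] by (intro mult_nonpos_nonneg) auto
      ultimately show "\<exists>y. ((\<lambda>x. w x * exp (- 2 * x)) has_real_derivative y) (at t) \<and> y \<le> 0"
        by blast
    qed
    then have "w x * exp (- 2 * x) \<le> 0" by (simp add: w0)
    then show ?thesis using wpos[of x] by (simp add: mult_le_0_iff)
  next
    case False
    then have "x \<le> 0" by simp
    have "w x * exp (2 * x) \<le> w 0 * exp (2 * 0)"
    proof (rule DERIV_nonneg_imp_nondecreasing[OF \<open>x \<le> 0\<close>])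
      fix t
      have "((\<lambda>x. w x * exp (2 * x)) has_real_derivative (w' t + 2 * w t) * exp (2 * t)) (at t)"
        by (auto intro!: derivative_eq_intros dw simp: algebra_simps)
      moreover have "(w' t + 2 * w t) * exp (2 * t) \<ge> 0"
        using bw[of t] by (intro mult_nonneg_nonneg) auto
      ultimately show "\<exists>y. ((\<lambda>x. w x * exp (2 * x)) has_real_derivative y) (at t) \<and> 0 \<le> y"
        by blast
    qed
    then have "w x * exp (2 * x) \<le> 0" by (simp add: w0)
    then show ?thesis using wpos[of x] by (simp add: mult_le_0_iff)
  qed
  then show "f = g" by (auto simp: w_def)
qed

end

theory Submission
  imports Defs
begin

text \<open>
  Put \<open>\<epsilon>\<^sup>2 = \<Lambda> - 1\<close> and \<open>\<omega> = \<epsilon>\<^sup>2 c\<close>, so that \<open>c = c\<^sub>0 + O(\<epsilon>)\<close>. The system is Newton's equation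
  \<open>(u, v)'' = \<nabla>W\<close> for

  \<open>W = (u\<^sup>2 + v\<^sup>2 - 1)\<^sup>2 / 4 + \<epsilon>\<^sup>2 (u v - c)\<^sup>2 / 2 \<ge> 0\<close>,

  whose zeros in the open quadrant are the two prescribed limits; a connection between them has
  energy zero. In polar coordinates \<open>u = \<surd>R cos (\<phi>/2)\<close>, \<open>v = \<surd>R sin (\<phi>/2)\<close> the radius is stiff and
  stays within \<open>O(\<epsilon>\<^sup>2)\<close> of \<open>1\<close>, and to leading order \<open>\<phi>' = \<epsilon> (2 c - sin \<phi>)\<close>.

  The angle is monotone, hence it can serve as the independent variable. Define \<open>\<tau>\<close> by
  \<open>\<phi> = het c (\<epsilon> \<tau>)\<close>, where \<open>het c\<close> is the heteroclinic of the reduced equation, an explicit function.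
  Conservation of energy determines the speed \<open>d\<tau>/dx\<close> algebraically, which replaces the angular
  equation, and the virial identity expresses \<open>R''\<close> through \<open>R\<close> and \<open>\<phi>\<close> alone. What remains is
  one second-order equation for the radius with known coefficients. The ansatz
  \<open>R = 1 + \<epsilon>\<^sup>2 y A\<close>, \<open>R' = \<epsilon>\<^sup>2 y B\<close> with \<open>y = sin \<phi> - 2 c\<close> builds in the exponential decay, so
  that \<open>A\<close> and \<open>B\<close> have only to be bounded functions of \<open>\<tau>\<close>. They satisfy
  \<open>dA/d\<tau> = B + O(\<epsilon>)\<close> and \<open>dB/d\<tau> = 2 A + f + O(\<epsilon>)\<close> with \<open>f\<close> known and bounded. This is a hyperbolic
  linear system with a small Lipschitz perturbation, so it has a bounded solution.

  The symmetry \<open>u(-x) = v(x)\<close> means that \<open>A\<close> is even and \<open>B\<close> is odd. For the diagonal modes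
  \<open>X = B + \<surd>2 A\<close> and \<open>Y = B - \<surd>2 A\<close> this reads \<open>Y(\<tau>) = - X(-\<tau>)\<close>, which turns the system into one
  scalar equation with a reflected argument. \<open>reflected_ode_bounded_solution\<close> solves it by a
  contraction, and \<open>radial_profile_ex\<close> applies this for all \<open>c\<close> in \<open>(0, 1/2)\<close> and \<open>\<epsilon> \<le> 1/100\<close>, with
  absolute constants. \<open>time_change\<close> returns from \<open>\<tau>\<close> to \<open>x\<close> with a relative error \<open>O(\<epsilon>\<^sup>2)\<close>, and
  \<open>polar_coupled_system\<close> recovers the system from the energy and the virial identities.

  Since \<open>\<phi>\<close> is the explicit function \<open>het c\<close> evaluated at \<open>\<epsilon> \<tau> = \<epsilon> x (1 + O(\<epsilon>\<^sup>2))\<close>, all the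
  asymptotic statements follow from the formula for \<open>het\<close>: the decay of \<open>y\<close> at the rate
  \<open>\<surd>(1 - 4 c\<^sup>2)\<close>, and the Lipschitz dependence on \<open>c\<close> and on a relative change of the argument.
\<close>

section \<open>Bounded solutions of a semilinear reflected equation\<close>

lemma ex_antiderivative_real:
  fixes f :: "real \<Rightarrow> real"
  assumes "continuous_on UNIV f"
  shows "\<exists>F. \<forall>x. (F has_real_derivative f x) (at x)"
proof -
  have "isCont f x" for x
    using assms by (simp add: continuous_on_eq_continuous_at)
  then show ?thesis
    using einterval_antiderivative[of "-\<infinity>" "\<infinity>" f]
    by (auto simp: has_real_derivative_iff_has_vector_derivative)
qed

text \<open>The homogeneous solutions \<open>exp (\<kappa> t)\<close> are unbounded, so a bounded solution is controlled by its
  right-hand side, without any initial condition. This gives uniqueness and, applied to differences,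
  the contraction estimate.\<close>
lemma bounded_solution_bound:
  fixes z h :: "real \<Rightarrow> real"
  assumes \<kappa>: "\<kappa> > 0"
    and z: "\<And>t. (z has_real_derivative \<kappa> * z t + h t) (at t)"
    and h: "\<And>t. \<bar>h t\<bar> \<le> K"
    and bd: "\<And>t. \<bar>z t\<bar> \<le> M"
  shows "\<bar>z t\<bar> \<le> K / \<kappa>"
proof -
  define E where "E = (\<lambda>t. exp (- \<kappa> * t))"
  have K: "K \<ge> 0" using h[of 0] by linarith
  have lim: "(E \<longlongrightarrow> 0) at_top"
    unfolding E_def using \<kappa>
    by (intro filterlim_compose[OF exp_at_bot] filterlim_tendsto_neg_mult_at_bot[OF tendsto_const _ filterlim_ident]) auto
  \<comment> \<open>The two signs \<open>\<sigma>\<close> give the lower and the upper bound: \<open>exp (- \<kappa> t) \<sigma> (z + \<sigma> K / \<kappa>)\<close> is nonincreasing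
  and tends to \<open>0\<close>, hence it is nonnegative.\<close>
  have up: "E t * (z t + \<sigma> * K / \<kappa>) * \<sigma> \<ge> 0" if \<sigma>: "\<sigma> = 1 \<or> \<sigma> = -1" for \<sigma> :: real
  proof -
    define w where "w = (\<lambda>t. E t * (z t + \<sigma> * K / \<kappa>) * \<sigma>)"
    have dw: "(w has_real_derivative E t * (\<sigma> * h t - K)) (at t)" for t
    proof -
      have "\<sigma> * \<sigma> = 1" using \<sigma> by auto
      then have "E t * (\<kappa> * z t + h t) * \<sigma> - \<kappa> * E t * (z t + \<sigma> * K / \<kappa>) * \<sigma>
          = E t * (\<sigma> * h t - K)"
        using \<kappa> \<sigma> by (auto simp: field_simps)
      moreover have "(w has_real_derivative E t * (\<kappa> * z t + h t) * \<sigma> - \<kappa> * E t * (z t + \<sigma> * K / \<kappa>) * \<sigma>) (at t)"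
        unfolding w_def E_def
        by (rule derivative_eq_intros z refl)+ (simp, simp only: left_diff_distrib right_diff_distrib mult_ac)
      ultimately show ?thesis by simp
    qed
    have "w s \<le> w t" if "t \<le> s" for s
    proof (rule DERIV_nonpos_imp_nonincreasing[OF that])
      fix r
      have "\<sigma> * h r \<le> K" using h[of r] \<sigma> by auto
      then have "E r * (\<sigma> * h r - K) \<le> 0"
        by (intro mult_nonneg_nonpos) (auto simp: E_def)
      then show "\<exists>d. (w has_real_derivative d) (at r) \<and> d \<le> 0" using dw by blast
    qed
    moreover have "(w \<longlongrightarrow> 0) at_top"
    proof (rule tendsto_0_le[OF lim, where K = "M + K / \<kappa>"])
      have "norm (w s) \<le> norm (E s) * (M + K / \<kappa>)" for s
      proof -
        have "\<bar>z s + \<sigma> * K / \<kappa>\<bar> \<le> \<bar>z s\<bar> + K / \<kappa>"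
        proof -
          have "K / \<kappa> \<ge> 0" using K \<kappa> by simp
          then show ?thesis using \<sigma> by auto
        qed
        then have "\<bar>z s + \<sigma> * K / \<kappa>\<bar> \<le> M + K / \<kappa>" using bd[of s] by simp
        then have "\<bar>E s\<bar> * \<bar>z s + \<sigma> * K / \<kappa>\<bar> \<le> \<bar>E s\<bar> * (M + K / \<kappa>)"
          by (rule mult_left_mono) simp
        moreover have "\<bar>w s\<bar> = \<bar>E s\<bar> * \<bar>z s + \<sigma> * K / \<kappa>\<bar>"
        proof -
          have "\<bar>\<sigma>\<bar> = 1" using \<sigma> by auto
          then show ?thesis unfolding w_def by (simp only: abs_mult mult_1_right)
        qed
        ultimately show ?thesis by simp
      qed
      then show "\<forall>\<^sub>F s in at_top. norm (w s) \<le> norm (E s) * (M + K / \<kappa>)" by simp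
    qed
    ultimately have "0 \<le> w t"
      by (intro tendsto_upperbound[of w 0 at_top "w t"] eventually_mono[OF eventually_ge_at_top[of t]]) auto
    then show ?thesis by (simp add: w_def)
  qed
  have "E t > 0" by (simp add: E_def)
  then show ?thesis using up[of 1] up[of "-1"]
    by (auto simp: zero_le_mult_iff mult_le_0_iff)
qed

text \<open>The solution is \<open>exp (\<kappa> t) (J t - L)\<close> where \<open>J\<close> is an antiderivative of \<open>exp (- \<kappa> t) g t\<close> and
  \<open>L\<close> its limit at \<open>+\<infinity>\<close>. Instead of an improper integral, \<open>L\<close> is obtained as a number
  separating the nondecreasing function \<open>J - K / \<kappa> exp (- \<kappa> t)\<close> from the nonincreasing function
  \<open>J + K / \<kappa> exp (- \<kappa> t)\<close>; this yields the bound on the solution at the same time.\<close>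
lemma bounded_solution_ex:
  fixes g :: "real \<Rightarrow> real"
  assumes \<kappa>: "\<kappa> > 0" and g: "continuous_on UNIV g" and K: "\<And>t. \<bar>g t\<bar> \<le> K"
  shows "\<exists>z. (\<forall>t. (z has_real_derivative \<kappa> * z t + g t) (at t)) \<and> (\<forall>t. \<bar>z t\<bar> \<le> K / \<kappa>)"
proof -
  define E where "E = (\<lambda>t. exp (- \<kappa> * t))"
  have E: "E t > 0" for t by (simp add: E_def)
  have "continuous_on UNIV (\<lambda>t. E t * g t)"
    unfolding E_def by (intro continuous_intros g)
  then obtain J where J: "\<And>t. (J has_real_derivative E t * g t) (at t)"
    using ex_antiderivative_real by blast
  define lo hi where "lo = (\<lambda>t. J t - K / \<kappa> * E t)" and "hi = (\<lambda>t. J t + K / \<kappa> * E t)"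
  have K0: "K \<ge> 0" using K[of 0] by linarith
  have dlo: "(lo has_real_derivative E t * (g t + K)) (at t)"
    and dhi: "(hi has_real_derivative E t * (g t - K)) (at t)" for t
  proof -
    have dE: "(E has_real_derivative E t * - \<kappa>) (at t)" for t
      unfolding E_def by (rule derivative_eq_intros refl)+ simp
    have *: "K / \<kappa> * (E t * - \<kappa>) = - (E t * K)" using \<kappa> by simp
    show "(lo has_real_derivative E t * (g t + K)) (at t)"
      unfolding lo_def
      by (rule DERIV_cong[OF DERIV_diff[OF J DERIV_cmult[OF dE]]]) (simp only: *, simp add: distrib_left)
    show "(hi has_real_derivative E t * (g t - K)) (at t)"
      unfolding hi_def
      by (rule DERIV_cong[OF DERIV_add[OF J DERIV_cmult[OF dE]]]) (simp only: *, simp add: right_diff_distrib)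
  qed
  have lo_mono: "lo s \<le> lo t" if "s \<le> t" for s t
  proof (rule DERIV_nonneg_imp_nondecreasing[OF that])
    fix r
    have "E r * (g r + K) \<ge> 0" using K[of r] E[of r] by (intro mult_nonneg_nonneg) auto
    then show "\<exists>d. (lo has_real_derivative d) (at r) \<and> 0 \<le> d" using dlo by blast
  qed
  have hi_anti: "hi t \<le> hi s" if "s \<le> t" for s t
  proof (rule DERIV_nonpos_imp_nonincreasing[OF that])
    fix r
    have "E r * (g r - K) \<le> 0" using K[of r] E[of r] by (intro mult_nonneg_nonpos) auto
    then show "\<exists>d. (hi has_real_derivative d) (at r) \<and> d \<le> 0" using dhi by blast
  qed
  have lohi: "lo s \<le> hi t" for s t
  proof -
    have "lo s \<le> lo (max s t)" by (rule lo_mono) simp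
    also have "\<dots> \<le> hi (max s t)"
      using E[of "max s t"] K0 \<kappa> unfolding lo_def hi_def
      by (simp add: add_increasing2 mult_nonneg_nonneg)
    also have "\<dots> \<le> hi t" by (rule hi_anti) simp
    finally show ?thesis .
  qed
  define L where "L = (SUP s. lo s)"
  have L: "lo t \<le> L" "L \<le> hi t" for t
  proof -
    have "bdd_above (range lo)" by (rule bdd_aboveI[of _ "hi 0"]) (auto intro: lohi)
    then show "lo t \<le> L" unfolding L_def by (intro cSUP_upper) auto
    show "L \<le> hi t" unfolding L_def by (intro cSUP_least) (auto intro: lohi)
  qed
  define z where "z = (\<lambda>t. exp (\<kappa> * t) * (J t - L))"
  have eE: "exp (\<kappa> * t) * E t = 1" for t by (simp add: E_def flip: exp_add)
  have "(z has_real_derivative \<kappa> * z t + g t) (at t)" for t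
  proof -
    have "(z has_real_derivative exp (\<kappa> * t) * \<kappa> * (J t - L) + exp (\<kappa> * t) * (E t * g t)) (at t)"
      unfolding z_def by (rule derivative_eq_intros J refl)+ simp
    moreover have "exp (\<kappa> * t) * \<kappa> * (J t - L) = \<kappa> * z t" by (simp add: z_def)
    moreover have "exp (\<kappa> * t) * (E t * g t) = g t"
      using eE[of t] by (simp flip: mult.assoc)
    ultimately show ?thesis by (simp only:)
  qed
  moreover have "\<bar>z t\<bar> \<le> K / \<kappa>" for t
  proof -
    have "\<bar>J t - L\<bar> \<le> K / \<kappa> * E t" using L[of t] unfolding lo_def hi_def by linarith
    then have "exp (\<kappa> * t) * \<bar>J t - L\<bar> \<le> exp (\<kappa> * t) * (K / \<kappa> * E t)"
      by (intro mult_left_mono) auto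
    also have "\<dots> = K / \<kappa> * (exp (\<kappa> * t) * E t)" by (simp only: mult_ac)
    also have "\<dots> = K / \<kappa>" by (simp only: eE mult_1_right)
    finally show ?thesis unfolding z_def by (simp add: abs_mult)
  qed
  ultimately show ?thesis by blast
qed

text \<open>Banach's theorem for the map that sends \<open>x\<close> to the bounded solution \<open>z\<close> of
  \<open>z' = \<kappa> z + F t (x t) (- x (- t))\<close>, on the ball of radius \<open>M\<close> in the space of bounded continuous
  functions. The factor \<open>2\<close> in \<open>2 L < \<kappa>\<close> appears because \<open>x\<close> enters twice, directly and reflected.\<close>
lemma reflected_ode_bounded_solution:
  fixes F :: "real \<Rightarrow> real \<Rightarrow> real \<Rightarrow> real"
  assumes \<kappa>: "\<kappa> > 0" and M: "M \<ge> 0"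
    and cont: "\<And>x y. continuous_on UNIV x \<Longrightarrow> continuous_on UNIV y \<Longrightarrow>
          (\<And>t. \<bar>x t\<bar> \<le> M \<and> \<bar>y t\<bar> \<le> M) \<Longrightarrow> continuous_on UNIV (\<lambda>t. F t (x t) (y t))"
    and bd: "\<And>t x y. \<bar>x\<bar> \<le> M \<Longrightarrow> \<bar>y\<bar> \<le> M \<Longrightarrow> \<bar>F t x y\<bar> \<le> \<kappa> * M"
    and lip: "\<And>t x y x' y'. \<bar>x\<bar> \<le> M \<Longrightarrow> \<bar>y\<bar> \<le> M \<Longrightarrow> \<bar>x'\<bar> \<le> M \<Longrightarrow> \<bar>y'\<bar> \<le> M \<Longrightarrow>
          \<bar>F t x y - F t x' y'\<bar> \<le> L * (\<bar>x - x'\<bar> + \<bar>y - y'\<bar>)"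
    and L: "0 \<le> L" "2 * L < \<kappa>"
  shows "\<exists>x. (\<forall>t. (x has_real_derivative \<kappa> * x t + F t (x t) (- x (- t))) (at t))
           \<and> (\<forall>t. \<bar>x t\<bar> \<le> M)"
proof -
  define S where "S = cball (0 :: real \<Rightarrow>\<^sub>C real) M"
  define N where "N = (\<lambda>x t. F t (apply_bcontfun x t) (- apply_bcontfun x (- t)))"
  have S: "x \<in> S \<longleftrightarrow> (\<forall>t. \<bar>apply_bcontfun x t\<bar> \<le> M)" for x
  proof
    assume "x \<in> S"
    then have "norm x \<le> M" by (simp add: S_def)
    then show "\<forall>t. \<bar>apply_bcontfun x t\<bar> \<le> M"
      using norm_bounded[of x] by (auto intro: order_trans)
  next
    assume "\<forall>t. \<bar>apply_bcontfun x t\<bar> \<le> M"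
    then show "x \<in> S" using norm_bound[of x M] by (simp add: S_def)
  qed
  have solution: "\<exists>z. (\<forall>t. (apply_bcontfun z has_real_derivative \<kappa> * apply_bcontfun z t + N x t) (at t))
                    \<and> z \<in> S" if x: "x \<in> S" for x
  proof -
    have "continuous_on UNIV (\<lambda>t. - apply_bcontfun x (- t))"
      by (intro continuous_intros continuous_on_compose2[OF continuous_on_apply_bcontfun[of UNIV x]]) auto
    then have "continuous_on UNIV (N x)"
      unfolding N_def using x by (intro cont) (auto simp: S)
    moreover have "\<bar>N x t\<bar> \<le> \<kappa> * M" for t
      unfolding N_def using x by (intro bd) (auto simp: S)
    ultimately obtain z where z: "\<And>t. (z has_real_derivative \<kappa> * z t + N x t) (at t)"
      and zM: "\<And>t. \<bar>z t\<bar> \<le> \<kappa> * M / \<kappa>"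
      using bounded_solution_ex[OF \<kappa>] by blast
    have "continuous_on UNIV z"
      using z by (intro continuous_at_imp_continuous_on) (auto intro: DERIV_isCont)
    then have "z \<in> bcontfun" using zM by (intro bcontfun_normI) auto
    then have "apply_bcontfun (Bcontfun z) = z" by (rule Bcontfun_inverse)
    then show ?thesis using z zM \<kappa> by (intro exI[of _ "Bcontfun z"]) (auto simp: S)
  qed
  then obtain T where
    T: "\<And>x t. x \<in> S \<Longrightarrow> (apply_bcontfun (T x) has_real_derivative \<kappa> * apply_bcontfun (T x) t + N x t) (at t)"
    and TS: "\<And>x. x \<in> S \<Longrightarrow> T x \<in> S"
    by metis
  have contraction: "dist (T x) (T y) \<le> 2 * L / \<kappa> * dist x y" if x: "x \<in> S" and y: "y \<in> S" for x y
  proof (rule dist_bound)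
    fix t
    have diff: "\<bar>N x r - N y r\<bar> \<le> L * (2 * dist x y)" for r
    proof -
      have "\<bar>N x r - N y r\<bar> \<le> L * (\<bar>apply_bcontfun x r - apply_bcontfun y r\<bar>
          + \<bar>- apply_bcontfun x (- r) - - apply_bcontfun y (- r)\<bar>)"
        unfolding N_def using x y by (intro lip) (auto simp: S)
      also have "\<dots> \<le> L * (2 * dist x y)"
        using dist_bounded[of x r y] dist_bounded[of x "-r" y]
        by (intro mult_left_mono L) (auto simp: dist_real_def)
      finally show ?thesis .
    qed
    have deriv: "((\<lambda>t. apply_bcontfun (T x) t - apply_bcontfun (T y) t) has_real_derivative
        \<kappa> * (apply_bcontfun (T x) r - apply_bcontfun (T y) r) + (N x r - N y r)) (at r)" for r
      by (rule DERIV_cong[OF DERIV_diff[OF T[OF x] T[OF y]]]) (simp add: algebra_simps)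
    have bounded: "\<bar>apply_bcontfun (T x) r - apply_bcontfun (T y) r\<bar> \<le> 2 * M" for r
    proof -
      have "\<bar>apply_bcontfun (T x) r\<bar> \<le> M" "\<bar>apply_bcontfun (T y) r\<bar> \<le> M"
        using TS[OF x] TS[OF y] unfolding S by auto
      then show ?thesis by linarith
    qed
    have "\<bar>apply_bcontfun (T x) t - apply_bcontfun (T y) t\<bar> \<le> L * (2 * dist x y) / \<kappa>"
      by (rule bounded_solution_bound[OF \<kappa> deriv diff bounded])
    then show "dist (apply_bcontfun (T x) t) (apply_bcontfun (T y) t) \<le> 2 * L / \<kappa> * dist x y"
      by (simp add: dist_real_def mult_ac)
  qed
  have "\<exists>!x. x \<in> S \<and> T x = x"
  proof (rule Banach_fix[of S "2 * L / \<kappa>" T])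
    show "complete S" unfolding S_def by (simp add: complete_eq_closed)
    show "S \<noteq> {}" unfolding S_def using M by (auto intro: exI[of _ 0])
  qed (use TS contraction L \<kappa> in auto)
  then obtain x where "x \<in> S" "T x = x" by blast
  with T[of x] show ?thesis unfolding N_def S by auto
qed

section \<open>The explicit heteroclinic of the reduced equation\<close>

text \<open>The linearization of \<open>2 c - sin \<phi>\<close> at its two zeros in \<open>(0, \<pi>)\<close> has the eigenvalues \<open>\<plusminus> het_rate c\<close>.\<close>
definition het_rate :: "real \<Rightarrow> real" where
  "het_rate c = sqrt (1 - 4 * c\<^sup>2)"

text \<open>The two zeros of \<open>2 c - sin \<phi>\<close> in \<open>(0, \<pi>)\<close> are \<open>\<pi>/2 \<plusminus> 2 arctan (het_amp c)\<close>.\<close>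
definition het_amp :: "real \<Rightarrow> real" where
  "het_amp c = sqrt ((1 - 2 * c) / (1 + 2 * c))"

text \<open>The substitution \<open>T = tan (\<pi>/4 - \<phi>/2)\<close> turns \<open>\<phi>' = 2 c - sin \<phi>\<close> into the Riccati equation
  \<open>2 T' = (1 - 2 c) - (1 + 2 c) T\<^sup>2\<close>, which is solved by a multiple of \<open>tanh\<close>.\<close>
definition het :: "real \<Rightarrow> real \<Rightarrow> real" where
  "het c x = pi / 2 - 2 * arctan (het_amp c * tanh (het_rate c * x / 2))"

lemma het_rate_factor: "1 - 4 * c\<^sup>2 = (1 - 2 * c) * (1 + 2 * c)" for c :: real
  by (simp add: algebra_simps power2_eq_square)

lemma het_minus: "het c (- x) = pi - het c x"
  by (simp add: het_def arctan_minus)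

context
  fixes c :: real
  assumes c: "0 < c" "c < 1 / 2"
begin

lemma het_rate_bounds: "0 < het_rate c" "het_rate c < 1"
proof -
  have "0 < 1 - 4 * c\<^sup>2" unfolding het_rate_factor using c by simp
  then show "0 < het_rate c" "het_rate c < 1" using c by (auto simp: het_rate_def)
qed

lemma het_amp_bounds: "0 < het_amp c" "het_amp c < 1"
  using c unfolding het_amp_def by (auto simp: divide_simps)

lemma het_amp_sq: "(het_amp c)\<^sup>2 * (1 + 2 * c) = 1 - 2 * c"
  using c unfolding het_amp_def by simp

lemma het_amp_rate: "het_amp c * het_rate c = 1 - 2 * c"
proof -
  have "het_amp c * het_rate c
      = sqrt (((1 - 2 * c) / (1 + 2 * c)) * ((1 - 2 * c) * (1 + 2 * c)))"
    unfolding het_amp_def het_rate_def het_rate_factor by (simp only: real_sqrt_mult)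
  also have "((1 - 2 * c) / (1 + 2 * c)) * ((1 - 2 * c) * (1 + 2 * c)) = (1 - 2 * c)\<^sup>2"
    using c by (simp add: divide_simps power2_eq_square)
  finally show ?thesis using c by simp
qed

lemma het_amp_mult: "het_amp c * (1 + 2 * c) = het_rate c"
proof -
  have "het_amp c * (het_amp c * (1 + 2 * c)) = het_amp c * het_rate c"
    using het_amp_sq het_amp_rate by (simp add: power2_eq_square mult.assoc)
  then show ?thesis using het_amp_bounds by simp
qed

end

lemma sin_half_pi_minus_double_arctan:
  "sin (pi / 2 - 2 * arctan t) = (1 - t\<^sup>2) / (1 + t\<^sup>2)"
  and cos_half_pi_minus_double_arctan:
  "cos (pi / 2 - 2 * arctan t) = 2 * t / (1 + t\<^sup>2)" for t :: real
proof -
  have p: "1 + t\<^sup>2 > 0" by (simp add: add_pos_nonneg)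
  then have q: "sqrt (1 + t\<^sup>2) * sqrt (1 + t\<^sup>2) = 1 + t\<^sup>2" by simp
  have c2: "(cos (arctan t))\<^sup>2 = 1 / (1 + t\<^sup>2)"
    using p by (simp add: cos_arctan power_divide)
  have "sin (pi / 2 - 2 * arctan t) = 2 * (cos (arctan t))\<^sup>2 - 1"
    by (simp add: sin_diff cos_double_cos)
  also have "\<dots> = (1 - t\<^sup>2) / (1 + t\<^sup>2)"
    unfolding c2 using p by (simp add: field_simps)
  finally show "sin (pi / 2 - 2 * arctan t) = (1 - t\<^sup>2) / (1 + t\<^sup>2)" .
  have "cos (pi / 2 - 2 * arctan t) = 2 * sin (arctan t) * cos (arctan t)"
    by (simp add: cos_diff sin_double)
  also have "\<dots> = 2 * t / (1 + t\<^sup>2)"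
    using q by (simp add: sin_arctan cos_arctan)
  finally show "cos (pi / 2 - 2 * arctan t) = 2 * t / (1 + t\<^sup>2)" .
qed

lemma abs_arctan_diff_le: "\<bar>arctan s - arctan t\<bar> \<le> \<bar>s - t\<bar>"
proof -
  have "\<bar>arctan a - arctan b\<bar> \<le> 1 * \<bar>a - b\<bar>" for a b
  proof -
    have "norm (arctan a - arctan b) \<le> 1 * norm (a - b)"
    proof (rule field_differentiable_bound[of UNIV arctan "\<lambda>x. inverse (1 + x\<^sup>2)"])
      show "norm (inverse (1 + z\<^sup>2)) \<le> 1" for z :: real
        by (simp add: inverse_le_1_iff)
    qed (auto intro!: DERIV_arctan[THEN DERIV_subset])
    then show ?thesis by simp
  qed
  then show ?thesis by simp
qed

lemma one_minus_abs_tanh_le: "1 - \<bar>tanh z\<bar> \<le> 2 * exp (- (2 * \<bar>z\<bar>))" for z :: real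
proof -
  define q where "q = exp (- 2 * \<bar>z\<bar>)"
  have q: "q > 0" by (simp add: q_def)
  have "tanh \<bar>z\<bar> = (1 - q) / (1 + q)"
    unfolding q_def by (rule tanh_real_altdef)
  then have "\<bar>tanh z\<bar> = (1 - q) / (1 + q)" by (simp only: tanh_real_abs)
  then have "1 - \<bar>tanh z\<bar> = 2 * q / (1 + q)" using q by (simp add: field_simps)
  also have "\<dots> \<le> 2 * q" using q by (simp add: divide_simps)
  finally show ?thesis by (simp add: q_def)
qed

context
  fixes c :: real
  assumes c: "0 < c" "c < 1 / 2"
begin

text \<open>The quantity \<open>sin \<phi> - 2 c\<close> is minus the derivative of \<open>het c\<close>. It is the factor \<open>y\<close> by which the radial
  perturbation decays.\<close>
lemma het_excess:
  "sin (het c x) - 2 * c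
     = (1 - 2 * c) * (1 - (tanh (het_rate c * x / 2))\<^sup>2)
        / (1 + (het_amp c * tanh (het_rate c * x / 2))\<^sup>2)"
proof -
  define s where "s = tanh (het_rate c * x / 2)"
  define a where "a = het_amp c"
  have p: "1 + a\<^sup>2 * s\<^sup>2 > 0" by (simp add: add_pos_nonneg)
  have "sin (het c x) - 2 * c = (1 - (a * s)\<^sup>2) / (1 + (a * s)\<^sup>2) - 2 * c"
    unfolding het_def s_def a_def sin_half_pi_minus_double_arctan ..
  also have "\<dots> = ((1 - 2 * c) - (a\<^sup>2 * (1 + 2 * c)) * s\<^sup>2) / (1 + a\<^sup>2 * s\<^sup>2)"
    using p by (simp add: power_mult_distrib divide_simps) (simp add: algebra_simps)
  also have "\<dots> = (1 - 2 * c) * (1 - s\<^sup>2) / (1 + (a * s)\<^sup>2)"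
    unfolding a_def het_amp_sq[OF c] by (simp add: power_mult_distrib algebra_simps)
  finally show ?thesis by (simp add: s_def a_def)
qed

lemma DERIV_het: "(het c has_real_derivative 2 * c - sin (het c x)) (at x)"
proof -
  define s where "s = tanh (het_rate c * x / 2)"
  have "(het c has_real_derivative
      (- (het_amp c * het_rate c) * (1 - s\<^sup>2) / (1 + (het_amp c * s)\<^sup>2))) (at x)"
    unfolding het_def s_def
    by (auto intro!: derivative_eq_intros simp: divide_simps power2_eq_square)
  moreover have "- (het_amp c * het_rate c) * (1 - s\<^sup>2) / (1 + (het_amp c * s)\<^sup>2)
      = 2 * c - sin (het c x)"
    using het_excess[of x]
    unfolding het_amp_rate[OF c] s_def mult_minus_left minus_divide_left[symmetric] by linarith
  ultimately show ?thesis by simp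
qed

lemma het_excess_pos: "sin (het c x) - 2 * c > 0"
  and het_excess_le: "sin (het c x) - 2 * c \<le> 4 * exp (- (het_rate c * \<bar>x\<bar>))"
proof -
  define s where "s = tanh (het_rate c * x / 2)"
  define D where "D = 1 + (het_amp c * s)\<^sup>2"
  have D: "D \<ge> 1" by (simp add: D_def)
  have s: "\<bar>s\<bar> < 1" unfolding s_def using tanh_real_bounds[of "het_rate c * x / 2"] by auto
  then have s2: "1 - s\<^sup>2 > 0" by (simp add: abs_square_less_1)
  have eq: "sin (het c x) - 2 * c = (1 - 2 * c) * (1 - s\<^sup>2) / D"
    using het_excess by (simp add: s_def D_def)
  then show "sin (het c x) - 2 * c > 0" using s2 D c by simp
  have "(1 - 2 * c) * (1 - s\<^sup>2) / D \<le> (1 - 2 * c) * (1 - s\<^sup>2) / 1"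
    using s2 D c by (intro divide_left_mono) auto
  also have "\<dots> \<le> 1 * (1 - s\<^sup>2)" using s2 c by simp
  also have "\<dots> = (1 - \<bar>s\<bar>) * (1 + \<bar>s\<bar>)" by (simp add: algebra_simps power2_eq_square)
  also have "\<dots> \<le> (1 - \<bar>s\<bar>) * 2" using s by (intro mult_left_mono) auto
  also have "\<dots> \<le> 4 * exp (- (2 * \<bar>het_rate c * x / 2\<bar>))"
    using one_minus_abs_tanh_le[of "het_rate c * x / 2"] unfolding s_def by simp
  also have "2 * \<bar>het_rate c * x / 2\<bar> = het_rate c * \<bar>x\<bar>"
    using het_rate_bounds[OF c] by (simp add: abs_mult)
  finally show "sin (het c x) - 2 * c \<le> 4 * exp (- (het_rate c * \<bar>x\<bar>))" unfolding eq .
qed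

lemma het_range: "0 < het c x" "het c x < pi"
proof -
  have "\<bar>het_amp c * tanh (het_rate c * x / 2)\<bar> < 1 * 1"
    unfolding abs_mult
    using het_amp_bounds[OF c] tanh_real_bounds[of "het_rate c * x / 2"]
    by (intro mult_strict_mono) auto
  then have "arctan (- 1) < arctan (het_amp c * tanh (het_rate c * x / 2))"
    "arctan (het_amp c * tanh (het_rate c * x / 2)) < arctan 1"
    by (simp_all only: arctan_less_iff abs_less_iff, auto)
  then show "0 < het c x" "het c x < pi" by (simp_all add: het_def arctan_one arctan_minus)
qed

lemma het_at_bot_bound:
  assumes "x \<le> 0"
  shows "\<bar>het c x - (pi / 2 + 2 * arctan (het_amp c))\<bar> \<le> 4 * exp (- (het_rate c * \<bar>x\<bar>))"
proof -
  define s where "s = tanh (het_rate c * x / 2)"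
  have s: "-1 < s" "s \<le> 0"
    unfolding s_def using tanh_real_bounds[of "het_rate c * x / 2"] assms het_rate_bounds[OF c]
    by (auto simp: mult_nonneg_nonpos)
  have "\<bar>het c x - (pi / 2 + 2 * arctan (het_amp c))\<bar>
      = 2 * \<bar>arctan (het_amp c * s) - arctan (- het_amp c)\<bar>"
    unfolding het_def s_def by (simp add: arctan_minus abs_if)
  also have "\<dots> \<le> 2 * \<bar>het_amp c * s - - het_amp c\<bar>"
    by (intro mult_left_mono abs_arctan_diff_le) simp
  also have "\<dots> = 2 * (het_amp c * (1 + s))"
  proof -
    have "het_amp c * s - - het_amp c = het_amp c * (1 + s)" by (simp add: distrib_left)
    moreover have "het_amp c * (1 + s) \<ge> 0" using s het_amp_bounds[OF c] by simp
    ultimately show ?thesis by simp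
  qed
  also have "\<dots> \<le> 2 * (1 * (1 + s))"
    using s het_amp_bounds[OF c] by (intro mult_left_mono mult_right_mono) auto
  also have "\<dots> = 2 * (1 - \<bar>s\<bar>)" using s by simp
  also have "\<dots> \<le> 2 * (2 * exp (- (2 * \<bar>het_rate c * x / 2\<bar>)))"
    unfolding s_def by (intro mult_left_mono one_minus_abs_tanh_le) simp
  also have "2 * \<bar>het_rate c * x / 2\<bar> = het_rate c * \<bar>x\<bar>"
    using het_rate_bounds[OF c] by (simp add: abs_mult)
  finally show ?thesis by simp
qed

lemma het_at_bot: "(het c \<longlongrightarrow> pi / 2 + 2 * arctan (het_amp c)) at_bot"
proof -
  have "((\<lambda>x. het c x - (pi / 2 + 2 * arctan (het_amp c))) \<longlongrightarrow> 0) at_bot"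
  proof (rule tendsto_0_le[where f = "\<lambda>x. exp (het_rate c * x)" and K = 4])
    show "((\<lambda>x. exp (het_rate c * x)) \<longlongrightarrow> 0) at_bot"
      using het_rate_bounds[OF c]
      by (intro filterlim_compose[OF exp_at_bot]
          filterlim_tendsto_pos_mult_at_bot[OF tendsto_const _ filterlim_ident]) auto
    show "\<forall>\<^sub>F x in at_bot. norm (het c x - (pi / 2 + 2 * arctan (het_amp c)))
        \<le> norm (exp (het_rate c * x)) * 4"
      using eventually_le_at_bot[of 0]
      by eventually_elim (use het_at_bot_bound in \<open>auto simp: mult.commute\<close>)
  qed
  then show ?thesis by (simp add: Lim_null[symmetric])
qed

lemma het_at_top: "(het c \<longlongrightarrow> pi / 2 - 2 * arctan (het_amp c)) at_top"
proof -
  have "((\<lambda>x. pi - het c (- x)) \<longlongrightarrow> pi - (pi / 2 + 2 * arctan (het_amp c))) at_top"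
    by (intro tendsto_intros filterlim_compose[OF het_at_bot filterlim_uminus_at_bot_at_top])
  then show ?thesis by (simp add: het_minus)
qed

lemma sin_het_limit: "sin (pi / 2 - 2 * arctan (het_amp c)) = 2 * c"
  and cos_het_limit: "cos (pi / 2 - 2 * arctan (het_amp c)) = het_rate c"
proof -
  have "1 + (het_amp c)\<^sup>2 = 2 / (1 + 2 * c)"
    using het_amp_sq[OF c] c by (simp add: field_simps)
  moreover have "1 - (het_amp c)\<^sup>2 = 4 * c / (1 + 2 * c)"
    using het_amp_sq[OF c] c by (simp add: field_simps)
  ultimately show "sin (pi / 2 - 2 * arctan (het_amp c)) = 2 * c"
    "cos (pi / 2 - 2 * arctan (het_amp c)) = het_rate c"
    using c het_amp_mult[OF c]
    unfolding sin_half_pi_minus_double_arctan cos_half_pi_minus_double_arctan by simp_all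
qed

lemma phi0_eq_het: "phi0 c = het c"
  unfolding phi0_def
proof (rule the1_equality[OF ex1_normalized_heteroclinic[OF c]])
  have "heteroclinic c (het c)"
    unfolding heteroclinic_def
  proof (intro conjI allI exI)
    show "(het c \<longlongrightarrow> pi / 2 - 2 * arctan (het_amp c)) at_top" by (rule het_at_top)
    show "(het c \<longlongrightarrow> pi / 2 + 2 * arctan (het_amp c)) at_bot" by (rule het_at_bot)
    show "pi / 2 + 2 * arctan (het_amp c) \<noteq> pi / 2 - 2 * arctan (het_amp c)"
      using het_amp_bounds[OF c] by simp
    show "sin (pi / 2 - 2 * arctan (het_amp c)) = 2 * c" by (rule sin_het_limit)
    then have "sin (pi - (pi / 2 - 2 * arctan (het_amp c))) = 2 * c" by (simp only: sin_pi_minus)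
    then show "sin (pi / 2 + 2 * arctan (het_amp c)) = 2 * c" by (simp add: algebra_simps)
  qed (rule DERIV_het)
  moreover have "\<exists>D<0. (het c has_real_derivative D) (at x)" for x
    using DERIV_het[of x] het_excess_pos[of x] by (intro exI[of _ "2 * c - sin (het c x)"]) simp
  ultimately show "normalized_heteroclinic c (het c)"
    unfolding normalized_heteroclinic_def by (simp add: het_minus) (simp add: het_def)
qed

end

text \<open>The derivative of \<open>tanh (l z)\<close> in \<open>l\<close> is \<open>z (1 - tanh\<^sup>2 (l z))\<close>, which is bounded uniformly in \<open>z\<close> because
  \<open>1 - tanh\<^sup>2\<close> decays exponentially. Thus a relative change of the argument changes \<open>tanh\<close> uniformly little
  on the whole line.\<close>
lemma abs_tanh_mult_diff_le:
  fixes z :: real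
  assumes "l \<ge> 1 / 2"
  shows "\<bar>tanh (l * z) - tanh z\<bar> \<le> 8 * \<bar>l - 1\<bar>"
proof -
  have aux: "(1 - (tanh r)\<^sup>2) * \<bar>r\<bar> \<le> 4" for r :: real
  proof -
    have b: "\<bar>tanh r\<bar> < 1" using tanh_real_bounds[of r] by auto
    have "(1 - (tanh r)\<^sup>2) = (1 - \<bar>tanh r\<bar>) * (1 + \<bar>tanh r\<bar>)"
      by (simp add: algebra_simps power2_eq_square)
    also have "\<dots> \<le> 2 * exp (- (2 * \<bar>r\<bar>)) * 2"
      using b by (intro mult_mono one_minus_abs_tanh_le) auto
    finally have "(1 - (tanh r)\<^sup>2) * \<bar>r\<bar> \<le> 4 * exp (- (2 * \<bar>r\<bar>)) * \<bar>r\<bar>"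
      by (intro mult_right_mono) auto
    moreover have "exp (- (2 * \<bar>r\<bar>)) * \<bar>r\<bar> \<le> exp (- (2 * \<bar>r\<bar>)) * exp (2 * \<bar>r\<bar>)"
    proof (rule mult_left_mono)
      show "\<bar>r\<bar> \<le> exp (2 * \<bar>r\<bar>)"
        using exp_ge_add_one_self[of "2 * \<bar>r\<bar>"] abs_ge_zero[of r] by linarith
    qed simp
    moreover have "exp (- (2 * \<bar>r\<bar>)) * exp (2 * \<bar>r\<bar>) = 1" by (simp flip: exp_add)
    ultimately show ?thesis by linarith
  qed
  have "norm (tanh (l * z) - tanh (1 * z)) \<le> 8 * norm (l - 1)"
  proof (rule field_differentiable_bound[of "{1/2..}" "\<lambda>l. tanh (l * z)"
        "\<lambda>l. (1 - (tanh (l * z))\<^sup>2) * z"])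
    fix r :: real assume r: "r \<in> {1/2..}"
    show "((\<lambda>l. tanh (l * z)) has_field_derivative (1 - (tanh (r * z))\<^sup>2) * z) (at r within {1/2..})"
      by (auto intro!: derivative_eq_intros)
    have "(1 - (tanh (r * z))\<^sup>2) \<ge> 0"
      using tanh_real_bounds[of "r * z"] by (simp add: abs_square_le_1 abs_le_iff less_imp_le minus_le_iff)
    moreover have "\<bar>z\<bar> \<le> 2 * \<bar>r * z\<bar>"
      using mult_right_mono[of 1 "2 * r" "\<bar>z\<bar>"] r by (simp add: abs_mult)
    ultimately have "\<bar>(1 - (tanh (r * z))\<^sup>2) * z\<bar> \<le> (1 - (tanh (r * z))\<^sup>2) * (2 * \<bar>r * z\<bar>)"
      by (simp add: abs_mult mult_left_mono)
    then show "norm ((1 - (tanh (r * z))\<^sup>2) * z) \<le> 8" using aux[of "r * z"] by simp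
  qed (use assms in auto)
  then show ?thesis by simp
qed

section \<open>Estimates for the rescaled radial equation\<close>

text \<open>
  Let \<open>R = u\<^sup>2 + v\<^sup>2\<close>, let \<open>\<phi>\<close> be the phase angle, \<open>s = sin \<phi>\<close>, \<open>C = cos \<phi>\<close>, \<open>y = s - 2 c > 0\<close> and
  \<open>e = \<epsilon>\<^sup>2\<close>. The radial unknowns \<open>A\<close> and \<open>B\<close> are defined by \<open>R = 1 + e y A\<close> and \<open>R' = e y B\<close>, the prime
  being \<open>d/dx\<close>. Every term of the zero-energy identity contains the factor \<open>y\<^sup>2\<close>, because
  \<open>R s - 2 c = y (1 + e A s)\<close>. After division by \<open>e y\<^sup>2 R\<close> it says that the square of the angular speed,
  \<open>R (\<phi>' / (\<epsilon> y))\<^sup>2\<close>, equals \<open>scaled_kinetic\<close>: potential energy minus radial kinetic energy. Therefore,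
  if \<open>\<phi> = het c (\<epsilon> \<tau>)\<close>, then \<open>dx/d\<tau>\<close> is \<open>slowness\<close>. The Lagrange-Jacobi (virial) identity, combined
  with the zero energy, becomes \<open>R'' = e y virial\<close>; it does not involve any velocity. Altogether, in
  the parameter \<open>\<tau>\<close>,

  \<open>dA/d\<tau> = B slowness + \<epsilon> C A\<close> and \<open>dB/d\<tau> = virial slowness + \<epsilon> C B\<close>,

  where \<open>slowness = 1 + O(e)\<close> and \<open>virial = 2 A + y/2 + s + O(e)\<close>. The estimates below make these two
  expansions quantitative, together with the Lipschitz constants of their remainders, for \<open>A\<close> and
  \<open>B\<close> in \<open>[-2, 2]\<close>. The constants are crude; what matters is that they are absolute and multiplied by \<open>e\<close>.
\<close>

definition radius_sq :: "real \<Rightarrow> real \<Rightarrow> real \<Rightarrow> real" where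
  "radius_sq e y A = 1 + e * y * A"

definition scaled_potential :: "real \<Rightarrow> real \<Rightarrow> real \<Rightarrow> real" where
  "scaled_potential e s A = (1 + e * A * s)\<^sup>2 + 2 * e * A\<^sup>2"

definition scaled_kinetic :: "real \<Rightarrow> real \<Rightarrow> real \<Rightarrow> real \<Rightarrow> real \<Rightarrow> real" where
  "scaled_kinetic e s y A B = scaled_potential e s A - e * (B\<^sup>2 / radius_sq e y A)"

definition slowness :: "real \<Rightarrow> real \<Rightarrow> real \<Rightarrow> real \<Rightarrow> real \<Rightarrow> real" where
  "slowness e s y A B = sqrt (radius_sq e y A / scaled_kinetic e s y A B)"

definition virial :: "real \<Rightarrow> real \<Rightarrow> real \<Rightarrow> real \<Rightarrow> real" where
  "virial e s y A = y / 2 * scaled_potential e s A + 2 * radius_sq e y A * A + radius_sq e y A * s * (1 + e * A * s)"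

lemma abs_mult_le: "\<bar>a * b\<bar> \<le> P * Q" if "\<bar>a\<bar> \<le> P" "\<bar>b\<bar> \<le> Q" for a b P Q :: real
  unfolding abs_mult using that by (intro mult_mono) auto

lemma abs_mult_diff_le:
  fixes a b a' b' P Q u v :: real
  assumes "\<bar>a\<bar> \<le> P" "\<bar>b'\<bar> \<le> Q" "\<bar>a - a'\<bar> \<le> u" "\<bar>b - b'\<bar> \<le> v"
  shows "\<bar>a * b - a' * b'\<bar> \<le> P * v + Q * u"
proof -
  have "a * b - a' * b' = a * (b - b') + b' * (a - a')" by (simp add: algebra_simps)
  then show ?thesis
    using abs_mult_le[OF assms(1,4)] abs_mult_le[OF assms(2,3)] by linarith
qed

lemma abs_sqrt_diff_le:
  fixes a b :: real
  assumes "a \<ge> 1 / 4" "b \<ge> 1 / 4"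
  shows "\<bar>sqrt a - sqrt b\<bar> \<le> \<bar>a - b\<bar>"
proof -
  have r: "sqrt a \<ge> 1 / 2" "sqrt b \<ge> 1 / 2"
    by (rule real_le_rsqrt, use assms in \<open>simp add: power_divide\<close>)+
  have "\<bar>a - b\<bar> = \<bar>sqrt a - sqrt b\<bar> * (sqrt a + sqrt b)"
  proof -
    have "a - b = (sqrt a - sqrt b) * (sqrt a + sqrt b)"
      using assms by (simp add: algebra_simps)
    then show ?thesis using r by (simp add: abs_mult)
  qed
  moreover have "\<bar>sqrt a - sqrt b\<bar> * 1 \<le> \<bar>sqrt a - sqrt b\<bar> * (sqrt a + sqrt b)"
    using r by (intro mult_left_mono) auto
  ultimately show ?thesis by simp
qed

lemma sq_le_4: "\<bar>A\<^sup>2\<bar> \<le> 4" if "\<bar>A\<bar> \<le> 2" for A :: real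
  using abs_mult_le[OF that that] by (simp add: power2_eq_square)

lemma sq_lip: "\<bar>A\<^sup>2 - A'\<^sup>2\<bar> \<le> 4 * \<bar>A - A'\<bar>" if "\<bar>A\<bar> \<le> 2" "\<bar>A'\<bar> \<le> 2" for A A' :: real
  using abs_mult_diff_le[OF that, of A' _ A, OF order_refl order_refl] by (simp add: power2_eq_square)

context
  fixes e y :: real
  assumes e: "0 < e" "e \<le> 1 / 10000" and y: "\<bar>y\<bar> \<le> 1"
begin

lemma radius_sq_near: "\<bar>radius_sq e y A - 1\<bar> \<le> 2 * e" if "\<bar>A\<bar> \<le> 2"
  using abs_mult_le[OF y that] e by (simp add: radius_sq_def abs_mult)

lemma radius_sq_lip: "\<bar>radius_sq e y A - radius_sq e y A'\<bar> \<le> e * \<bar>A - A'\<bar>"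
proof -
  have "radius_sq e y A - radius_sq e y A' = e * (y * (A - A'))" by (simp add: radius_sq_def algebra_simps)
  then show ?thesis using abs_mult_le[OF y order_refl, of "A - A'"] e by (simp add: abs_mult)
qed

lemma radius_sq_ge: "radius_sq e y A \<ge> 99 / 100" "radius_sq e y A \<le> 101 / 100" if "\<bar>A\<bar> \<le> 2"
  using radius_sq_near[OF that] e by linarith+

lemma quot_le: "\<bar>B\<^sup>2 / radius_sq e y A\<bar> \<le> 8" if A: "\<bar>A\<bar> \<le> 2" and B: "\<bar>B\<bar> \<le> 2"
  using radius_sq_ge[OF A] sq_le_4[OF B] by (simp add: divide_simps abs_if)

lemma quot_lip: "\<bar>B\<^sup>2 / radius_sq e y A - B'\<^sup>2 / radius_sq e y A'\<bar> \<le> 9 * (\<bar>A - A'\<bar> + \<bar>B - B'\<bar>)"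
  if A: "\<bar>A\<bar> \<le> 2" "\<bar>A'\<bar> \<le> 2" and B: "\<bar>B\<bar> \<le> 2" "\<bar>B'\<bar> \<le> 2"
proof -
  define R R' where "R = radius_sq e y A" and "R' = radius_sq e y A'"
  have R: "R \<ge> 99 / 100" "R' \<ge> 99 / 100" using radius_sq_ge A by (auto simp: R_def R'_def)
  have "99 / 100 * (99 / 100) \<le> R * R'" using R by (intro mult_mono) auto
  then have RR: "1 / 2 \<le> R * R'" by simp
  have "1 / R - 1 / R' = (R' - R) / (R * R')" using R by (simp add: divide_simps)
  then have "\<bar>1 / R - 1 / R'\<bar> = \<bar>R - R'\<bar> / (R * R')" using R by (simp add: abs_minus_commute)
  also have "\<dots> \<le> \<bar>R - R'\<bar> / (1 / 2)" using RR R by (intro divide_left_mono) auto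
  also have "\<dots> \<le> 2 * (e * \<bar>A - A'\<bar>)" using radius_sq_lip[of A A'] by (simp add: R_def R'_def)
  also have "\<dots> \<le> 2 * (1 / 10000 * \<bar>A - A'\<bar>)" using e by (intro mult_left_mono mult_right_mono) auto
  finally have inv: "\<bar>1 / R - 1 / R'\<bar> \<le> 2 * (1 / 10000 * \<bar>A - A'\<bar>)" .
  have "\<bar>1 / R'\<bar> \<le> 2" using R by (simp add: divide_simps)
  from abs_mult_diff_le[OF sq_le_4[OF B(1)] this sq_lip[OF B] inv]
  have prod: "\<bar>B\<^sup>2 * (1 / R) - B'\<^sup>2 * (1 / R')\<bar> \<le> 4 * (2 * (1 / 10000 * \<bar>A - A'\<bar>)) + 2 * (4 * \<bar>B - B'\<bar>)" .
  define a b where "a = \<bar>A - A'\<bar>" and "b = \<bar>B - B'\<bar>"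
  have "a \<ge> 0" "b \<ge> 0" by (simp_all add: a_def b_def)
  then have "4 * (2 * (1 / 10000 * a)) + 2 * (4 * b) \<le> 9 * (a + b)" by argo
  with prod show ?thesis unfolding a_def[symmetric] b_def[symmetric] by (simp add: R_def R'_def)
qed

end

context
  fixes e s :: real
  assumes e: "0 < e" "e \<le> 1 / 10000" and s: "\<bar>s\<bar> \<le> 1"
begin

lemma lin_near: "\<bar>e * A * s\<bar> \<le> 2 * e" if "\<bar>A\<bar> \<le> 2"
  using abs_mult_le[OF that s] e by (simp add: abs_mult)

lemma lin_lip: "\<bar>(1 + e * A * s) - (1 + e * A' * s)\<bar> \<le> e * \<bar>A - A'\<bar>"
proof -
  have "(1 + e * A * s) - (1 + e * A' * s) = e * (s * (A - A'))" by (simp add: algebra_simps)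
  then show ?thesis using abs_mult_le[OF s order_refl, of "A - A'"] e by (simp add: abs_mult)
qed

lemma scaled_potential_near: "\<bar>scaled_potential e s A - 1\<bar> \<le> 13 * e" if A: "\<bar>A\<bar> \<le> 2"
proof -
  have "\<bar>e * A * s\<bar> \<le> 1 / 2" using lin_near[OF A] e by linarith
  from abs_mult_le[OF lin_near[OF A] this]
  have "\<bar>(e * A * s) * (e * A * s)\<bar> \<le> e" by simp
  moreover have "scaled_potential e s A - 1 = 2 * (e * A * s) + (e * A * s) * (e * A * s) + 2 * (e * A\<^sup>2)"
    by (simp add: scaled_potential_def power2_eq_square algebra_simps)
  moreover have "\<bar>e * A\<^sup>2\<bar> \<le> e * 4" using sq_le_4[OF A] e by (intro abs_mult_le) auto
  ultimately show ?thesis using lin_near[OF A] by linarith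
qed

lemma scaled_potential_lip: "\<bar>scaled_potential e s A - scaled_potential e s A'\<bar> \<le> 11 * e * \<bar>A - A'\<bar>"
  if A: "\<bar>A\<bar> \<le> 2" "\<bar>A'\<bar> \<le> 2"
proof -
  have "\<bar>1 + e * A * s\<bar> \<le> 3 / 2" "\<bar>1 + e * A' * s\<bar> \<le> 3 / 2"
    using lin_near[OF A(1)] lin_near[OF A(2)] e by linarith+
  from abs_mult_diff_le[OF this lin_lip[of A A'] lin_lip[of A A']]
  have "\<bar>(1 + e * A * s)\<^sup>2 - (1 + e * A' * s)\<^sup>2\<bar> \<le> 3 * (e * \<bar>A - A'\<bar>)"
    by (simp add: power2_eq_square)
  moreover have "\<bar>e * (A\<^sup>2 - A'\<^sup>2)\<bar> \<le> e * (4 * \<bar>A - A'\<bar>)"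
    using sq_lip[OF A] e by (intro abs_mult_le) auto
  moreover have "scaled_potential e s A - scaled_potential e s A'
      = ((1 + e * A * s)\<^sup>2 - (1 + e * A' * s)\<^sup>2) + 2 * (e * (A\<^sup>2 - A'\<^sup>2))"
    by (simp add: scaled_potential_def algebra_simps)
  ultimately show ?thesis by linarith
qed

end

context
  fixes e s y :: real
  assumes e: "0 < e" "e \<le> 1 / 10000" and s: "\<bar>s\<bar> \<le> 1" and y: "\<bar>y\<bar> \<le> 1"
begin

lemma scaled_kinetic_near: "\<bar>scaled_kinetic e s y A B - 1\<bar> \<le> 21 * e" if A: "\<bar>A\<bar> \<le> 2" and B: "\<bar>B\<bar> \<le> 2"
proof -
  have "\<bar>e * (B\<^sup>2 / radius_sq e y A)\<bar> \<le> e * 8" using quot_le[OF e y A B] e by (intro abs_mult_le) auto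
  moreover define q where "q = e * (B\<^sup>2 / radius_sq e y A)"
  ultimately show ?thesis using scaled_potential_near[OF e s A] unfolding scaled_kinetic_def q_def[symmetric] by linarith
qed

lemma scaled_kinetic_lip: "\<bar>scaled_kinetic e s y A B - scaled_kinetic e s y A' B'\<bar> \<le> 20 * e * (\<bar>A - A'\<bar> + \<bar>B - B'\<bar>)"
  if A: "\<bar>A\<bar> \<le> 2" "\<bar>A'\<bar> \<le> 2" and B: "\<bar>B\<bar> \<le> 2" "\<bar>B'\<bar> \<le> 2"
proof -
  have "\<bar>e * (B\<^sup>2 / radius_sq e y A - B'\<^sup>2 / radius_sq e y A')\<bar> \<le> e * (9 * (\<bar>A - A'\<bar> + \<bar>B - B'\<bar>))"
    using quot_lip[OF e y A B] e by (intro abs_mult_le) auto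
  moreover have "e * \<bar>B - B'\<bar> \<ge> 0" using e by simp
  moreover have "scaled_kinetic e s y A B - scaled_kinetic e s y A' B'
      = (scaled_potential e s A - scaled_potential e s A') - e * (B\<^sup>2 / radius_sq e y A - B'\<^sup>2 / radius_sq e y A')"
    by (simp add: scaled_kinetic_def right_diff_distrib)
  ultimately show ?thesis using scaled_potential_lip[OF e s A] by (simp add: algebra_simps)
qed

lemma scaled_kinetic_ge: "scaled_kinetic e s y A B \<ge> 99 / 100" "scaled_kinetic e s y A B \<le> 101 / 100"
  if A: "\<bar>A\<bar> \<le> 2" and B: "\<bar>B\<bar> \<le> 2"
  using scaled_kinetic_near[OF A B] e by linarith+

lemma ratio_ge: "radius_sq e y A / scaled_kinetic e s y A B \<ge> 1 / 4"
  if A: "\<bar>A\<bar> \<le> 2" and B: "\<bar>B\<bar> \<le> 2"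
  using radius_sq_ge[OF e y A] scaled_kinetic_ge[OF A B] by (simp add: field_simps)

lemma slowness_near: "\<bar>slowness e s y A B - 1\<bar> \<le> 25 * e" if A: "\<bar>A\<bar> \<le> 2" and B: "\<bar>B\<bar> \<le> 2"
proof -
  define R D where "R = radius_sq e y A" and "D = scaled_kinetic e s y A B"
  have D: "D \<ge> 99 / 100" using scaled_kinetic_ge[OF A B] by (simp add: D_def)
  have "\<bar>slowness e s y A B - 1\<bar> \<le> \<bar>R / D - 1\<bar>"
    using abs_sqrt_diff_le[OF ratio_ge[OF A B], of 1] by (simp add: slowness_def R_def D_def)
  also have "R / D - 1 = (R - D) / D" using D by (simp add: divide_simps)
  also have "\<bar>(R - D) / D\<bar> \<le> 25 * e"
  proof -
    have "\<bar>R - D\<bar> \<le> 23 * e" using radius_sq_near[OF e y A] scaled_kinetic_near[OF A B] unfolding R_def D_def by linarith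
    moreover have "25 * e * D \<ge> 25 * e * (99 / 100)" using D e by (intro mult_left_mono) auto
    ultimately have "\<bar>R - D\<bar> \<le> 25 * e * D" using e by linarith
    then show ?thesis using D by (simp add: divide_le_eq)
  qed
  finally show ?thesis .
qed

lemma slowness_lip: "\<bar>slowness e s y A B - slowness e s y A' B'\<bar> \<le> 30 * e * (\<bar>A - A'\<bar> + \<bar>B - B'\<bar>)"
  if A: "\<bar>A\<bar> \<le> 2" "\<bar>A'\<bar> \<le> 2" and B: "\<bar>B\<bar> \<le> 2" "\<bar>B'\<bar> \<le> 2"
proof -
  define d where "d = \<bar>A - A'\<bar> + \<bar>B - B'\<bar>"
  define R D R' D' where "R = radius_sq e y A" and "D = scaled_kinetic e s y A B"
    and "R' = radius_sq e y A'" and "D' = scaled_kinetic e s y A' B'"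
  have D: "D \<ge> 99 / 100" "D' \<ge> 99 / 100" "D \<le> 101 / 100"
    using scaled_kinetic_ge A B by (auto simp: D_def D'_def)
  have R: "\<bar>R\<bar> \<le> 101 / 100" using radius_sq_ge[OF e y A(1)] by (simp add: R_def)
  have d0: "e * d \<ge> 0" using e by (simp add: d_def)
  have "\<bar>D' - D\<bar> \<le> 20 * e * d" using scaled_kinetic_lip[OF A B] by (simp add: D_def D'_def d_def abs_minus_commute)
  moreover have "\<bar>R - R'\<bar> \<le> e * d"
    using radius_sq_lip[OF e y, of A A'] e by (auto simp: R_def R'_def d_def distrib_left intro: order_trans)
  moreover have "\<bar>D\<bar> \<le> 101 / 100" using D by simp
  ultimately have "\<bar>R * D' - R' * D\<bar> \<le> 101 / 100 * (20 * e * d) + 101 / 100 * (e * d)"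
    using R by (intro abs_mult_diff_le)
  also have "\<dots> \<le> 22 * (e * d)" using d0 by (simp add: mult_ac)
  finally have num: "\<bar>R * D' - R' * D\<bar> \<le> 22 * (e * d)" .
  have "99 / 100 * (99 / 100) \<le> D * D'" using D by (intro mult_mono) auto
  then have den: "22 / 30 \<le> D * D'" by simp
  have "\<bar>slowness e s y A B - slowness e s y A' B'\<bar> \<le> \<bar>R / D - R' / D'\<bar>"
    using abs_sqrt_diff_le[OF ratio_ge[OF A(1) B(1)] ratio_ge[OF A(2) B(2)]]
    by (simp add: slowness_def R_def D_def R'_def D'_def)
  also have "R / D - R' / D' = (R * D' - R' * D) / (D * D')" using D by (simp add: divide_simps)
  also have "\<bar>(R * D' - R' * D) / (D * D')\<bar> = \<bar>R * D' - R' * D\<bar> / (D * D')" using D by simp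
  also have "\<dots> \<le> 22 * (e * d) / (22 / 30)"
    using num den d0 by (intro frac_le) auto
  finally show ?thesis by (simp add: d_def)
qed

lemma virial_near: "\<bar>virial e s y A - 2 * A - (y / 2 + s)\<bar> \<le> 20 * e" if A: "\<bar>A\<bar> \<le> 2"
proof -
  have eq: "virial e s y A - 2 * A - (y / 2 + s) = (y * (scaled_potential e s A - 1)) / 2 + 2 * ((radius_sq e y A - 1) * A)
      + s * ((radius_sq e y A - 1) * (1 + e * A * s) + e * A * s)"
    by (simp add: virial_def field_simps)
  have 1: "\<bar>y * (scaled_potential e s A - 1)\<bar> \<le> 1 * (13 * e)" by (intro abs_mult_le y scaled_potential_near[OF e s] A)
  have 2: "\<bar>(radius_sq e y A - 1) * A\<bar> \<le> 2 * e * 2" by (intro abs_mult_le radius_sq_near[OF e y] A)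
  have "\<bar>1 + e * A * s\<bar> \<le> 11 / 10" using lin_near[OF e s A] e by linarith
  then have "\<bar>(radius_sq e y A - 1) * (1 + e * A * s)\<bar> \<le> 2 * e * (11 / 10)"
    by (intro abs_mult_le radius_sq_near[OF e y] A)
  then have "\<bar>(radius_sq e y A - 1) * (1 + e * A * s) + e * A * s\<bar> \<le> 5 * e"
    using lin_near[OF e s A] e by linarith
  then have 3: "\<bar>s * ((radius_sq e y A - 1) * (1 + e * A * s) + e * A * s)\<bar> \<le> 1 * (5 * e)"
    by (intro abs_mult_le s)
  show ?thesis using 1 2 3 e unfolding eq by linarith
qed

lemma virial_lip: "\<bar>(virial e s y A - 2 * A) - (virial e s y A' - 2 * A')\<bar> \<le> 20 * e * \<bar>A - A'\<bar>"
  if A: "\<bar>A\<bar> \<le> 2" "\<bar>A'\<bar> \<le> 2"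
proof -
  define d where "d = e * \<bar>A - A'\<bar>"
  have d0: "d \<ge> 0" using e by (simp add: d_def)
  have eq: "(virial e s y A - 2 * A) - (virial e s y A' - 2 * A') = (y * (scaled_potential e s A - scaled_potential e s A')) / 2
      + 2 * ((radius_sq e y A - 1) * A - (radius_sq e y A' - 1) * A')
      + s * (radius_sq e y A * (1 + e * A * s) - radius_sq e y A' * (1 + e * A' * s))"
    by (simp add: virial_def field_simps)
  have 1: "\<bar>y * (scaled_potential e s A - scaled_potential e s A')\<bar> \<le> 1 * (11 * e * \<bar>A - A'\<bar>)"
    by (intro abs_mult_le y scaled_potential_lip[OF e s] A)
  have "\<bar>(radius_sq e y A - 1) - (radius_sq e y A' - 1)\<bar> \<le> e * \<bar>A - A'\<bar>" using radius_sq_lip[OF e y, of A A'] by simp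
  from abs_mult_diff_le[OF radius_sq_near[OF e y A(1)] A(2) this order_refl[of "\<bar>A - A'\<bar>"]]
  have 2: "\<bar>(radius_sq e y A - 1) * A - (radius_sq e y A' - 1) * A'\<bar> \<le> 4 * d" by (simp add: d_def)
  have "\<bar>radius_sq e y A\<bar> \<le> 11 / 10" "\<bar>1 + e * A' * s\<bar> \<le> 11 / 10"
    using radius_sq_ge[OF e y A(1)] lin_near[OF e s A(2)] e by linarith+
  from abs_mult_diff_le[OF this radius_sq_lip[OF e y, of A A'] lin_lip[OF e s, of A A']]
  have "\<bar>radius_sq e y A * (1 + e * A * s) - radius_sq e y A' * (1 + e * A' * s)\<bar> \<le> 3 * d"
    using d0 by (simp add: d_def)
  then have 3: "\<bar>s * (radius_sq e y A * (1 + e * A * s) - radius_sq e y A' * (1 + e * A' * s))\<bar> \<le> 1 * (3 * d)"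
    by (intro abs_mult_le s)
  have "11 * e * \<bar>A - A'\<bar> = 11 * d" "20 * e * \<bar>A - A'\<bar> = 20 * d" by (simp_all add: d_def)
  moreover have "\<bar>p / 2 + 2 * q + r\<bar> \<le> 20 * d"
    if "\<bar>p\<bar> \<le> 11 * d" "\<bar>q\<bar> \<le> 4 * d" "\<bar>r\<bar> \<le> 3 * d" for p q r
    using that d0 unfolding abs_le_iff by linarith
  ultimately show ?thesis using 1 2 3 unfolding eq by simp
qed

end

text \<open>\<open>displacement\<close> and \<open>velocity\<close> recover \<open>A\<close> and \<open>B\<close> from the diagonal modes \<open>X = B + \<surd>2 A\<close> and
  \<open>Y = B - \<surd>2 A\<close>.\<close>
definition displacement :: "real \<Rightarrow> real \<Rightarrow> real" where
  "displacement X Y = (X - Y) / (2 * sqrt 2)"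

definition velocity :: "real \<Rightarrow> real \<Rightarrow> real" where
  "velocity X Y = (X + Y) / 2"

text \<open>What is left of \<open>dX/d\<tau> = dB/d\<tau> + \<surd>2 dA/d\<tau>\<close> after removing the linear part \<open>\<surd>2 X\<close>.\<close>
definition nonlinear_rest :: "real \<Rightarrow> real \<Rightarrow> real \<Rightarrow> real \<Rightarrow> real \<Rightarrow> real \<Rightarrow> real" where
  "nonlinear_rest \<epsilon> s C y X Y =
     (virial (\<epsilon>\<^sup>2) s y (displacement X Y) + sqrt 2 * velocity X Y) * slowness (\<epsilon>\<^sup>2) s y (displacement X Y) (velocity X Y)
       - sqrt 2 * X + \<epsilon> * C * X"

lemma sqrt2_bounds: "14 / 10 \<le> sqrt 2" "sqrt 2 \<le> 15 / 10"
  by (rule real_le_rsqrt real_le_lsqrt; simp add: power2_eq_square)+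

lemma displacement_lip: "\<bar>displacement X Y - displacement X' Y'\<bar> \<le> (\<bar>X - X'\<bar> + \<bar>Y - Y'\<bar>) / 2"
proof -
  have "displacement X Y - displacement X' Y' = ((X - X') - (Y - Y')) / (2 * sqrt 2)"
    by (simp add: displacement_def diff_divide_distrib)
  then have "\<bar>displacement X Y - displacement X' Y'\<bar> = \<bar>(X - X') - (Y - Y')\<bar> / (2 * sqrt 2)" by simp
  also have "\<dots> \<le> (\<bar>X - X'\<bar> + \<bar>Y - Y'\<bar>) / 2"
    using sqrt2_bounds by (intro frac_le) auto
  finally show ?thesis .
qed

lemma velocity_lip: "\<bar>velocity X Y - velocity X' Y'\<bar> \<le> (\<bar>X - X'\<bar> + \<bar>Y - Y'\<bar>) / 2"
  using abs_triangle_ineq[of "X - X'" "Y - Y'"]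
  by (simp add: velocity_def diff_divide_distrib[symmetric] add_diff_add)

lemma modes_bounded:
  assumes "\<bar>X\<bar> \<le> 2" "\<bar>Y\<bar> \<le> 2"
  shows "\<bar>displacement X Y\<bar> \<le> 2" "\<bar>velocity X Y\<bar> \<le> 2"
  using displacement_lip[of X Y 0 0] velocity_lip[of X Y 0 0] assms
  by (auto simp: displacement_def velocity_def)

lemma mode_sum: "sqrt 2 * X = 2 * displacement X Y + sqrt 2 * velocity X Y"
proof -
  have "2 * ((X - Y) / (2 * sqrt 2)) = sqrt 2 * (X - Y) / 2"
    using real_sqrt_mult_self[of 2] by (simp add: field_simps del: real_sqrt_mult_self)
  then show ?thesis unfolding displacement_def velocity_def by (simp only:) (simp add: field_simps)
qed

text \<open>Since \<open>virial = 2 A + O(1)\<close> and \<open>\<surd>2 X = 2 A + \<surd>2 B\<close>, the unbounded-looking linear terms cancel up to the factor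
  \<open>slowness - 1 = O(\<epsilon>\<^sup>2)\<close>. In this form it is visible that the remainder is a known bounded function plus
  \<open>O(\<epsilon>)\<close>.\<close>
lemma nonlinear_rest_split: "nonlinear_rest \<epsilon> s C y X Y =
   sqrt 2 * X * (slowness (\<epsilon>\<^sup>2) s y (displacement X Y) (velocity X Y) - 1)
   + (virial (\<epsilon>\<^sup>2) s y (displacement X Y) - 2 * displacement X Y) * slowness (\<epsilon>\<^sup>2) s y (displacement X Y) (velocity X Y)
   + \<epsilon> * C * X"
  unfolding nonlinear_rest_def mode_sum[of X Y] by (simp add: algebra_simps)

lemma square_small:
  fixes \<epsilon> :: real
  assumes "0 < \<epsilon>" "\<epsilon> \<le> 1 / 100"
  shows "0 < \<epsilon>\<^sup>2" "\<epsilon>\<^sup>2 \<le> 1 / 10000"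
  using assms power_mono[of \<epsilon> "1/100" 2] by (auto simp: power2_eq_square)

context
  fixes \<epsilon> s C y :: real
  assumes \<epsilon>: "0 < \<epsilon>" "\<epsilon> \<le> 1 / 100" and s: "\<bar>s\<bar> \<le> 1" and y: "\<bar>y\<bar> \<le> 1" and C: "\<bar>C\<bar> \<le> 1"
begin

text \<open>The main term is \<open>y/2 + s \<le> 3/2\<close>, and \<open>\<epsilon> \<le> 1/100\<close> leaves room for the others. Any bound below
  \<open>2 \<surd>2\<close> makes the ball of radius \<open>2\<close> invariant.\<close>
lemma nonlinear_rest_bound:
  assumes X: "\<bar>X\<bar> \<le> 2" and Y: "\<bar>Y\<bar> \<le> 2"
  shows "\<bar>nonlinear_rest \<epsilon> s C y X Y\<bar> \<le> 2"
proof -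
  note AB = modes_bounded[OF X Y]
  note sn = slowness_near[OF square_small[OF \<epsilon>] s y AB]
  note vn = virial_near[OF square_small[OF \<epsilon>] s y AB(1)]
  have "\<bar>sqrt 2 * X\<bar> \<le> 15 / 10 * 2" using sqrt2_bounds X by (intro abs_mult_le) auto
  moreover have "\<bar>slowness (\<epsilon>\<^sup>2) s y (displacement X Y) (velocity X Y) - 1\<bar> \<le> 25 / 10000"
    using sn square_small[OF \<epsilon>] by linarith
  ultimately have 1: "\<bar>sqrt 2 * X * (slowness (\<epsilon>\<^sup>2) s y (displacement X Y) (velocity X Y) - 1)\<bar> \<le> 15 / 10 * 2 * (25 / 10000)"
    by (rule abs_mult_le)
  have 2: "\<bar>(virial (\<epsilon>\<^sup>2) s y (displacement X Y) - 2 * displacement X Y) * slowness (\<epsilon>\<^sup>2) s y (displacement X Y) (velocity X Y)\<bar>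
      \<le> (15 / 10 + 20 / 10000) * (1 + 25 / 10000)"
    using sn vn square_small[OF \<epsilon>] s y by (intro abs_mult_le) linarith+
  have "\<bar>\<epsilon> * C\<bar> \<le> 1 / 100 * 1" using \<epsilon> C by (intro abs_mult_le) auto
  then have 3: "\<bar>\<epsilon> * C * X\<bar> \<le> 1 / 100 * 1 * 2" using X by (rule abs_mult_le)
  have "\<bar>p + q + r\<bar> \<le> 2"
    if "\<bar>p\<bar> \<le> 1 / 10" "\<bar>q\<bar> \<le> 16 / 10" "\<bar>r\<bar> \<le> 1 / 10" for p q r :: real
    using that unfolding abs_le_iff by linarith
  from this[OF order_trans[OF 1] order_trans[OF 2] order_trans[OF 3]]
  show ?thesis unfolding nonlinear_rest_split by simp
qed

text \<open>The main term does not depend on \<open>X\<close> and \<open>Y\<close>, hence the Lipschitz constant is \<open>O(\<epsilon>)\<close>. A constant below \<open>\<surd>2 / 2\<close>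
  suffices for the contraction.\<close>
lemma nonlinear_rest_lip:
  assumes X: "\<bar>X\<bar> \<le> 2" "\<bar>X'\<bar> \<le> 2" and Y: "\<bar>Y\<bar> \<le> 2" "\<bar>Y'\<bar> \<le> 2"
  shows "\<bar>nonlinear_rest \<epsilon> s C y X Y - nonlinear_rest \<epsilon> s C y X' Y'\<bar> \<le> 1 / 4 * (\<bar>X - X'\<bar> + \<bar>Y - Y'\<bar>)"
proof -
  define d where "d = \<bar>X - X'\<bar> + \<bar>Y - Y'\<bar>"
  define g g' where "g = slowness (\<epsilon>\<^sup>2) s y (displacement X Y) (velocity X Y)"
    and "g' = slowness (\<epsilon>\<^sup>2) s y (displacement X' Y') (velocity X' Y')"
  define W W' where "W = virial (\<epsilon>\<^sup>2) s y (displacement X Y) - 2 * displacement X Y"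
    and "W' = virial (\<epsilon>\<^sup>2) s y (displacement X' Y') - 2 * displacement X' Y'"
  note AB = modes_bounded[OF X(1) Y(1)] and AB' = modes_bounded[OF X(2) Y(2)]
  have d: "d \<ge> 0" "\<bar>X - X'\<bar> \<le> d" by (auto simp: d_def)
  have g: "\<bar>g' - 1\<bar> \<le> 25 / 10000"
    using slowness_near[OF square_small[OF \<epsilon>] s y AB'] square_small[OF \<epsilon>] by (simp add: g'_def)
  have ed: "\<epsilon>\<^sup>2 * d \<le> 1 / 10000 * d" using square_small[OF \<epsilon>] d by (intro mult_right_mono) auto
  have gd: "\<bar>g - g'\<bar> \<le> 30 / 10000 * d"
  proof -
    have "\<bar>g - g'\<bar> \<le> 30 * \<epsilon>\<^sup>2 * (\<bar>displacement X Y - displacement X' Y'\<bar> + \<bar>velocity X Y - velocity X' Y'\<bar>)"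
      unfolding g_def g'_def by (rule slowness_lip[OF square_small[OF \<epsilon>] s y AB(1) AB'(1) AB(2) AB'(2)])
    also have "\<dots> \<le> 30 * \<epsilon>\<^sup>2 * d"
      using displacement_lip[of X Y X' Y'] velocity_lip[of X Y X' Y'] square_small[OF \<epsilon>]
      unfolding d_def by (intro mult_left_mono) auto
    finally show ?thesis using ed by simp
  qed
  have W: "\<bar>W\<bar> \<le> 16 / 10"
    using virial_near[OF square_small[OF \<epsilon>] s y AB(1)] square_small[OF \<epsilon>] s y unfolding W_def by linarith
  have Wd: "\<bar>W - W'\<bar> \<le> 20 / 10000 * d"
  proof -
    have "\<bar>W - W'\<bar> \<le> 20 * \<epsilon>\<^sup>2 * \<bar>displacement X Y - displacement X' Y'\<bar>"
      unfolding W_def W'_def by (rule virial_lip[OF square_small[OF \<epsilon>] s y AB(1) AB'(1)])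
    also have "\<dots> \<le> 20 * \<epsilon>\<^sup>2 * d"
    proof (rule mult_left_mono)
      show "\<bar>displacement X Y - displacement X' Y'\<bar> \<le> d"
        using displacement_lip[of X Y X' Y', folded d_def] d(1) by linarith
    qed simp
    finally show ?thesis using ed by simp
  qed
  have s2: "\<bar>sqrt 2 * X\<bar> \<le> 15 / 10 * 2" "\<bar>sqrt 2 * X - sqrt 2 * X'\<bar> \<le> 15 / 10 * d"
    using sqrt2_bounds X d unfolding right_diff_distrib[symmetric]
    by (intro abs_mult_le; simp)+
  have "\<bar>(g - 1) - (g' - 1)\<bar> \<le> 30 / 10000 * d" using gd by simp
  from abs_mult_diff_le[OF s2(1) g s2(2) this]
  have 1: "\<bar>sqrt 2 * X * (g - 1) - sqrt 2 * X' * (g' - 1)\<bar> \<le> 15 / 10 * 2 * (30 / 10000 * d) + 25 / 10000 * (15 / 10 * d)" .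
  have "\<bar>g'\<bar> \<le> 11 / 10" using g by linarith
  from abs_mult_diff_le[OF W this Wd gd]
  have 2: "\<bar>W * g - W' * g'\<bar> \<le> 16 / 10 * (30 / 10000 * d) + 11 / 10 * (20 / 10000 * d)" .
  have "\<bar>\<epsilon> * C\<bar> \<le> 1 / 100 * 1" using \<epsilon> C by (intro abs_mult_le) auto
  then have 3: "\<bar>\<epsilon> * C * (X - X')\<bar> \<le> 1 / 100 * 1 * d" using d(2) by (rule abs_mult_le)
  have eq: "nonlinear_rest \<epsilon> s C y X Y - nonlinear_rest \<epsilon> s C y X' Y' =
      (sqrt 2 * X * (g - 1) - sqrt 2 * X' * (g' - 1)) + (W * g - W' * g') + \<epsilon> * C * (X - X')"
    unfolding nonlinear_rest_split g_def g'_def W_def W'_def by (simp add: algebra_simps)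
  have "\<bar>nonlinear_rest \<epsilon> s C y X Y - nonlinear_rest \<epsilon> s C y X' Y'\<bar> \<le> 1 / 4 * d"
  proof -
    have "\<bar>p + q + r\<bar> \<le> 1 / 4 * d"
      if "\<bar>p\<bar> \<le> 15 / 10 * 2 * (30 / 10000 * d) + 25 / 10000 * (15 / 10 * d)"
        "\<bar>q\<bar> \<le> 16 / 10 * (30 / 10000 * d) + 11 / 10 * (20 / 10000 * d)"
        "\<bar>r\<bar> \<le> 1 / 100 * 1 * d" for p q r
      using that d(1) unfolding abs_le_iff by argo
    from this[OF 1 2 3] show ?thesis unfolding eq .
  qed
  then show ?thesis by (simp add: d_def)
qed

end

section \<open>The radial profile in the angular parameter\<close>

lemma continuous_slowness:
  fixes s y A B :: "real \<Rightarrow> real"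
  assumes e: "0 < e" "e \<le> 1 / 10000"
    and cs: "continuous_on UNIV s" and cy: "continuous_on UNIV y"
    and cA: "continuous_on UNIV A" and cB: "continuous_on UNIV B"
    and s: "\<And>t. \<bar>s t\<bar> \<le> 1" and y: "\<And>t. \<bar>y t\<bar> \<le> 1"
    and A: "\<And>t. \<bar>A t\<bar> \<le> 2" and B: "\<And>t. \<bar>B t\<bar> \<le> 2"
  shows "continuous_on UNIV (\<lambda>t. slowness e (s t) (y t) (A t) (B t))"
proof -
  have cR: "continuous_on UNIV (\<lambda>t. radius_sq e (y t) (A t))"
    unfolding radius_sq_def by (intro continuous_intros cA cy)
  have R0: "radius_sq e (y t) (A t) \<noteq> 0" for t
    using radius_sq_ge(1)[OF e y A, of t t] by auto
  have cK: "continuous_on UNIV (\<lambda>t. scaled_kinetic e (s t) (y t) (A t) (B t))"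
    unfolding scaled_kinetic_def scaled_potential_def by (intro continuous_intros cA cs cB cR) (use R0 in auto)
  have K0: "scaled_kinetic e (s t) (y t) (A t) (B t) \<noteq> 0" for t
    using scaled_kinetic_ge(1)[OF e s y A B, of t t t t] by auto
  show ?thesis
    unfolding slowness_def by (intro continuous_intros cK cR) (use K0 in auto)
qed

text \<open>Under \<open>\<tau> \<mapsto> - \<tau>\<close> the coefficients \<open>s\<close> and \<open>y\<close> are even and \<open>C\<close> is odd, so the equation of \<open>Y\<close> is that of \<open>X\<close>
  reflected. Hence a bounded solution \<open>X\<close> of the scalar equation in which \<open>Y(\<tau>)\<close> is replaced by
  \<open>- X(- \<tau>)\<close> yields a solution of both equations, with \<open>A\<close> even and \<open>B\<close> odd by construction.\<close>
lemma radial_profile_ex: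
  assumes c: "0 < c" "c < 1 / 2" and \<epsilon>: "0 < \<epsilon>" "\<epsilon> \<le> 1 / 100"
  defines "s \<equiv> \<lambda>\<tau>. sin (het c (\<epsilon> * \<tau>))"
  defines "y \<equiv> \<lambda>\<tau>. s \<tau> - 2 * c"
  defines "C \<equiv> \<lambda>\<tau>. cos (het c (\<epsilon> * \<tau>))"
  shows "\<exists>A B. (\<forall>\<tau>. \<bar>A \<tau>\<bar> \<le> 2 \<and> \<bar>B \<tau>\<bar> \<le> 2 \<and> A (- \<tau>) = A \<tau> \<and> B (- \<tau>) = - B \<tau>)
     \<and> (\<forall>\<tau>. (A has_real_derivative
             B \<tau> * slowness (\<epsilon>\<^sup>2) (s \<tau>) (y \<tau>) (A \<tau>) (B \<tau>) + \<epsilon> * C \<tau> * A \<tau>) (at \<tau>))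
     \<and> (\<forall>\<tau>. (B has_real_derivative
             virial (\<epsilon>\<^sup>2) (s \<tau>) (y \<tau>) (A \<tau>) * slowness (\<epsilon>\<^sup>2) (s \<tau>) (y \<tau>) (A \<tau>) (B \<tau>)
             + \<epsilon> * C \<tau> * B \<tau>) (at \<tau>))"
proof -
  have s1: "\<bar>s \<tau>\<bar> \<le> 1" and C1: "\<bar>C \<tau>\<bar> \<le> 1" for \<tau>
    by (simp_all add: s_def C_def)
  have y1: "\<bar>y \<tau>\<bar> \<le> 1" for \<tau>
    using het_excess_pos[OF c, of "\<epsilon> * \<tau>"] sin_le_one[of "het c (\<epsilon> * \<tau>)"] c
    unfolding y_def s_def abs_le_iff by linarith
  have even: "s (- \<tau>) = s \<tau>" "y (- \<tau>) = y \<tau>" "C (- \<tau>) = - C \<tau>" for \<tau>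
    by (simp_all add: y_def s_def C_def het_minus)
  have "continuous_on UNIV (het c)"
    using DERIV_het[OF c] by (intro continuous_at_imp_continuous_on) (auto intro: DERIV_isCont)
  then have ch: "continuous_on UNIV (\<lambda>\<tau>. het c (\<epsilon> * \<tau>))"
    by (rule continuous_on_compose2) (auto intro!: continuous_intros)
  have cs: "continuous_on UNIV s" and cC: "continuous_on UNIV C" and cy: "continuous_on UNIV y"
    unfolding y_def s_def C_def by (intro continuous_intros ch)+
  note \<epsilon>sq = square_small[OF \<epsilon>]
  have "\<exists>X. (\<forall>\<tau>. (X has_real_derivative
          sqrt 2 * X \<tau> + nonlinear_rest \<epsilon> (s \<tau>) (C \<tau>) (y \<tau>) (X \<tau>) (- X (- \<tau>))) (at \<tau>))
        \<and> (\<forall>\<tau>. \<bar>X \<tau>\<bar> \<le> 2)"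
  proof (rule reflected_ode_bounded_solution[where L = "1 / 4" and F = "\<lambda>\<tau>. nonlinear_rest \<epsilon> (s \<tau>) (C \<tau>) (y \<tau>)"])
    fix x z :: "real \<Rightarrow> real"
    assume x: "continuous_on UNIV x" and z: "continuous_on UNIV z"
      and bd: "\<And>t. \<bar>x t\<bar> \<le> 2 \<and> \<bar>z t\<bar> \<le> 2"
    define A B where "A = (\<lambda>t. displacement (x t) (z t))" and "B = (\<lambda>t. velocity (x t) (z t))"
    have cA: "continuous_on UNIV A" and cB: "continuous_on UNIV B"
      unfolding A_def B_def displacement_def velocity_def by (auto intro!: continuous_intros x z)
    have AB: "\<bar>A t\<bar> \<le> 2" "\<bar>B t\<bar> \<le> 2" for t
      using bd modes_bounded by (auto simp: A_def B_def)
    have cS: "continuous_on UNIV (\<lambda>t. slowness (\<epsilon>\<^sup>2) (s t) (y t) (A t) (B t))"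
      by (rule continuous_slowness[OF \<epsilon>sq cs cy cA cB s1 y1 AB])
    have cV: "continuous_on UNIV (\<lambda>t. virial (\<epsilon>\<^sup>2) (s t) (y t) (A t))"
      unfolding virial_def scaled_potential_def radius_sq_def by (intro continuous_intros cA cs cy) auto
    have "continuous_on UNIV (\<lambda>t. (virial (\<epsilon>\<^sup>2) (s t) (y t) (A t) + sqrt 2 * B t)
        * slowness (\<epsilon>\<^sup>2) (s t) (y t) (A t) (B t) - sqrt 2 * x t + \<epsilon> * C t * x t)"
      by (intro continuous_intros cV cS cB cC x)
    then show "continuous_on UNIV (\<lambda>t. nonlinear_rest \<epsilon> (s t) (C t) (y t) (x t) (z t))"
      by (simp add: nonlinear_rest_def A_def B_def)
  next
    fix t x z :: real assume "\<bar>x\<bar> \<le> 2" "\<bar>z\<bar> \<le> 2"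
    then show "\<bar>nonlinear_rest \<epsilon> (s t) (C t) (y t) x z\<bar> \<le> sqrt 2 * 2"
      using nonlinear_rest_bound[OF \<epsilon> s1 y1 C1, of x z t t t] sqrt2_bounds by linarith
  next
    fix t x z x' z' :: real assume "\<bar>x\<bar> \<le> 2" "\<bar>z\<bar> \<le> 2" "\<bar>x'\<bar> \<le> 2" "\<bar>z'\<bar> \<le> 2"
    then show "\<bar>nonlinear_rest \<epsilon> (s t) (C t) (y t) x z - nonlinear_rest \<epsilon> (s t) (C t) (y t) x' z'\<bar>
        \<le> 1 / 4 * (\<bar>x - x'\<bar> + \<bar>z - z'\<bar>)"
      by (intro nonlinear_rest_lip[OF \<epsilon> s1 y1 C1])
  qed (use sqrt2_bounds in auto)
  then obtain X where
    X: "\<And>\<tau>. (X has_real_derivative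
          sqrt 2 * X \<tau> + nonlinear_rest \<epsilon> (s \<tau>) (C \<tau>) (y \<tau>) (X \<tau>) (- X (- \<tau>))) (at \<tau>)"
    and Xb: "\<And>\<tau>. \<bar>X \<tau>\<bar> \<le> 2" by blast
  define A where "A = (\<lambda>\<tau>. displacement (X \<tau>) (- X (- \<tau>)))"
  define B where "B = (\<lambda>\<tau>. velocity (X \<tau>) (- X (- \<tau>)))"
  define g where "g = (\<lambda>\<tau>. slowness (\<epsilon>\<^sup>2) (s \<tau>) (y \<tau>) (A \<tau>) (B \<tau>))"
  define V where "V = (\<lambda>\<tau>. virial (\<epsilon>\<^sup>2) (s \<tau>) (y \<tau>) (A \<tau>))"
  have AB: "\<bar>A \<tau>\<bar> \<le> 2" "\<bar>B \<tau>\<bar> \<le> 2" for \<tau>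
    using Xb modes_bounded by (auto simp: A_def B_def)
  have par: "A (- \<tau>) = A \<tau>" "B (- \<tau>) = - B \<tau>" for \<tau>
    by (simp_all add: A_def B_def displacement_def velocity_def add.commute minus_divide_left)
  have g_even: "g (- \<tau>) = g \<tau>" "V (- \<tau>) = V \<tau>" for \<tau>
    by (simp_all add: g_def V_def par even slowness_def scaled_kinetic_def)
  have dX: "(X has_real_derivative (V \<tau> + sqrt 2 * B \<tau>) * g \<tau> + \<epsilon> * C \<tau> * X \<tau>) (at \<tau>)" for \<tau>
    using X[of \<tau>] unfolding nonlinear_rest_def by (simp add: g_def V_def A_def B_def)
  have dXm: "((\<lambda>\<tau>. X (- \<tau>)) has_real_derivative
      - ((V \<tau> - sqrt 2 * B \<tau>) * g \<tau> - \<epsilon> * C \<tau> * X (- \<tau>))) (at \<tau>)" for \<tau>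
    using DERIV_chain2[OF dX[of "- \<tau>"] DERIV_minus[OF DERIV_ident]]
    by (simp add: g_even par even)
  have "(A has_real_derivative B \<tau> * g \<tau> + \<epsilon> * C \<tau> * A \<tau>) (at \<tau>)" for \<tau>
  proof -
    have "((\<lambda>\<tau>. (X \<tau> - (- X (- \<tau>))) / (2 * sqrt 2)) has_real_derivative
        (((V \<tau> + sqrt 2 * B \<tau>) * g \<tau> + \<epsilon> * C \<tau> * X \<tau>)
          - (- (- ((V \<tau> - sqrt 2 * B \<tau>) * g \<tau> - \<epsilon> * C \<tau> * X (- \<tau>))))) / (2 * sqrt 2)) (at \<tau>)"
      by (intro DERIV_cdivide DERIV_diff DERIV_minus dX dXm)
    moreover have "(((V \<tau> + sqrt 2 * B \<tau>) * g \<tau> + \<epsilon> * C \<tau> * X \<tau>)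
          - (- (- ((V \<tau> - sqrt 2 * B \<tau>) * g \<tau> - \<epsilon> * C \<tau> * X (- \<tau>))))) / (2 * sqrt 2)
        = B \<tau> * g \<tau> + \<epsilon> * C \<tau> * A \<tau>"
      by (simp add: A_def displacement_def field_simps)
    moreover have "(\<lambda>\<tau>. (X \<tau> - (- X (- \<tau>))) / (2 * sqrt 2)) = A"
      by (simp add: A_def displacement_def fun_eq_iff)
    ultimately show ?thesis by (simp only:)
  qed
  moreover have "(B has_real_derivative V \<tau> * g \<tau> + \<epsilon> * C \<tau> * B \<tau>) (at \<tau>)" for \<tau>
  proof -
    have "((\<lambda>\<tau>. (X \<tau> + (- X (- \<tau>))) / 2) has_real_derivative
        (((V \<tau> + sqrt 2 * B \<tau>) * g \<tau> + \<epsilon> * C \<tau> * X \<tau>)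
          + (- (- ((V \<tau> - sqrt 2 * B \<tau>) * g \<tau> - \<epsilon> * C \<tau> * X (- \<tau>))))) / 2) (at \<tau>)"
      by (intro DERIV_cdivide DERIV_add DERIV_minus dX dXm)
    moreover have "(((V \<tau> + sqrt 2 * B \<tau>) * g \<tau> + \<epsilon> * C \<tau> * X \<tau>)
          + (- (- ((V \<tau> - sqrt 2 * B \<tau>) * g \<tau> - \<epsilon> * C \<tau> * X (- \<tau>))))) / 2
        = V \<tau> * g \<tau> + \<epsilon> * C \<tau> * B \<tau>"
      by (simp add: B_def velocity_def field_simps)
    moreover have "(\<lambda>\<tau>. (X \<tau> + (- X (- \<tau>))) / 2) = B"
      by (simp add: B_def velocity_def fun_eq_iff)
    ultimately show ?thesis by (simp only:)
  qed
  ultimately show ?thesis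
    using AB par unfolding g_def V_def by (intro exI[of _ A] exI[of _ B]) blast
qed

section \<open>Changing the independent variable\<close>

text \<open>The inverse function of an odd antiderivative of \<open>g\<close>. The bound on \<open>g - 1\<close> makes the new variable
  proportional to the old one up to the relative error \<open>2 \<delta>\<close>.\<close>
lemma time_change:
  fixes g :: "real \<Rightarrow> real"
  assumes g: "continuous_on UNIV g" and near: "\<And>\<tau>. \<bar>g \<tau> - 1\<bar> \<le> \<delta>" and \<delta>: "\<delta> \<le> 1 / 2"
    and even: "\<And>\<tau>. g (- \<tau>) = g \<tau>"
  shows "\<exists>\<theta>. (\<forall>x. (\<theta> has_real_derivative 1 / g (\<theta> x)) (at x))
           \<and> (\<forall>x. \<theta> (- x) = - \<theta> x) \<and> (\<forall>x. \<bar>\<theta> x - x\<bar> \<le> 2 * \<delta> * \<bar>x\<bar>)"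
proof -
  have \<delta>0: "0 \<le> \<delta>" using near[of 0] by linarith
  have gpos: "g \<tau> \<ge> 1 / 2" for \<tau> using near[of \<tau>] \<delta> by linarith
  obtain H where H: "\<And>\<tau>. (H has_real_derivative g \<tau>) (at \<tau>)"
    using ex_antiderivative_real[OF g] by blast
  define G where "G = (\<lambda>\<tau>. H \<tau> - H 0)"
  have G0: "G 0 = 0" by (simp add: G_def)
  have dG: "(G has_real_derivative g \<tau>) (at \<tau>)" for \<tau>
    unfolding G_def by (auto intro!: derivative_eq_intros H)
  have odd: "G (- \<tau>) = - G \<tau>" for \<tau>
  proof -
    have "((\<lambda>\<tau>. G (- \<tau>) + G \<tau>) has_real_derivative 0) (at r)" for r
      using DERIV_add[OF DERIV_chain2[OF dG[of "- r"] DERIV_minus[OF DERIV_ident]] dG[of r]]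
      by (simp add: even)
    then have "G (- \<tau>) + G \<tau> = G (- 0) + G 0"
      by (intro DERIV_isconst_all[of "\<lambda>\<tau>. G (- \<tau>) + G \<tau>"]) auto
    then show ?thesis using G0 by simp
  qed
  have Gnear: "\<bar>G \<tau> - \<tau>\<bar> \<le> \<delta> * \<bar>\<tau>\<bar>" for \<tau>
  proof -
    have "norm ((G \<tau> - \<tau>) - (G 0 - 0)) \<le> \<delta> * norm (\<tau> - 0)"
    proof (rule field_differentiable_bound[of UNIV "\<lambda>\<tau>. G \<tau> - \<tau>" "\<lambda>\<tau>. g \<tau> - 1"])
      show "((\<lambda>\<tau>. G \<tau> - \<tau>) has_field_derivative g z - 1) (at z within UNIV)" for z
        by (intro DERIV_diff dG DERIV_ident)
    qed (use near in auto)
    then show ?thesis by (simp add: G0)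
  qed
  have contG: "continuous_on S G" for S
    using dG by (intro continuous_at_imp_continuous_on) (auto intro: DERIV_isCont)
  have "inj G"
  proof (rule strict_mono_imp_inj_on)
    show "strict_mono G"
    proof (rule strict_monoI)
      fix a b :: real assume "a < b"
      then show "G a < G b"
        using dG gpos by (intro DERIV_pos_imp_increasing[of a b G]) (force intro: less_le_trans[OF _ gpos])+
    qed
  qed
  moreover have "\<exists>\<tau>. G \<tau> = x" for x
  proof -
    have pos: "t / 2 \<le> G t" if "t \<ge> 0" for t
      using Gnear[of t] mult_right_mono[OF \<delta> that] that by auto
    have "G (- (2 * \<bar>x\<bar>)) \<le> x" "x \<le> G (2 * \<bar>x\<bar>)"
      using pos[of "2 * \<bar>x\<bar>"] by (auto simp: odd)
    then show ?thesis
      using IVT'[of G "- (2 * \<bar>x\<bar>)" x "2 * \<bar>x\<bar>"] contG by auto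
  qed
  ultimately have "bij G" by (metis bijI surjI)
  define \<theta> where "\<theta> = inv G"
  have G\<theta>: "G (\<theta> x) = x" and \<theta>G: "\<theta> (G x) = x" for x
    using \<open>bij G\<close> by (simp_all add: \<theta>_def bij_def surj_f_inv_f)
  have "(\<theta> has_real_derivative 1 / g (\<theta> x)) (at x)" for x
  proof -
    have "(\<theta> has_derivative (*) (1 / g (\<theta> x))) (at (G (\<theta> x)))"
    proof (rule has_derivative_inverse_strong[of UNIV _ G \<theta> "(*) (g (\<theta> x))"])
      show "(G has_derivative (*) (g (\<theta> x))) (at (\<theta> x))"
        using dG[of "\<theta> x"] by (simp add: has_field_derivative_def)
      show "(*) (g (\<theta> x)) \<circ> (*) (1 / g (\<theta> x)) = id"
        using gpos[of "\<theta> x"] by (auto simp: fun_eq_iff)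
    qed (use contG \<theta>G in auto)
    then show ?thesis by (simp add: has_field_derivative_def G\<theta>)
  qed
  moreover have "\<theta> (- x) = - \<theta> x" for x
    by (metis G\<theta> \<theta>G odd)
  moreover have "\<bar>\<theta> x - x\<bar> \<le> 2 * \<delta> * \<bar>x\<bar>" for x
  proof -
    have 1: "\<bar>x - \<theta> x\<bar> \<le> \<delta> * \<bar>\<theta> x\<bar>" using Gnear[of "\<theta> x"] by (simp add: G\<theta>)
    have "\<delta> * \<bar>\<theta> x\<bar> \<le> 1 / 2 * \<bar>\<theta> x\<bar>" using \<delta> by (intro mult_right_mono) auto
    then have "\<bar>\<theta> x\<bar> \<le> 2 * \<bar>x\<bar>" using 1 by linarith
    then have "\<delta> * \<bar>\<theta> x\<bar> \<le> \<delta> * (2 * \<bar>x\<bar>)" using \<delta>0 by (intro mult_left_mono) auto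
    then show ?thesis using 1 by (simp add: abs_minus_commute)
  qed
  ultimately show ?thesis by blast
qed

section \<open>Polar coordinates\<close>

text \<open>The hypotheses are the virial identity for \<open>R''\<close>, the zero-energy identity, and \<open>\<phi>' < 0\<close>; the angular
  equation is not among them. It follows by differentiating the energy: all terms cancel except those
  containing the angular momentum \<open>m = R \<phi>'\<close>, and \<open>m\<close> can be divided out because it does not vanish. That
  \<open>m\<close> is differentiable at all is seen from \<open>m = - \<surd>E\<close>.\<close>
lemma polar_coupled_system:
  fixes R R1 \<phi> \<phi>1 :: "real \<Rightarrow> real"
  assumes Rpos: "\<And>x. R x > 0"
    and dR: "\<And>x. (R has_real_derivative R1 x) (at x)"
    and dR1: "\<And>x. (R1 has_real_derivative
          e * (R x * sin (\<phi> x) - 2 * c)\<^sup>2 / 2 + (R x - 1)\<^sup>2 + 2 * R x * (R x - 1)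
          + e * R x * sin (\<phi> x) * (R x * sin (\<phi> x) - 2 * c)) (at x)"
    and d\<phi>: "\<And>x. (\<phi> has_real_derivative \<phi>1 x) (at x)"
    and neg: "\<And>x. \<phi>1 x < 0"
    and energy: "\<And>x. (R x * \<phi>1 x)\<^sup>2 =
          e * R x * (R x * sin (\<phi> x) - 2 * c)\<^sup>2 + 2 * R x * (R x - 1)\<^sup>2 - (R1 x)\<^sup>2"
  shows "coupled_system (1 + e) (e * c)
           (\<lambda>x. sqrt (R x) * cos (\<phi> x / 2)) (\<lambda>x. sqrt (R x) * sin (\<phi> x / 2))"
proof -
  define D where "D = (\<lambda>x. R x * sin (\<phi> x) - 2 * c)"
  define E where "E = (\<lambda>x. e * R x * (D x)\<^sup>2 + 2 * R x * (R x - 1)\<^sup>2 - (R1 x)\<^sup>2)"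
  define R2 where "R2 = (\<lambda>x. e * (D x)\<^sup>2 / 2 + (R x - 1)\<^sup>2 + 2 * R x * (R x - 1)
          + e * R x * sin (\<phi> x) * D x)"
  define m where "m = (\<lambda>x. R x * \<phi>1 x)"
  define p where "p = (\<lambda>x. R1 x / (2 * R x))"
  define q where "q = (\<lambda>x. m x / (2 * R x))"
  define u where "u = (\<lambda>x. sqrt (R x) * cos (\<phi> x / 2))"
  define v where "v = (\<lambda>x. sqrt (R x) * sin (\<phi> x / 2))"
  have mneg: "m x < 0" for x using Rpos neg by (simp add: m_def mult_pos_neg)
  have m2: "(m x)\<^sup>2 = E x" for x using energy by (simp add: m_def E_def D_def)
  have dR1': "(R1 has_real_derivative R2 x) (at x)" for x
    using dR1 by (simp add: R2_def D_def)
  have dD: "(D has_real_derivative R1 x * sin (\<phi> x) + R x * cos (\<phi> x) * \<phi>1 x) (at x)" for x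
    unfolding D_def by (auto intro!: derivative_eq_intros dR d\<phi>)
  \<comment> \<open>The virial identity is exactly what cancels the terms without the factor \<open>m\<close>.\<close>
  have dE: "(E has_real_derivative 2 * m x * (e * R x * cos (\<phi> x) * D x)) (at x)" for x
  proof -
    have "(E has_real_derivative
        (e * R1 x * (D x)\<^sup>2 + e * R x * (2 * D x * (R1 x * sin (\<phi> x) + R x * cos (\<phi> x) * \<phi>1 x)))
        + (2 * R1 x * (R x - 1)\<^sup>2 + 2 * R x * (2 * (R x - 1) * R1 x)) - 2 * R1 x * R2 x) (at x)"
      unfolding E_def by (rule derivative_eq_intros dR dD dR1' refl)+ (simp add: algebra_simps)
    moreover have "(e * R1 x * (D x)\<^sup>2 + e * R x * (2 * D x * (R1 x * sin (\<phi> x) + R x * cos (\<phi> x) * \<phi>1 x)))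
        + (2 * R1 x * (R x - 1)\<^sup>2 + 2 * R x * (2 * (R x - 1) * R1 x)) - 2 * R1 x * R2 x
        = 2 * m x * (e * R x * cos (\<phi> x) * D x)"
      unfolding R2_def m_def by (simp add: algebra_simps)
    ultimately show ?thesis by simp
  qed
  have m_eq: "m = (\<lambda>x. - sqrt (E x))"
    using mneg by (simp add: fun_eq_iff less_imp_le flip: m2)
  have dm: "(m has_real_derivative e * R x * cos (\<phi> x) * D x) (at x)" for x
  proof -
    have "E x > 0" using m2[of x] mneg[of x] by (metis less_irrefl zero_less_power2)
    then have "((\<lambda>x. - sqrt (E x)) has_real_derivative
        - (2 * m x * (e * R x * cos (\<phi> x) * D x) * (inverse (sqrt (E x)) / 2))) (at x)"
      by (auto intro!: derivative_eq_intros dE)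
    moreover have "sqrt (E x) = - m x" by (simp add: m_eq)
    ultimately show ?thesis using mneg[of x] by (simp add: m_eq[symmetric] field_simps)
  qed
  have Rne: "R x \<noteq> 0" for x using Rpos[of x] by simp
  have dp: "(p has_real_derivative R2 x / (2 * R x) - 2 * (p x)\<^sup>2) (at x)" for x
    unfolding p_def
    by (rule DERIV_cong[OF DERIV_divide[OF dR1' DERIV_cmult[OF dR]]])
       (use Rne[of x] in \<open>auto simp: field_simps power2_eq_square\<close>)
  have dq: "(q has_real_derivative e * cos (\<phi> x) * D x / 2 - 2 * p x * q x) (at x)" for x
    unfolding q_def p_def
    by (rule DERIV_cong[OF DERIV_divide[OF dm DERIV_cmult[OF dR]]])
       (use Rne[of x] in \<open>auto simp: field_simps power2_eq_square\<close>)
  have q_eq: "q x = \<phi>1 x / 2" for x using Rne[of x] by (simp add: q_def m_def)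
  have dsq: "((\<lambda>x. sqrt (R x)) has_real_derivative p x * sqrt (R x)) (at x)" for x
  proof -
    have "((\<lambda>x. sqrt (R x)) has_real_derivative R1 x * (inverse (sqrt (R x)) / 2)) (at x)"
      using Rpos[of x] by (auto intro!: derivative_eq_intros dR)
    moreover have "R1 x * (inverse (sqrt (R x)) / 2) = p x * sqrt (R x)"
    proof -
      have "sqrt (R x) * sqrt (R x) = R x" "sqrt (R x) \<noteq> 0" using Rpos[of x] by auto
      then show ?thesis using Rne[of x] by (simp add: p_def field_simps)
    qed
    ultimately show ?thesis by simp
  qed
  have du: "(u has_real_derivative p x * u x - q x * v x) (at x)" for x
    unfolding u_def v_def q_eq
    by (rule derivative_eq_intros dsq d\<phi> refl | simp)+
  have dv: "(v has_real_derivative p x * v x + q x * u x) (at x)" for x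
    unfolding u_def v_def q_eq
    by (rule derivative_eq_intros dsq d\<phi> refl | simp)+
  have R_eq: "R x = (u x)\<^sup>2 + (v x)\<^sup>2" for x
    using Rpos[of x] by (simp add: u_def v_def power_mult_distrib flip: distrib_left)
  have D_eq: "D x = 2 * (u x * v x - c)" for x
  proof -
    have "sin (\<phi> x) = 2 * sin (\<phi> x / 2) * cos (\<phi> x / 2)" using sin_double[of "\<phi> x / 2"] by simp
    moreover have "sqrt (R x) * sqrt (R x) = R x" using Rpos[of x] by simp
    ultimately have "R x * sin (\<phi> x) = 2 * (u x * v x)"
      unfolding u_def v_def by (metis (no_types, opaque_lifting) mult.assoc mult.commute mult.left_commute)
    then show ?thesis by (simp add: D_def)
  qed
  have rot: "sin (\<phi> x) * u x - cos (\<phi> x) * v x = v x" "sin (\<phi> x) * v x + cos (\<phi> x) * u x = u x" for x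
  proof -
    have "sin (\<phi> x) * cos (\<phi> x / 2) - cos (\<phi> x) * sin (\<phi> x / 2) = sin (\<phi> x / 2)"
      using sin_diff[of "\<phi> x" "\<phi> x / 2"] by simp
    moreover have "cos (\<phi> x) * cos (\<phi> x / 2) + sin (\<phi> x) * sin (\<phi> x / 2) = cos (\<phi> x / 2)"
      using cos_diff[of "\<phi> x" "\<phi> x / 2"] by simp
    moreover have "sin (\<phi> x) * u x - cos (\<phi> x) * v x
        = sqrt (R x) * (sin (\<phi> x) * cos (\<phi> x / 2) - cos (\<phi> x) * sin (\<phi> x / 2))"
      "sin (\<phi> x) * v x + cos (\<phi> x) * u x
        = sqrt (R x) * (cos (\<phi> x) * cos (\<phi> x / 2) + sin (\<phi> x) * sin (\<phi> x / 2))"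
      by (simp_all add: u_def v_def algebra_simps)
    ultimately show "sin (\<phi> x) * u x - cos (\<phi> x) * v x = v x"
      "sin (\<phi> x) * v x + cos (\<phi> x) * u x = u x" by (simp_all add: u_def v_def)
  qed
  have radial: "R2 x / (2 * R x) - (p x)\<^sup>2 - (q x)\<^sup>2 = (R x - 1) + e * sin (\<phi> x) * D x / 2" for x
  proof -
    have "(p x)\<^sup>2 + (q x)\<^sup>2 = ((R1 x)\<^sup>2 + (m x)\<^sup>2) / (4 * (R x)\<^sup>2)"
      by (simp add: p_def q_def power_divide add_divide_distrib power_mult_distrib)
    also have "\<dots> = (e * (D x)\<^sup>2 + 2 * (R x - 1)\<^sup>2) / (4 * R x)"
      unfolding m2 E_def using Rne[of x] by (simp add: field_simps power2_eq_square)
    finally have "(p x)\<^sup>2 + (q x)\<^sup>2 = (e * (D x)\<^sup>2 + 2 * (R x - 1)\<^sup>2) / (4 * R x)" .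
    moreover have "R2 x / (2 * R x) = (e * (D x)\<^sup>2 + 2 * (R x - 1)\<^sup>2) / (4 * R x)
        + (R x - 1) + e * sin (\<phi> x) * D x / 2"
      unfolding R2_def using Rne[of x] by (simp add: field_simps)
    ultimately show ?thesis by simp
  qed
  have du1: "((\<lambda>x. p x * u x - q x * v x) has_real_derivative
      (u x ^ 3 - u x + (1 + e) * (v x)\<^sup>2 * u x - e * c * v x)) (at x)" for x
  proof -
    have "((\<lambda>x. p x * u x - q x * v x) has_real_derivative
      ((R2 x / (2 * R x) - 2 * (p x)\<^sup>2) * u x + (p x * u x - q x * v x) * p x)
      - ((e * cos (\<phi> x) * D x / 2 - 2 * p x * q x) * v x + (p x * v x + q x * u x) * q x)) (at x)"
      by (intro DERIV_diff DERIV_mult dp dq du dv)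
    moreover have "((R2 x / (2 * R x) - 2 * (p x)\<^sup>2) * u x + (p x * u x - q x * v x) * p x)
      - ((e * cos (\<phi> x) * D x / 2 - 2 * p x * q x) * v x + (p x * v x + q x * u x) * q x)
      = (R2 x / (2 * R x) - (p x)\<^sup>2 - (q x)\<^sup>2) * u x - e * cos (\<phi> x) * D x / 2 * v x"
      by (simp add: algebra_simps power2_eq_square)
    moreover have "\<dots> = (R x - 1) * u x + e * D x / 2 * (sin (\<phi> x) * u x - cos (\<phi> x) * v x)"
      unfolding radial by (simp add: algebra_simps)
    moreover have "\<dots> = u x ^ 3 - u x + (1 + e) * (v x)\<^sup>2 * u x - e * c * v x"
      unfolding rot D_eq R_eq by (simp add: field_simps power2_eq_square power3_eq_cube)
    ultimately show ?thesis by simp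
  qed
  have dv1: "((\<lambda>x. p x * v x + q x * u x) has_real_derivative
      (v x ^ 3 - v x + (1 + e) * (u x)\<^sup>2 * v x - e * c * u x)) (at x)" for x
  proof -
    have "((\<lambda>x. p x * v x + q x * u x) has_real_derivative
      ((R2 x / (2 * R x) - 2 * (p x)\<^sup>2) * v x + (p x * v x + q x * u x) * p x)
      + ((e * cos (\<phi> x) * D x / 2 - 2 * p x * q x) * u x + (p x * u x - q x * v x) * q x)) (at x)"
      by (intro DERIV_add DERIV_mult dp dq du dv)
    moreover have "((R2 x / (2 * R x) - 2 * (p x)\<^sup>2) * v x + (p x * v x + q x * u x) * p x)
      + ((e * cos (\<phi> x) * D x / 2 - 2 * p x * q x) * u x + (p x * u x - q x * v x) * q x)
      = (R2 x / (2 * R x) - (p x)\<^sup>2 - (q x)\<^sup>2) * v x + e * cos (\<phi> x) * D x / 2 * u x"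
      by (simp add: algebra_simps power2_eq_square)
    moreover have "\<dots> = (R x - 1) * v x + e * D x / 2 * (sin (\<phi> x) * v x + cos (\<phi> x) * u x)"
      unfolding radial by (simp add: algebra_simps)
    moreover have "\<dots> = v x ^ 3 - v x + (1 + e) * (u x)\<^sup>2 * v x - e * c * u x"
      unfolding rot D_eq R_eq by (simp add: field_simps power2_eq_square power3_eq_cube)
    ultimately show ?thesis by simp
  qed
  show ?thesis
    unfolding coupled_system_def u_def[symmetric] v_def[symmetric]
    using du dv du1 dv1
    by (intro exI[of _ "\<lambda>x. p x * u x - q x * v x"] exI[of _ "\<lambda>x. p x * v x + q x * u x"]) simp
qed

section \<open>The front in polar form\<close>

text \<open>The profile of \<open>radial_profile_ex\<close> is transported to the variable \<open>x\<close> by \<open>\<theta>\<close>, the inverse of the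
  integral of \<open>slowness\<close>. The three hypotheses of \<open>polar_coupled_system\<close> are then the definitions of
  \<open>scaled_kinetic\<close>, \<open>slowness\<close> and \<open>virial\<close> multiplied by powers of \<open>e\<close> and \<open>y\<close>. The relative error
  \<open>50 \<epsilon>\<^sup>2\<close> is twice the bound \<open>25 \<epsilon>\<^sup>2\<close> on \<open>slowness - 1\<close>.\<close>
lemma polar_front_ex:
  assumes c: "0 < c" "c < 1 / 2" and \<epsilon>: "0 < \<epsilon>" "\<epsilon> \<le> 1 / 100"
  shows "\<exists>R \<theta> :: real \<Rightarrow> real.
     coupled_system (1 + \<epsilon>\<^sup>2) (\<epsilon>\<^sup>2 * c)
       (\<lambda>x. sqrt (R x) * cos (het c (\<epsilon> * \<theta> x) / 2)) (\<lambda>x. sqrt (R x) * sin (het c (\<epsilon> * \<theta> x) / 2))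
   \<and> (\<forall>x. 0 < R x \<and> R (- x) = R x \<and> \<bar>R x - 1\<bar> \<le> 2 * \<epsilon>\<^sup>2 * (sin (het c (\<epsilon> * \<theta> x)) - 2 * c))
   \<and> (\<forall>x. \<theta> (- x) = - \<theta> x \<and> \<bar>\<theta> x - x\<bar> \<le> 50 * \<epsilon>\<^sup>2 * \<bar>x\<bar>)
   \<and> (\<forall>x. \<exists>D<0. ((\<lambda>x. het c (\<epsilon> * \<theta> x)) has_real_derivative D) (at x))"
proof -
  define s where "s = (\<lambda>\<tau>. sin (het c (\<epsilon> * \<tau>)))"
  define y where "y = (\<lambda>\<tau>. s \<tau> - 2 * c)"
  define C where "C = (\<lambda>\<tau>. cos (het c (\<epsilon> * \<tau>)))"
  define e where "e = \<epsilon>\<^sup>2"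
  have e: "0 < e" "e \<le> 1 / 10000" using square_small[OF \<epsilon>] by (auto simp: e_def)
  obtain A B where AB: "\<And>\<tau>. \<bar>A \<tau>\<bar> \<le> 2" "\<And>\<tau>. \<bar>B \<tau>\<bar> \<le> 2"
    and par: "\<And>\<tau>. A (- \<tau>) = A \<tau>" "\<And>\<tau>. B (- \<tau>) = - B \<tau>"
    and dA: "\<And>\<tau>. (A has_real_derivative
          B \<tau> * slowness e (s \<tau>) (y \<tau>) (A \<tau>) (B \<tau>) + \<epsilon> * C \<tau> * A \<tau>) (at \<tau>)"
    and dB: "\<And>\<tau>. (B has_real_derivative
          virial e (s \<tau>) (y \<tau>) (A \<tau>) * slowness e (s \<tau>) (y \<tau>) (A \<tau>) (B \<tau>) + \<epsilon> * C \<tau> * B \<tau>) (at \<tau>)"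
    using radial_profile_ex[OF c \<epsilon>] unfolding s_def y_def C_def e_def by blast
  have s1: "\<bar>s \<tau>\<bar> \<le> 1" for \<tau> by (simp add: s_def)
  have ypos: "y \<tau> > 0" for \<tau> using het_excess_pos[OF c, of "\<epsilon> * \<tau>"] by (simp add: y_def s_def)
  have y1: "\<bar>y \<tau>\<bar> \<le> 1" for \<tau> using ypos[of \<tau>] s1[of \<tau>] c by (simp add: y_def)
  have even: "s (- \<tau>) = s \<tau>" "y (- \<tau>) = y \<tau>" for \<tau>
    by (simp_all add: y_def s_def het_minus)
  define g where "g = (\<lambda>\<tau>. slowness e (s \<tau>) (y \<tau>) (A \<tau>) (B \<tau>))"
  define V where "V = (\<lambda>\<tau>. virial e (s \<tau>) (y \<tau>) (A \<tau>))"
  have ds: "((\<lambda>\<tau>. het c (\<epsilon> * \<tau>)) has_real_derivative - (\<epsilon> * y \<tau>)) (at \<tau>)" for \<tau>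
    by (rule DERIV_cong[OF DERIV_chain2[OF DERIV_het[OF c] DERIV_cmult[OF DERIV_ident]]])
       (simp add: y_def s_def algebra_simps)
  have dy: "(y has_real_derivative - (\<epsilon> * C \<tau> * y \<tau>)) (at \<tau>)" for \<tau>
    unfolding y_def s_def
    by (rule DERIV_cong[OF DERIV_diff[OF DERIV_chain2[OF DERIV_sin ds] DERIV_const]])
       (simp add: C_def y_def s_def)
  have cont: "continuous_on UNIV f" if "\<And>\<tau>. (f has_real_derivative f' \<tau>) (at \<tau>)" for f f' :: "real \<Rightarrow> real"
    using that by (intro continuous_at_imp_continuous_on) (auto intro: DERIV_isCont)
  have cs: "continuous_on UNIV s"
    unfolding s_def by (intro continuous_intros cont[OF ds])
  have cg: "continuous_on UNIV g"
    unfolding g_def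
    by (rule continuous_slowness[OF e cs cont[OF dy] cont[OF dA] cont[OF dB] s1 y1 AB])
  have g_near: "\<bar>g \<tau> - 1\<bar> \<le> 25 * e" for \<tau>
    unfolding g_def by (rule slowness_near[OF e s1 y1 AB])
  have g_even: "g (- \<tau>) = g \<tau>" for \<tau> by (simp add: g_def par even slowness_def scaled_kinetic_def)
  have "25 * e \<le> 1 / 2" using e by simp
  then obtain \<theta> where d\<theta>: "\<And>x. (\<theta> has_real_derivative 1 / g (\<theta> x)) (at x)"
    and \<theta>_odd: "\<And>x. \<theta> (- x) = - \<theta> x" and \<theta>_near: "\<And>x. \<bar>\<theta> x - x\<bar> \<le> 2 * (25 * e) * \<bar>x\<bar>"
    using time_change[OF cg g_near _ g_even] by blast
  have gpos: "g \<tau> \<ge> 1 / 2" for \<tau> using g_near[of \<tau>] e by linarith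
  have gne: "g \<tau> \<noteq> 0" for \<tau> using gpos[of \<tau>] by linarith
  define R where "R = (\<lambda>x. radius_sq e (y (\<theta> x)) (A (\<theta> x)))"
  define R1 where "R1 = (\<lambda>x. e * (y (\<theta> x) * B (\<theta> x)))"
  define \<phi> where "\<phi> = (\<lambda>x. het c (\<epsilon> * \<theta> x))"
  define \<phi>1 where "\<phi>1 = (\<lambda>x. - (\<epsilon> * y (\<theta> x)) * (1 / g (\<theta> x)))"
  have Rpos: "R x > 0" for x using radius_sq_ge(1)[OF e y1 AB(1), of "\<theta> x" "\<theta> x"] by (simp add: R_def)
  have D_eq: "R x * sin (\<phi> x) - 2 * c = y (\<theta> x) * (1 + e * A (\<theta> x) * s (\<theta> x))" for x
  proof -
    have "sin (\<phi> x) = s (\<theta> x)" by (simp add: \<phi>_def s_def)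
    then show ?thesis by (simp add: R_def radius_sq_def y_def algebra_simps)
  qed
  have "coupled_system (1 + e) (e * c) (\<lambda>x. sqrt (R x) * cos (\<phi> x / 2)) (\<lambda>x. sqrt (R x) * sin (\<phi> x / 2))"
  proof (rule polar_coupled_system[of R R1 e \<phi> c \<phi>1])
    fix x
    define t where "t = \<theta> x"
    show "R x > 0" by (rule Rpos)
    show "(\<phi> has_real_derivative \<phi>1 x) (at x)"
      unfolding \<phi>_def \<phi>1_def by (rule DERIV_chain2[OF ds d\<theta>])
    show "\<phi>1 x < 0"
      using ypos[of "\<theta> x"] gpos[of "\<theta> x"] \<epsilon> by (simp add: \<phi>1_def)
    have "((\<lambda>\<tau>. radius_sq e (y \<tau>) (A \<tau>)) has_real_derivative e * (y t * (B t * g t))) (at t)"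
    proof -
      have "((\<lambda>\<tau>. 1 + e * (y \<tau> * A \<tau>)) has_real_derivative
          0 + e * (- (\<epsilon> * C t * y t) * A t + (B t * g t + \<epsilon> * C t * A t) * y t)) (at t)"
        using dA[of t] by (intro DERIV_add DERIV_const DERIV_cmult DERIV_mult dy) (simp add: g_def)
      then show ?thesis by (simp add: radius_sq_def algebra_simps)
    qed
    from DERIV_chain2[OF this[unfolded t_def] d\<theta>]
    show "(R has_real_derivative R1 x) (at x)"
      using gne[of "\<theta> x"] by (simp add: R_def R1_def)
    have "((\<lambda>\<tau>. e * (y \<tau> * B \<tau>)) has_real_derivative e * (y t * (V t * g t))) (at t)"
    proof -
      have "((\<lambda>\<tau>. e * (y \<tau> * B \<tau>)) has_real_derivative
          e * (- (\<epsilon> * C t * y t) * B t + (V t * g t + \<epsilon> * C t * B t) * y t)) (at t)"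
        using dB[of t] by (intro DERIV_cmult DERIV_mult dy) (simp add: g_def V_def)
      then show ?thesis by (simp add: algebra_simps)
    qed
    from DERIV_chain2[OF this[unfolded t_def] d\<theta>]
    have "(R1 has_real_derivative e * (y t * V t)) (at x)"
      using gne[of "\<theta> x"] by (simp add: R1_def t_def)
    moreover have "e * (y t * V t) = e * (R x * sin (\<phi> x) - 2 * c)\<^sup>2 / 2 + (R x - 1)\<^sup>2
        + 2 * R x * (R x - 1) + e * R x * sin (\<phi> x) * (R x * sin (\<phi> x) - 2 * c)"
    proof -
      have "R x = radius_sq e (y t) (A t)" "R x - 1 = e * y t * A t" "sin (\<phi> x) = s t"
        by (simp_all add: R_def t_def radius_sq_def \<phi>_def s_def)
      then show ?thesis
        unfolding D_eq t_def[symmetric] V_def virial_def scaled_potential_def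
        by (simp add: field_simps power2_eq_square)
    qed
    ultimately show "(R1 has_real_derivative e * (R x * sin (\<phi> x) - 2 * c)\<^sup>2 / 2 + (R x - 1)\<^sup>2
        + 2 * R x * (R x - 1) + e * R x * sin (\<phi> x) * (R x * sin (\<phi> x) - 2 * c)) (at x)"
      by simp
    show "(R x * \<phi>1 x)\<^sup>2 = e * R x * (R x * sin (\<phi> x) - 2 * c)\<^sup>2 + 2 * R x * (R x - 1)\<^sup>2 - (R1 x)\<^sup>2"
    proof -
      define K where "K = scaled_kinetic e (s t) (y t) (A t) (B t)"
      have K: "K > 0" using scaled_kinetic_ge(1)[OF e s1 y1 AB, of t t t t] by (simp add: K_def)
      have Rt: "R x = radius_sq e (y t) (A t)" by (simp add: R_def t_def)
      have g2: "(g t)\<^sup>2 = R x / K"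
        using K Rpos[of x] by (simp add: g_def slowness_def K_def Rt)
      have "R x * K = R x * scaled_potential e (s t) (A t) - e * (B t)\<^sup>2"
        using Rpos[of x] by (simp add: K_def scaled_kinetic_def Rt[symmetric] field_simps)
      moreover have "(R x * \<phi>1 x)\<^sup>2 = (R x)\<^sup>2 * e * (y t)\<^sup>2 / (g t)\<^sup>2"
        by (simp add: \<phi>1_def t_def e_def power_mult_distrib power_divide)
      moreover have "\<dots> = e * (y t)\<^sup>2 * (R x * K)"
        unfolding g2 using Rpos[of x] K by (simp add: power2_eq_square)
      moreover have "e * R x * (y t * q)\<^sup>2 + 2 * R x * (e * y t * A t)\<^sup>2 - (e * (y t * B t))\<^sup>2
          = e * (y t)\<^sup>2 * (R x * (q\<^sup>2 + 2 * e * (A t)\<^sup>2) - e * (B t)\<^sup>2)" for q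
        by (simp add: algebra_simps power2_eq_square)
      moreover have "R x - 1 = e * y t * A t" by (simp add: Rt radius_sq_def)
      ultimately show ?thesis
        unfolding D_eq t_def[symmetric] R1_def scaled_potential_def by (simp only:)
    qed
  qed
  moreover have "R (- x) = R x" for x by (simp add: R_def \<theta>_odd even par)
  moreover have "\<bar>R x - 1\<bar> \<le> 2 * e * (sin (het c (\<epsilon> * \<theta> x)) - 2 * c)" for x
  proof -
    have "\<bar>R x - 1\<bar> = e * (y (\<theta> x) * \<bar>A (\<theta> x)\<bar>)"
      using e ypos[of "\<theta> x"] by (simp add: R_def radius_sq_def abs_mult)
    also have "\<dots> \<le> e * (y (\<theta> x) * 2)"
      using e ypos[of "\<theta> x"] AB(1) by (intro mult_left_mono) auto
    finally show ?thesis by (simp add: y_def s_def algebra_simps)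
  qed
  moreover have "\<exists>D<0. (\<phi> has_real_derivative D) (at x)" for x
  proof (intro exI conjI)
    show "(\<phi> has_real_derivative \<phi>1 x) (at x)"
      unfolding \<phi>_def \<phi>1_def by (rule DERIV_chain2[OF ds d\<theta>])
    show "\<phi>1 x < 0"
      using ypos[of "\<theta> x"] gpos[of "\<theta> x"] \<epsilon> by (simp add: \<phi>1_def)
  qed
  ultimately show ?thesis
    using Rpos \<theta>_odd \<theta>_near unfolding \<phi>_def e_def
    by (intro exI[of _ R] exI[of _ \<theta>]) simp
qed

section \<open>The front in the original variables\<close>

lemma abs_cos_diff_le: "\<bar>cos x - cos y\<bar> \<le> \<bar>x - y\<bar>"
  and abs_sin_diff_le: "\<bar>sin x - sin y\<bar> \<le> \<bar>x - y\<bar>" for x y :: real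
proof -
  have "norm (cos x - cos y) \<le> 1 * norm (x - y)"
    by (rule field_differentiable_bound[of UNIV cos "\<lambda>x. - sin x"])
       (auto intro!: derivative_eq_intros)
  then show "\<bar>cos x - cos y\<bar> \<le> \<bar>x - y\<bar>" by simp
  have "norm (sin x - sin y) \<le> 1 * norm (x - y)"
    by (rule field_differentiable_bound[of UNIV sin cos]) (auto intro!: derivative_eq_intros)
  then show "\<bar>sin x - sin y\<bar> \<le> \<bar>x - y\<bar>" by simp
qed

text \<open>The prescribed limits are the point of the unit circle with phase angle \<open>\<beta>\<close>, the limit of \<open>het c\<close>
  at \<open>-\<infinity>\<close>; the inner square root in their definition is \<open>- cos \<beta>\<close>.\<close>
lemma bar_het:
  assumes c: "0 < c" "c < 1 / 2" and e: "e > 0"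
  defines "\<beta> \<equiv> pi / 2 + 2 * arctan (het_amp c)"
  shows "u_bar (1 + e) (e * c) = cos (\<beta> / 2)" "v_bar (1 + e) (e * c) = sin (\<beta> / 2)"
proof -
  have k: "sqrt (1 - 4 * (e * c)\<^sup>2 / (1 + e - 1)\<^sup>2) = het_rate c"
    using e by (simp add: het_rate_def power_mult_distrib)
  have "\<bar>arctan (het_amp c)\<bar> < pi / 4"
    using het_amp_bounds[OF c] arctan_less_iff[of "het_amp c" 1] arctan_one
      zero_less_arctan_iff[of "het_amp c"] by simp
  then have \<beta>: "0 < \<beta> / 2" "\<beta> / 2 < pi / 2" by (auto simp: \<beta>_def)
  have "cos \<beta> = - cos (pi - \<beta>)" by simp
  also have "pi - \<beta> = pi / 2 - 2 * arctan (het_amp c)" by (simp add: \<beta>_def)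
  finally have cb: "cos \<beta> = - het_rate c" by (simp only: cos_het_limit[OF c])
  have "(cos (\<beta> / 2))\<^sup>2 = (1 - het_rate c) / 2" "(sin (\<beta> / 2))\<^sup>2 = (1 + het_rate c) / 2"
    using cos_double_cos[of "\<beta> / 2"] cos_double_sin[of "\<beta> / 2"] cb by simp_all
  then show "u_bar (1 + e) (e * c) = cos (\<beta> / 2)" "v_bar (1 + e) (e * c) = sin (\<beta> / 2)"
    unfolding u_bar_def v_bar_def k using \<beta> cos_gt_zero_pi[of "\<beta> / 2"] sin_gt_zero[of "\<beta> / 2"]
    by (auto intro!: real_sqrt_unique)
qed

text \<open>Everything about the solution that the asymptotic analysis uses, for fixed parameters and with
  absolute constants, so that the limit \<open>\<Lambda> \<rightarrow> 1\<close> can be taken afterwards.\<close>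
definition front :: "real \<Rightarrow> real \<Rightarrow> (real \<Rightarrow> real) \<Rightarrow> (real \<Rightarrow> real) \<Rightarrow> bool" where
  "front c \<epsilon> u v \<longleftrightarrow>
     coupled_system (1 + \<epsilon>\<^sup>2) (\<epsilon>\<^sup>2 * c) u v
   \<and> (\<forall>x. u x > 0 \<and> v x > 0 \<and> u (- x) = v x)
   \<and> (\<forall>x. \<exists>D<0. (phase_angle u v has_real_derivative D) (at x))
   \<and> (\<exists>\<theta>. \<forall>x. phase_angle u v x = het c (\<epsilon> * \<theta> x) \<and> \<bar>\<theta> x - x\<bar> \<le> 50 * \<epsilon>\<^sup>2 * \<bar>x\<bar>)
   \<and> (\<forall>x. \<bar>(u x)\<^sup>2 + (v x)\<^sup>2 - 1\<bar>
          \<le> 8 * \<epsilon>\<^sup>2 * exp (- (het_rate c * \<epsilon> * (1 - 50 * \<epsilon>\<^sup>2) * \<bar>x\<bar>)))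
   \<and> (\<forall>x\<le>0. \<bar>u x - u_bar (1 + \<epsilon>\<^sup>2) (\<epsilon>\<^sup>2 * c)\<bar> + \<bar>v x - v_bar (1 + \<epsilon>\<^sup>2) (\<epsilon>\<^sup>2 * c)\<bar>
          \<le> 6 * exp (- (het_rate c * \<epsilon> * (1 - 50 * \<epsilon>\<^sup>2) * \<bar>x\<bar>)))"

text \<open>The decay is that of \<open>sin \<phi> - 2 c\<close>, evaluated at \<open>\<epsilon> \<theta> x\<close> with \<open>\<bar>\<theta> x\<bar> \<ge> (1 - 50 \<epsilon>\<^sup>2) \<bar>x\<bar>\<close>. In the left tail
  both the radius and the angle converge at this rate, and \<open>cos\<close> and \<open>sin\<close> are Lipschitz.\<close>
lemma front_ex:
  assumes c: "0 < c" "c < 1 / 2" and \<epsilon>: "0 < \<epsilon>" "\<epsilon> \<le> 1 / 100"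
  shows "\<exists>u v. front c \<epsilon> u v"
proof -
  obtain R \<theta> where
    sys: "coupled_system (1 + \<epsilon>\<^sup>2) (\<epsilon>\<^sup>2 * c)
       (\<lambda>x. sqrt (R x) * cos (het c (\<epsilon> * \<theta> x) / 2)) (\<lambda>x. sqrt (R x) * sin (het c (\<epsilon> * \<theta> x) / 2))"
    and Rpos: "\<And>x. 0 < R x" and Reven: "\<And>x. R (- x) = R x"
    and Rnear: "\<And>x. \<bar>R x - 1\<bar> \<le> 2 * \<epsilon>\<^sup>2 * (sin (het c (\<epsilon> * \<theta> x)) - 2 * c)"
    and \<theta>odd: "\<And>x. \<theta> (- x) = - \<theta> x" and \<theta>near: "\<And>x. \<bar>\<theta> x - x\<bar> \<le> 50 * \<epsilon>\<^sup>2 * \<bar>x\<bar>"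
    and mono: "\<And>x. \<exists>D<0. ((\<lambda>x. het c (\<epsilon> * \<theta> x)) has_real_derivative D) (at x)"
    using polar_front_ex[OF c \<epsilon>] by blast
  define \<phi> where "\<phi> = (\<lambda>x. het c (\<epsilon> * \<theta> x))"
  define u where "u = (\<lambda>x. sqrt (R x) * cos (\<phi> x / 2))"
  define v where "v = (\<lambda>x. sqrt (R x) * sin (\<phi> x / 2))"
  define E where "E = (\<lambda>x. exp (- (het_rate c * \<epsilon> * (1 - 50 * \<epsilon>\<^sup>2) * \<bar>x\<bar>)))"
  define \<beta> where "\<beta> = pi / 2 + 2 * arctan (het_amp c)"
  note k = het_rate_bounds[OF c] and e = square_small[OF \<epsilon>]
  have \<phi>r: "0 < \<phi> x" "\<phi> x < pi" for x using het_range[OF c] by (auto simp: \<phi>_def)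
  have cpos: "cos (\<phi> x / 2) > 0" and spos: "sin (\<phi> x / 2) > 0" for x
    using \<phi>r[of x] by (auto intro!: cos_gt_zero_pi sin_gt_zero)
  have upos: "u x > 0" "v x > 0" for x using Rpos cpos spos by (auto simp: u_def v_def)
  have refl: "u (- x) = v x" for x
  proof -
    have "\<phi> (- x) / 2 = pi / 2 - \<phi> x / 2"
      by (simp add: \<phi>_def \<theta>odd het_minus diff_divide_distrib)
    moreover have "cos (pi / 2 - t) = sin t" for t :: real by (simp add: cos_diff)
    ultimately have "cos (\<phi> (- x) / 2) = sin (\<phi> x / 2)" by (simp only:)
    then show ?thesis by (simp add: u_def v_def Reven)
  qed
  have phase: "phase_angle u v = \<phi>"
  proof
    fix x
    have "v x / u x = tan (\<phi> x / 2)" using Rpos[of x] by (simp add: u_def v_def tan_def)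
    then show "phase_angle u v x = \<phi> x"
      using \<phi>r[of x] by (simp add: phase_angle_def arctan_tan)
  qed
  have decay: "exp (- (het_rate c * \<bar>\<epsilon> * \<theta> x\<bar>)) \<le> E x" for x
  proof -
    have "(1 - 50 * \<epsilon>\<^sup>2) * \<bar>x\<bar> \<le> \<bar>\<theta> x\<bar>" using \<theta>near[of x] by (simp add: left_diff_distrib)
    then have "(het_rate c * \<epsilon>) * ((1 - 50 * \<epsilon>\<^sup>2) * \<bar>x\<bar>) \<le> (het_rate c * \<epsilon>) * \<bar>\<theta> x\<bar>"
      using k \<epsilon> by (intro mult_left_mono) auto
    then show ?thesis using \<epsilon> by (simp add: E_def abs_mult mult.assoc)
  qed
  have R1: "\<bar>R x - 1\<bar> \<le> 8 * \<epsilon>\<^sup>2 * E x" for x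
  proof -
    have "2 * \<epsilon>\<^sup>2 * (sin (het c (\<epsilon> * \<theta> x)) - 2 * c) \<le> 2 * \<epsilon>\<^sup>2 * (4 * E x)"
      using het_excess_le[OF c, of "\<epsilon> * \<theta> x"] decay[of x] by (intro mult_left_mono) auto
    from order_trans[OF Rnear this] show ?thesis by (simp add: mult_ac)
  qed
  have sum: "(u x)\<^sup>2 + (v x)\<^sup>2 = R x" for x
    using Rpos[of x] by (simp add: u_def v_def power_mult_distrib flip: distrib_left)
  have Epos: "E x > 0" for x by (simp add: E_def)
  have tail: "\<bar>u x - cos (\<beta> / 2)\<bar> \<le> 3 * E x \<and> \<bar>v x - sin (\<beta> / 2)\<bar> \<le> 3 * E x" if x: "x \<le> 0" for x
  proof -
    have "\<bar>\<theta> x - x\<bar> \<le> 1 * \<bar>x\<bar>"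
      using \<theta>near[of x] by (rule order_trans) (use e in \<open>intro mult_right_mono, auto\<close>)
    then have "\<theta> x \<le> 0" using x by auto
    then have "\<epsilon> * \<theta> x \<le> 0" using \<epsilon> by (simp add: mult_nonneg_nonpos)
    then have "\<bar>\<phi> x - \<beta>\<bar> \<le> 4 * E x"
      using het_at_bot_bound[OF c, of "\<epsilon> * \<theta> x"] decay[of x] by (simp add: \<phi>_def \<beta>_def)
    then have half: "\<bar>\<phi> x / 2 - \<beta> / 2\<bar> \<le> 2 * E x" by (simp flip: diff_divide_distrib)
    have "\<epsilon>\<^sup>2 * E x \<le> 1 / 8 * E x" using e Epos[of x] by (intro mult_right_mono) auto
    then have "\<bar>R x - 1\<bar> \<le> E x" using R1[of x] by simp
    moreover have "\<bar>sqrt (R x) - 1\<bar> \<le> \<bar>R x - 1\<bar>"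
    proof -
      have "E x \<le> 1" using k \<epsilon> e by (simp add: E_def)
      then have "\<bar>R x - 1\<bar> \<le> 8 * \<epsilon>\<^sup>2 * 1"
        by (intro order_trans[OF R1] mult_left_mono) auto
      then have "R x \<ge> 1 / 4" using e by linarith
      then show ?thesis using abs_sqrt_diff_le[of "R x" 1] by simp
    qed
    ultimately have sq: "\<bar>sqrt (R x) - 1\<bar> \<le> E x" by linarith
    have "\<bar>(sqrt (R x) - 1) * cos (\<phi> x / 2)\<bar> \<le> E x * 1"
      "\<bar>(sqrt (R x) - 1) * sin (\<phi> x / 2)\<bar> \<le> E x * 1"
      by (intro abs_mult_le sq abs_cos_le_one abs_sin_le_one)+
    moreover have "u x - cos (\<beta> / 2) = (sqrt (R x) - 1) * cos (\<phi> x / 2) + (cos (\<phi> x / 2) - cos (\<beta> / 2))"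
      "v x - sin (\<beta> / 2) = (sqrt (R x) - 1) * sin (\<phi> x / 2) + (sin (\<phi> x / 2) - sin (\<beta> / 2))"
      by (simp_all add: u_def v_def algebra_simps)
    ultimately show ?thesis
      using half abs_cos_diff_le[of "\<phi> x / 2" "\<beta> / 2"] abs_sin_diff_le[of "\<phi> x / 2" "\<beta> / 2"]
      by linarith
  qed
  have "front c \<epsilon> u v"
    unfolding front_def phase
  proof (intro conjI)
    show "coupled_system (1 + \<epsilon>\<^sup>2) (\<epsilon>\<^sup>2 * c) u v" using sys by (simp add: u_def v_def \<phi>_def)
    show "\<forall>x. u x > 0 \<and> v x > 0 \<and> u (- x) = v x" using upos refl by blast
    show "\<forall>x. \<exists>D<0. (\<phi> has_real_derivative D) (at x)" using mono by (simp add: \<phi>_def)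
    show "\<exists>\<theta>. \<forall>x. \<phi> x = het c (\<epsilon> * \<theta> x) \<and> \<bar>\<theta> x - x\<bar> \<le> 50 * \<epsilon>\<^sup>2 * \<bar>x\<bar>"
      using \<theta>near by (intro exI[of _ \<theta>]) (simp add: \<phi>_def)
    show "\<forall>x. \<bar>(u x)\<^sup>2 + (v x)\<^sup>2 - 1\<bar> \<le> 8 * \<epsilon>\<^sup>2 * exp (- (het_rate c * \<epsilon> * (1 - 50 * \<epsilon>\<^sup>2) * \<bar>x\<bar>))"
      using R1 unfolding sum E_def by blast
    show "\<forall>x\<le>0. \<bar>u x - u_bar (1 + \<epsilon>\<^sup>2) (\<epsilon>\<^sup>2 * c)\<bar> + \<bar>v x - v_bar (1 + \<epsilon>\<^sup>2) (\<epsilon>\<^sup>2 * c)\<bar>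
          \<le> 6 * exp (- (het_rate c * \<epsilon> * (1 - 50 * \<epsilon>\<^sup>2) * \<bar>x\<bar>))"
      unfolding bar_het[OF c e(1)] \<beta>_def[symmetric]
    proof (intro allI impI)
      fix x :: real assume "x \<le> 0"
      from tail[OF this, unfolded E_def]
      show "\<bar>u x - cos (\<beta> / 2)\<bar> + \<bar>v x - sin (\<beta> / 2)\<bar>
          \<le> 6 * exp (- (het_rate c * \<epsilon> * (1 - 50 * \<epsilon>\<^sup>2) * \<bar>x\<bar>))" by linarith
    qed
  qed
  then show ?thesis by blast
qed

lemma front_limits:
  assumes p: "front c \<epsilon> u v" and c: "0 < c" "c < 1 / 2" and \<epsilon>: "0 < \<epsilon>" "\<epsilon> \<le> 1 / 100"
  defines "ub \<equiv> u_bar (1 + \<epsilon>\<^sup>2) (\<epsilon>\<^sup>2 * c)" and "vb \<equiv> v_bar (1 + \<epsilon>\<^sup>2) (\<epsilon>\<^sup>2 * c)"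
  shows "(u \<longlongrightarrow> ub) at_bot" "(v \<longlongrightarrow> vb) at_bot" "(u \<longlongrightarrow> vb) at_top" "(v \<longlongrightarrow> ub) at_top"
proof -
  define k where "k = het_rate c * \<epsilon> * (1 - 50 * \<epsilon>\<^sup>2)"
  have k: "k > 0"
    using het_rate_bounds[OF c] square_small[OF \<epsilon>] \<epsilon> by (simp add: k_def)
  have bd: "\<bar>u x - ub\<bar> + \<bar>v x - vb\<bar> \<le> 6 * exp (- (k * \<bar>x\<bar>))" if "x \<le> 0" for x
    using p that unfolding front_def ub_def vb_def k_def by blast
  have lim: "((\<lambda>x. exp (k * x)) \<longlongrightarrow> 0) at_bot"
    using k by (intro filterlim_compose[OF exp_at_bot]
        filterlim_tendsto_pos_mult_at_bot[OF tendsto_const _ filterlim_ident]) auto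
  have gen: "(f \<longlongrightarrow> l) at_bot"
    if "\<And>x. x \<le> 0 \<Longrightarrow> \<bar>f x - l\<bar> \<le> 6 * exp (- (k * \<bar>x\<bar>))" for f :: "real \<Rightarrow> real" and l
  proof -
    have "((\<lambda>x. f x - l) \<longlongrightarrow> 0) at_bot"
    proof (rule tendsto_0_le[OF lim, where K = 6])
      show "\<forall>\<^sub>F x in at_bot. norm (f x - l) \<le> norm (exp (k * x)) * 6"
        using eventually_le_at_bot[of 0] by eventually_elim (use that in \<open>auto simp: mult.commute\<close>)
    qed
    then show ?thesis by (simp add: Lim_null[symmetric])
  qed
  show u: "(u \<longlongrightarrow> ub) at_bot" by (rule gen) (use bd in force)
  show v: "(v \<longlongrightarrow> vb) at_bot" by (rule gen) (use bd in force)
  have refl: "u (- x) = v x" for x using p unfolding front_def by blast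
  have "((\<lambda>x. u (- x)) \<longlongrightarrow> ub) at_top"
    by (rule filterlim_compose[OF u filterlim_uminus_at_bot_at_top])
  then show "(v \<longlongrightarrow> ub) at_top" by (simp add: refl)
  have "v (- x) = u x" for x using refl[of "- x"] by simp
  moreover have "((\<lambda>x. v (- x)) \<longlongrightarrow> vb) at_top"
    by (rule filterlim_compose[OF v filterlim_uminus_at_bot_at_top])
  ultimately show "(u \<longlongrightarrow> vb) at_top" by simp
qed

section \<open>Dependence on the parameters\<close>

text \<open>The hypothesis says that the arguments of the two \<open>tanh\<close> differ by a relative error \<open>\<eta>\<close>. It covers both the
  change of the rate with \<open>c\<close> and the distortion of the independent variable, and
  \<open>abs_tanh_mult_diff_le\<close> makes the resulting estimate uniform in \<open>x\<close>.\<close>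
lemma het_param_diff_le:
  assumes c: "0 < c" "c < 1 / 2" and c0: "0 < c0" "c0 < 1 / 2"
    and l: "\<bar>het_rate c * \<theta> - het_rate c0 * x\<bar> \<le> \<eta> * \<bar>het_rate c0 * x\<bar>" and \<eta>: "0 \<le> \<eta>" "\<eta> \<le> 1 / 2"
  shows "\<bar>het c \<theta> - het c0 x\<bar> \<le> 2 * \<bar>het_amp c - het_amp c0\<bar> + 16 * \<eta>"
proof (cases "x = 0")
  case True
  then have "\<theta> = 0" using l het_rate_bounds[OF c] by simp
  then show ?thesis using True \<eta> by (simp add: het_def)
next
  case False
  define z where "z = het_rate c0 * x / 2"
  have z: "z \<noteq> 0" using False het_rate_bounds[OF c0] by (simp add: z_def)
  define r where "r = (het_rate c * \<theta> / 2) / z"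
  have zr: "het_rate c * \<theta> / 2 = r * z" using z by (simp add: r_def)
  have "\<bar>r * z - z\<bar> \<le> \<eta> * \<bar>z\<bar>"
  proof -
    have "r * z - z = (het_rate c * \<theta> - het_rate c0 * x) / 2"
      unfolding zr[symmetric] by (simp add: z_def diff_divide_distrib)
    moreover have "\<eta> * \<bar>z\<bar> = (\<eta> * \<bar>het_rate c0 * x\<bar>) / 2" by (simp add: z_def)
    moreover have "\<bar>a\<bar> \<le> b" if "a = p / 2" "b = q / 2" "\<bar>p\<bar> \<le> q" for a b p q :: real
      using that by simp
    ultimately show ?thesis using l by blast
  qed
  then have "\<bar>r - 1\<bar> * \<bar>z\<bar> \<le> \<eta> * \<bar>z\<bar>" by (simp add: left_diff_distrib flip: abs_mult)
  then have r1: "\<bar>r - 1\<bar> \<le> \<eta>" using z by simp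
  then have "r \<ge> 1 / 2" using \<eta> by linarith
  from abs_tanh_mult_diff_le[OF this, of z]
  have th: "\<bar>tanh (r * z) - tanh z\<bar> \<le> 8 * \<eta>"
    by (rule order_trans) (use r1 in simp)
  have t1: "\<bar>tanh (r * z)\<bar> \<le> 1" using tanh_real_bounds[of "r * z"] by auto
  have a0: "\<bar>het_amp c0\<bar> \<le> 1" using het_amp_bounds[OF c0] by simp
  have "\<bar>het c \<theta> - het c0 x\<bar>
      = 2 * \<bar>arctan (het_amp c * tanh (r * z)) - arctan (het_amp c0 * tanh z)\<bar>"
  proof -
    have "\<bar>(h - 2 * p) - (h - 2 * q)\<bar> = 2 * \<bar>p - q\<bar>" for h p q :: real
      using abs_mult[of 2 "q - p"] abs_minus_commute[of p q] by (simp add: right_diff_distrib)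
    then show ?thesis unfolding het_def zr z_def[symmetric] .
  qed
  also have "\<dots> \<le> 2 * \<bar>het_amp c * tanh (r * z) - het_amp c0 * tanh z\<bar>"
    by (intro mult_left_mono abs_arctan_diff_le) simp
  also have "het_amp c * tanh (r * z) - het_amp c0 * tanh z
      = (het_amp c - het_amp c0) * tanh (r * z) + het_amp c0 * (tanh (r * z) - tanh z)"
    by (simp add: algebra_simps)
  also have "2 * \<bar>\<dots>\<bar> \<le> 2 * (\<bar>het_amp c - het_amp c0\<bar> * 1 + 1 * (8 * \<eta>))"
    by (intro mult_left_mono order_trans[OF abs_triangle_ineq] add_mono
        abs_mult_le order_refl t1 a0 th) simp
  finally show ?thesis by simp
qed

lemma eventually_lipschitz_at:
  fixes f :: "real \<Rightarrow> real"
  assumes "(f has_real_derivative D) (at a within S)"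
  shows "\<forall>\<^sub>F x in at a within S. \<bar>f x - f a\<bar> \<le> (\<bar>D\<bar> + 1) * \<bar>x - a\<bar>"
proof -
  have "((\<lambda>x. \<bar>(f x - f a) / (x - a)\<bar>) \<longlongrightarrow> \<bar>D\<bar>) (at a within S)"
    using assms unfolding has_field_derivative_iff by (rule tendsto_rabs)
  then have "\<forall>\<^sub>F x in at a within S. \<bar>(f x - f a) / (x - a)\<bar> < \<bar>D\<bar> + 1"
    by (rule order_tendstoD) simp
  moreover have "\<forall>\<^sub>F x in at a within S. x \<noteq> a"
    by (simp add: eventually_at_filter)
  ultimately show ?thesis
    by eventually_elim (simp add: divide_less_eq abs_divide less_imp_le)
qed

lemma het_params_lipschitz:
  assumes c0: "0 < c0" "c0 < 1 / 2"
  shows "\<exists>K>0. \<forall>\<^sub>F c in nhds c0. \<bar>het_rate c - het_rate c0\<bar> \<le> K * \<bar>c - c0\<bar>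
                          \<and> \<bar>het_amp c - het_amp c0\<bar> \<le> K * \<bar>c - c0\<bar>"
proof -
  have "1 - 4 * c0\<^sup>2 > 0" unfolding het_rate_factor using c0 by simp
  then have "\<exists>D. (het_rate has_real_derivative D) (at c0)"
    unfolding het_rate_def by (intro exI) (rule derivative_eq_intros refl | simp)+
  then obtain D1 where D1: "(het_rate has_real_derivative D1) (at c0)" ..
  have pos: "(1 - 2 * c0) / (1 + 2 * c0) > 0" using c0 by auto
  have "((\<lambda>c. (1 - 2 * c) / (1 + 2 * c)) has_real_derivative
      ((- 2) * (1 + 2 * c0) - (1 - 2 * c0) * 2) / ((1 + 2 * c0) * (1 + 2 * c0))) (at c0)"
    using c0 by (auto intro!: derivative_eq_intros)
  from DERIV_chain2[OF DERIV_real_sqrt[OF pos] this]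
  have "\<exists>D. (het_amp has_real_derivative D) (at c0)"
    unfolding het_amp_def by blast
  then obtain D2 where D2: "(het_amp has_real_derivative D2) (at c0)" ..
  have "\<forall>\<^sub>F c in at c0. \<bar>het_rate c - het_rate c0\<bar> \<le> (\<bar>D1\<bar> + \<bar>D2\<bar> + 1) * \<bar>c - c0\<bar>
      \<and> \<bar>het_amp c - het_amp c0\<bar> \<le> (\<bar>D1\<bar> + \<bar>D2\<bar> + 1) * \<bar>c - c0\<bar>"
    using eventually_lipschitz_at[OF D1] eventually_lipschitz_at[OF D2]
  proof eventually_elim
    case (elim c)
    have "(\<bar>D1\<bar> + 1) * \<bar>c - c0\<bar> \<le> (\<bar>D1\<bar> + \<bar>D2\<bar> + 1) * \<bar>c - c0\<bar>"
      "(\<bar>D2\<bar> + 1) * \<bar>c - c0\<bar> \<le> (\<bar>D1\<bar> + \<bar>D2\<bar> + 1) * \<bar>c - c0\<bar>"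
      by (intro mult_right_mono; simp)+
    then show ?case using elim by linarith
  qed
  then show ?thesis
    by (intro exI[of _ "\<bar>D1\<bar> + \<bar>D2\<bar> + 1"]) (simp add: eventually_nhds_conv_at add_nonneg_pos)
qed

text \<open>Collects what smallness of \<open>\<epsilon>\<close> has to guarantee. Differentiability of \<open>\<omega>t\<close> at \<open>0\<close> gives
  \<open>c - c\<^sub>0 = O(\<epsilon>)\<close>, and rate and amplitude depend differentiably on \<open>c\<close>. The condition on \<open>(L + 1) \<epsilon>\<close> keeps the
  relative error in \<open>het_param_diff_le\<close> below \<open>1/2\<close>.\<close>
lemma eventually_params:
  assumes c0: "0 < c0" "c0 < 1 / 2" and C2: "C2_within \<omega>t {0..}" and \<omega>0: "\<omega>t 0 = 0"
  shows "\<exists>L>0. \<forall>\<^sub>F \<epsilon> in at_right 0. 0 < \<epsilon> \<and> \<epsilon> \<le> 1 / 100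
     \<and> (L + 1) * \<epsilon> \<le> het_rate c0 / 2 \<and> 0 < c0 + \<omega>t \<epsilon> \<and> c0 + \<omega>t \<epsilon> < 1 / 2
     \<and> \<bar>het_rate (c0 + \<omega>t \<epsilon>) - het_rate c0\<bar> \<le> L * \<epsilon>
     \<and> \<bar>het_amp (c0 + \<omega>t \<epsilon>) - het_amp c0\<bar> \<le> L * \<epsilon>"
proof -
  obtain D where "(\<omega>t has_real_derivative D) (at 0 within {0..})"
    using C2 unfolding C2_within_def by auto
  then have D: "(\<omega>t has_real_derivative D) (at_right 0)"
    by (rule DERIV_subset) auto
  have "(\<omega>t \<longlongrightarrow> \<omega>t 0) (at_right 0)"
    using DERIV_continuous[OF D] by (simp add: continuous_within)
  then have lim: "((\<lambda>\<epsilon>. c0 + \<omega>t \<epsilon>) \<longlongrightarrow> c0) (at_right 0)"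
    using tendsto_add[OF tendsto_const[of c0]] \<omega>0 by fastforce
  obtain K where K: "K > 0" and ev: "\<forall>\<^sub>F c in nhds c0. \<bar>het_rate c - het_rate c0\<bar> \<le> K * \<bar>c - c0\<bar>
      \<and> \<bar>het_amp c - het_amp c0\<bar> \<le> K * \<bar>c - c0\<bar>"
    using het_params_lipschitz[OF c0] by blast
  define L where "L = K * (\<bar>D\<bar> + 1)"
  have L: "L > 0" using K by (simp add: L_def add_nonneg_pos)
  define b where "b = min (1 / 100) (het_rate c0 / 2 / (L + 1))"
  have b: "b > 0" using L het_rate_bounds[OF c0] by (simp add: b_def)
  have "\<forall>\<^sub>F \<epsilon> in at_right 0. \<epsilon> \<in> {0<..<b}" using b by (rule eventually_at_right_real)
  moreover note order_tendstoD(1)[OF lim c0(1)] order_tendstoD(2)[OF lim c0(2)]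
  moreover note eventually_lipschitz_at[OF D] eventually_compose_filterlim[OF ev lim]
  ultimately have "\<forall>\<^sub>F \<epsilon> in at_right 0. 0 < \<epsilon> \<and> \<epsilon> \<le> 1 / 100
     \<and> (L + 1) * \<epsilon> \<le> het_rate c0 / 2 \<and> 0 < c0 + \<omega>t \<epsilon> \<and> c0 + \<omega>t \<epsilon> < 1 / 2
     \<and> \<bar>het_rate (c0 + \<omega>t \<epsilon>) - het_rate c0\<bar> \<le> L * \<epsilon>
     \<and> \<bar>het_amp (c0 + \<omega>t \<epsilon>) - het_amp c0\<bar> \<le> L * \<epsilon>"
  proof eventually_elim
    case (elim \<epsilon>)
    have \<epsilon>: "0 < \<epsilon>" "\<epsilon> \<le> 1 / 100" "\<epsilon> \<le> het_rate c0 / 2 / (L + 1)"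
      using elim(1) by (auto simp: b_def)
    have "K * \<bar>c0 + \<omega>t \<epsilon> - c0\<bar> \<le> K * ((\<bar>D\<bar> + 1) * \<epsilon>)"
      using elim(4) K \<epsilon> \<omega>0 by (intro mult_left_mono) auto
    then have "K * \<bar>c0 + \<omega>t \<epsilon> - c0\<bar> \<le> L * \<epsilon>" by (simp add: L_def mult.assoc)
    moreover have "(L + 1) * \<epsilon> \<le> het_rate c0 / 2"
      using \<epsilon>(3) L by (simp add: le_divide_eq algebra_simps)
    ultimately show ?case using elim \<epsilon> by auto
  qed
  then show ?thesis using L by blast
qed

section \<open>Passage to the limit\<close>

lemma filterlim_sqrt_at_right_1: "filterlim (\<lambda>\<Lambda>. sqrt (\<Lambda> - 1)) (at_right 0) (at_right 1)"
proof -
  have "((\<lambda>\<Lambda>. sqrt (\<Lambda> - 1)) \<longlongrightarrow> sqrt (1 - 1)) (at_right (1 :: real))"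
    by (intro tendsto_intros)
  moreover have "\<forall>\<^sub>F \<Lambda> in at_right (1 :: real). sqrt (\<Lambda> - 1) \<in> {0<..} \<and> sqrt (\<Lambda> - 1) \<noteq> 0"
    by (simp add: eventually_at_filter)
  ultimately show ?thesis by (simp add: filterlim_at)
qed

text \<open>Replacing the rate at \<open>c\<close> by the one at \<open>c\<^sub>0\<close> costs \<open>L \<epsilon>\<close>, and the distortion \<open>1 - 50 \<epsilon>\<^sup>2\<close> costs at most another
  \<open>\<epsilon>\<close>; the further factor \<open>\<epsilon>\<close> in the exponent turns both into \<open>O(\<epsilon>\<^sup>2)\<close>.\<close>
lemma front_rate_le:
  fixes k k0 L \<epsilon> C x :: real
  assumes k: "\<bar>k - k0\<bar> \<le> L * \<epsilon>" "0 < k" "k < 1" and \<epsilon>: "0 < \<epsilon>" "\<epsilon> \<le> 1 / 100"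
    and C: "L + 1 \<le> C"
  shows "exp (- (k * \<epsilon> * (1 - 50 * \<epsilon>\<^sup>2) * \<bar>x\<bar>)) \<le> exp (- (k0 * \<epsilon> - C * \<epsilon>\<^sup>2) * \<bar>x\<bar>)"
proof -
  have "50 * \<epsilon>\<^sup>2 \<le> \<epsilon>"
    using mult_right_mono[of "50 * \<epsilon>" 1 \<epsilon>] \<epsilon> by (simp add: power2_eq_square)
  then have "k * (50 * \<epsilon>\<^sup>2) \<le> 1 * \<epsilon>" using k \<epsilon> by (intro mult_mono) auto
  then have "k0 - L * \<epsilon> - \<epsilon> \<le> k * (1 - 50 * \<epsilon>\<^sup>2)" using k by (simp add: algebra_simps)
  moreover have "(L + 1) * \<epsilon> \<le> C * \<epsilon>" using C \<epsilon> by (intro mult_right_mono) auto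
  ultimately have "k0 - C * \<epsilon> \<le> k * (1 - 50 * \<epsilon>\<^sup>2)" by (simp add: distrib_right)
  then have "(k0 - C * \<epsilon>) * \<epsilon> * \<bar>x\<bar> \<le> k * (1 - 50 * \<epsilon>\<^sup>2) * \<epsilon> * \<bar>x\<bar>"
    using \<epsilon> by (intro mult_right_mono) auto
  then show ?thesis by (simp add: algebra_simps power2_eq_square)
qed

theorem theorem1p2:
  fixes c\<^sub>0 :: real and \<omega>t \<omega> :: "real \<Rightarrow> real"
  assumes "0 < c\<^sub>0" and "c\<^sub>0 < 1 / 2"
    and "C2_within \<omega>t {0..}" and "\<omega>t 0 = 0"
    and "\<And>\<Lambda>. \<Lambda> > 1 \<Longrightarrow> \<omega> \<Lambda> / (\<Lambda> - 1) = c\<^sub>0 + \<omega>t (sqrt (\<Lambda> - 1))"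
  shows "\<exists>u v :: real \<Rightarrow> real \<Rightarrow> real.
      (\<forall>\<^sub>F \<Lambda> in at_right 1.
         coupled_system \<Lambda> (\<omega> \<Lambda>) (u \<Lambda>) (v \<Lambda>)
       \<and> (\<forall>x. u \<Lambda> x > 0 \<and> v \<Lambda> x > 0)
       \<and> (u \<Lambda> \<longlongrightarrow> u_bar \<Lambda> (\<omega> \<Lambda>)) at_bot \<and> (v \<Lambda> \<longlongrightarrow> v_bar \<Lambda> (\<omega> \<Lambda>)) at_bot
       \<and> (u \<Lambda> \<longlongrightarrow> v_bar \<Lambda> (\<omega> \<Lambda>)) at_top \<and> (v \<Lambda> \<longlongrightarrow> u_bar \<Lambda> (\<omega> \<Lambda>)) at_top
       \<and> (\<forall>x. u \<Lambda> (- x) = v \<Lambda> x)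
       \<and> (\<forall>x. \<exists>D<0. (phase_angle (u \<Lambda>) (v \<Lambda>) has_real_derivative D) (at x)))
    \<and> exp_decay_bound UNIV (\<lambda>\<Lambda>. \<Lambda> - 1) (\<lambda>\<Lambda>. sqrt (1 - 4 * c\<^sub>0\<^sup>2) * sqrt (\<Lambda> - 1)) (\<lambda>\<Lambda>. \<Lambda> - 1)
        (\<lambda>\<Lambda> x. (u \<Lambda> x)\<^sup>2 + (v \<Lambda> x)\<^sup>2 - 1)
    \<and> (\<exists>C>0. \<forall>\<^sub>F \<Lambda> in at_right 1. \<forall>x.
         \<bar>phase_angle (u \<Lambda>) (v \<Lambda>) x - phi0 c\<^sub>0 (x * sqrt (\<Lambda> - 1))\<bar> \<le> C * sqrt (\<Lambda> - 1))
    \<and> exp_decay_bound {..<0} (\<lambda>\<Lambda>. 1) (\<lambda>\<Lambda>. sqrt (1 - 4 * c\<^sub>0\<^sup>2) * sqrt (\<Lambda> - 1)) (\<lambda>\<Lambda>. \<Lambda> - 1)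
        (\<lambda>\<Lambda> x. \<bar>u \<Lambda> x - u_bar \<Lambda> (\<omega> \<Lambda>)\<bar> + \<bar>v \<Lambda> x - v_bar \<Lambda> (\<omega> \<Lambda>)\<bar>)"
proof -
  note c0 = assms(1,2)
  define k0 where "k0 = het_rate c\<^sub>0"
  have k0: "0 < k0" using het_rate_bounds[OF c0] by (simp add: k0_def)
  define \<epsilon> where "\<epsilon> = (\<lambda>\<Lambda> :: real. sqrt (\<Lambda> - 1))"
  define c where "c = (\<lambda>\<Lambda>. c\<^sub>0 + \<omega>t (\<epsilon> \<Lambda>))"
  obtain L where L: "L > 0" and ev: "\<forall>\<^sub>F \<epsilon> in at_right 0. 0 < \<epsilon> \<and> \<epsilon> \<le> 1 / 100
     \<and> (L + 1) * \<epsilon> \<le> het_rate c\<^sub>0 / 2 \<and> 0 < c\<^sub>0 + \<omega>t \<epsilon> \<and> c\<^sub>0 + \<omega>t \<epsilon> < 1 / 2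
     \<and> \<bar>het_rate (c\<^sub>0 + \<omega>t \<epsilon>) - het_rate c\<^sub>0\<bar> \<le> L * \<epsilon>
     \<and> \<bar>het_amp (c\<^sub>0 + \<omega>t \<epsilon>) - het_amp c\<^sub>0\<bar> \<le> L * \<epsilon>"
    using eventually_params[OF assms(1-4)] by blast
  define good where "good = (\<lambda>\<Lambda>. 0 < \<epsilon> \<Lambda> \<and> \<epsilon> \<Lambda> \<le> 1 / 100 \<and> (L + 1) * \<epsilon> \<Lambda> \<le> k0 / 2
     \<and> 0 < c \<Lambda> \<and> c \<Lambda> < 1 / 2 \<and> \<bar>het_rate (c \<Lambda>) - k0\<bar> \<le> L * \<epsilon> \<Lambda>
     \<and> \<bar>het_amp (c \<Lambda>) - het_amp c\<^sub>0\<bar> \<le> L * \<epsilon> \<Lambda>)"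
  have good: "\<forall>\<^sub>F \<Lambda> in at_right 1. good \<Lambda>"
    using eventually_compose_filterlim[OF ev filterlim_sqrt_at_right_1]
    by (simp add: good_def c_def \<epsilon>_def k0_def)
  have "\<forall>\<Lambda>. \<exists>u v. good \<Lambda> \<longrightarrow> front (c \<Lambda>) (\<epsilon> \<Lambda>) u v"
    using front_ex unfolding good_def by blast
  then have "\<exists>U V. \<forall>\<Lambda>. good \<Lambda> \<longrightarrow> front (c \<Lambda>) (\<epsilon> \<Lambda>) (U \<Lambda>) (V \<Lambda>)"
    by metis
  then obtain u v where uv: "\<And>\<Lambda>. good \<Lambda> \<Longrightarrow> front (c \<Lambda>) (\<epsilon> \<Lambda>) (u \<Lambda>) (v \<Lambda>)" by blast
  have par: "1 + (\<epsilon> \<Lambda>)\<^sup>2 = \<Lambda>" "(\<epsilon> \<Lambda>)\<^sup>2 = \<Lambda> - 1" "(\<epsilon> \<Lambda>)\<^sup>2 * c \<Lambda> = \<omega> \<Lambda>" if "good \<Lambda>" for \<Lambda>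
  proof -
    have \<Lambda>: "\<Lambda> > 1" using that by (simp add: good_def \<epsilon>_def)
    then show "1 + (\<epsilon> \<Lambda>)\<^sup>2 = \<Lambda>" and sq: "(\<epsilon> \<Lambda>)\<^sup>2 = \<Lambda> - 1" by (simp_all add: \<epsilon>_def)
    show "(\<epsilon> \<Lambda>)\<^sup>2 * c \<Lambda> = \<omega> \<Lambda>"
      using assms(5)[OF \<Lambda>] \<Lambda> unfolding sq by (simp add: c_def \<epsilon>_def field_simps)
  qed
  \<comment> \<open>In \<open>L + 9\<close> the term \<open>L + 1\<close> is needed for the rate, and \<open>8\<close> dominates the prefactors \<open>8\<close> and \<open>6\<close> of \<open>front\<close>.\<close>
  have rate: "exp (- (het_rate (c \<Lambda>) * \<epsilon> \<Lambda> * (1 - 50 * (\<epsilon> \<Lambda>)\<^sup>2) * \<bar>x\<bar>))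
      \<le> exp (- (sqrt (1 - 4 * c\<^sub>0\<^sup>2) * sqrt (\<Lambda> - 1) - (L + 9) * (\<Lambda> - 1)) * \<bar>x\<bar>)"
    if g: "good \<Lambda>" for \<Lambda> x
  proof -
    have "0 < het_rate (c \<Lambda>)" "het_rate (c \<Lambda>) < 1"
      using g by (auto simp: good_def het_rate_bounds)
    then have "exp (- (het_rate (c \<Lambda>) * \<epsilon> \<Lambda> * (1 - 50 * (\<epsilon> \<Lambda>)\<^sup>2) * \<bar>x\<bar>))
        \<le> exp (- (k0 * \<epsilon> \<Lambda> - (L + 9) * (\<epsilon> \<Lambda>)\<^sup>2) * \<bar>x\<bar>)"
      using g by (intro front_rate_le[where L = L]) (auto simp: good_def)
    then show ?thesis unfolding par(2)[OF g] by (simp add: k0_def het_rate_def \<epsilon>_def)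
  qed
  show ?thesis
  proof (rule exI[of _ u], rule exI[of _ v], intro conjI)
    show "\<forall>\<^sub>F \<Lambda> in at_right 1.
         coupled_system \<Lambda> (\<omega> \<Lambda>) (u \<Lambda>) (v \<Lambda>)
       \<and> (\<forall>x. u \<Lambda> x > 0 \<and> v \<Lambda> x > 0)
       \<and> (u \<Lambda> \<longlongrightarrow> u_bar \<Lambda> (\<omega> \<Lambda>)) at_bot \<and> (v \<Lambda> \<longlongrightarrow> v_bar \<Lambda> (\<omega> \<Lambda>)) at_bot
       \<and> (u \<Lambda> \<longlongrightarrow> v_bar \<Lambda> (\<omega> \<Lambda>)) at_top \<and> (v \<Lambda> \<longlongrightarrow> u_bar \<Lambda> (\<omega> \<Lambda>)) at_top
       \<and> (\<forall>x. u \<Lambda> (- x) = v \<Lambda> x)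
       \<and> (\<forall>x. \<exists>D<0. (phase_angle (u \<Lambda>) (v \<Lambda>) has_real_derivative D) (at x))"
      using good
    proof eventually_elim
      case (elim \<Lambda>)
      have "0 < c \<Lambda>" "c \<Lambda> < 1 / 2" "0 < \<epsilon> \<Lambda>" "\<epsilon> \<Lambda> \<le> 1 / 100" using elim by (auto simp: good_def)
      from front_limits[OF uv[OF elim] this] uv[OF elim, unfolded front_def]
      show ?case unfolding par(1,3)[OF elim] by blast
    qed
    show "exp_decay_bound UNIV (\<lambda>\<Lambda>. \<Lambda> - 1) (\<lambda>\<Lambda>. sqrt (1 - 4 * c\<^sub>0\<^sup>2) * sqrt (\<Lambda> - 1)) (\<lambda>\<Lambda>. \<Lambda> - 1)
        (\<lambda>\<Lambda> x. (u \<Lambda> x)\<^sup>2 + (v \<Lambda> x)\<^sup>2 - 1)"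
      unfolding exp_decay_bound_def
    proof (intro exI[of _ "L + 9"] conjI)
      show "\<forall>\<^sub>F \<Lambda> in at_right 1. \<forall>x\<in>UNIV. \<bar>(u \<Lambda> x)\<^sup>2 + (v \<Lambda> x)\<^sup>2 - 1\<bar> \<le> (L + 9) * (\<Lambda> - 1) *
          exp (- (sqrt (1 - 4 * c\<^sub>0\<^sup>2) * sqrt (\<Lambda> - 1) - (L + 9) * (\<Lambda> - 1)) * \<bar>x\<bar>)"
        using good
      proof eventually_elim
        case g: (elim \<Lambda>)
        show ?case
        proof
          fix x :: real
          have "\<bar>(u \<Lambda> x)\<^sup>2 + (v \<Lambda> x)\<^sup>2 - 1\<bar>
              \<le> 8 * (\<epsilon> \<Lambda>)\<^sup>2 * exp (- (het_rate (c \<Lambda>) * \<epsilon> \<Lambda> * (1 - 50 * (\<epsilon> \<Lambda>)\<^sup>2) * \<bar>x\<bar>))"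
            using uv[OF g] unfolding front_def by blast
          also have "\<dots> \<le> (L + 9) * (\<epsilon> \<Lambda>)\<^sup>2 *
              exp (- (sqrt (1 - 4 * c\<^sub>0\<^sup>2) * sqrt (\<Lambda> - 1) - (L + 9) * (\<Lambda> - 1)) * \<bar>x\<bar>)"
            using L by (intro mult_mono mult_right_mono rate[OF g]) auto
          finally show "\<bar>(u \<Lambda> x)\<^sup>2 + (v \<Lambda> x)\<^sup>2 - 1\<bar> \<le> (L + 9) * (\<Lambda> - 1) *
              exp (- (sqrt (1 - 4 * c\<^sub>0\<^sup>2) * sqrt (\<Lambda> - 1) - (L + 9) * (\<Lambda> - 1)) * \<bar>x\<bar>)"
            unfolding par(2)[OF g] .
        qed
      qed
    qed (use L in simp)
    show "\<exists>C>0. \<forall>\<^sub>F \<Lambda> in at_right 1. \<forall>x.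
         \<bar>phase_angle (u \<Lambda>) (v \<Lambda>) x - phi0 c\<^sub>0 (x * sqrt (\<Lambda> - 1))\<bar> \<le> C * sqrt (\<Lambda> - 1)"
    proof (intro exI[of _ "2 * L + 16 * ((L + 1) / k0)"] conjI)
      show "\<forall>\<^sub>F \<Lambda> in at_right 1. \<forall>x. \<bar>phase_angle (u \<Lambda>) (v \<Lambda>) x - phi0 c\<^sub>0 (x * sqrt (\<Lambda> - 1))\<bar>
          \<le> (2 * L + 16 * ((L + 1) / k0)) * sqrt (\<Lambda> - 1)"
        using good
      proof eventually_elim
        case g: (elim \<Lambda>)
        show ?case
        proof
          fix x :: real
          define e where "e = \<epsilon> \<Lambda>"
          have c: "0 < c \<Lambda>" "c \<Lambda> < 1 / 2" and e: "0 < e" "e \<le> 1 / 100" "(L + 1) * e \<le> k0 / 2"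
            and dk: "\<bar>het_rate (c \<Lambda>) - k0\<bar> \<le> L * e" and da: "\<bar>het_amp (c \<Lambda>) - het_amp c\<^sub>0\<bar> \<le> L * e"
            using g by (auto simp: good_def e_def)
          obtain \<theta> where ph: "phase_angle (u \<Lambda>) (v \<Lambda>) x = het (c \<Lambda>) (e * \<theta>)"
            and \<theta>: "\<bar>\<theta> - x\<bar> \<le> 50 * e\<^sup>2 * \<bar>x\<bar>"
            using uv[OF g] unfolding front_def e_def by blast
          have "50 * e\<^sup>2 \<le> e"
            using mult_right_mono[of "50 * e" 1 e] e by (simp add: power2_eq_square)
          then have "\<bar>\<theta> - x\<bar> \<le> e * \<bar>x\<bar>"
            using \<theta> mult_right_mono[of "50 * e\<^sup>2" e "\<bar>x\<bar>"] by linarith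
          moreover have "\<bar>het_rate (c \<Lambda>)\<bar> \<le> 1" using het_rate_bounds[OF c] by simp
          ultimately have "\<bar>het_rate (c \<Lambda>) * (\<theta> - x)\<bar> \<le> 1 * (e * \<bar>x\<bar>)"
            by (intro abs_mult_le)
          moreover have "\<bar>(het_rate (c \<Lambda>) - k0) * x\<bar> \<le> L * e * \<bar>x\<bar>"
            by (intro abs_mult_le dk) simp
          ultimately have "\<bar>het_rate (c \<Lambda>) * \<theta> - k0 * x\<bar> \<le> (L + 1) * e * \<bar>x\<bar>"
            by (simp add: algebra_simps)
          then have le: "e * \<bar>het_rate (c \<Lambda>) * \<theta> - k0 * x\<bar> \<le> e * ((L + 1) * e * \<bar>x\<bar>)"
            using e by (intro mult_left_mono) auto
          have "\<bar>het_rate (c \<Lambda>) * (e * \<theta>) - k0 * (e * x)\<bar> \<le> (L + 1) * e / k0 * \<bar>k0 * (e * x)\<bar>"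
          proof -
            have "het_rate (c \<Lambda>) * (e * \<theta>) - k0 * (e * x) = e * (het_rate (c \<Lambda>) * \<theta> - k0 * x)"
              by (simp add: algebra_simps)
            moreover have "(L + 1) * e / k0 * \<bar>k0 * (e * x)\<bar> = e * ((L + 1) * e * \<bar>x\<bar>)"
              using k0 e by (simp add: abs_mult)
            ultimately show ?thesis using le e by (simp add: abs_mult)
          qed
          moreover have "0 \<le> (L + 1) * e / k0" "(L + 1) * e / k0 \<le> 1 / 2"
            using L e k0 by (auto simp: divide_le_eq)
          ultimately have "\<bar>het (c \<Lambda>) (e * \<theta>) - het c\<^sub>0 (e * x)\<bar>
              \<le> 2 * \<bar>het_amp (c \<Lambda>) - het_amp c\<^sub>0\<bar> + 16 * ((L + 1) * e / k0)"
            unfolding k0_def by (intro het_param_diff_le c c0)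
          also have "\<dots> \<le> 2 * (L * e) + 16 * ((L + 1) * e / k0)" using da by simp
          also have "\<dots> = (2 * L + 16 * ((L + 1) / k0)) * e" by (simp add: distrib_right)
          finally show "\<bar>phase_angle (u \<Lambda>) (v \<Lambda>) x - phi0 c\<^sub>0 (x * sqrt (\<Lambda> - 1))\<bar>
              \<le> (2 * L + 16 * ((L + 1) / k0)) * sqrt (\<Lambda> - 1)"
            unfolding ph phi0_eq_het[OF c0] by (simp add: e_def \<epsilon>_def mult.commute)
        qed
      qed
    qed (use L k0 in \<open>simp add: add_pos_pos\<close>)
    show "exp_decay_bound {..<0} (\<lambda>\<Lambda>. 1) (\<lambda>\<Lambda>. sqrt (1 - 4 * c\<^sub>0\<^sup>2) * sqrt (\<Lambda> - 1)) (\<lambda>\<Lambda>. \<Lambda> - 1)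
        (\<lambda>\<Lambda> x. \<bar>u \<Lambda> x - u_bar \<Lambda> (\<omega> \<Lambda>)\<bar> + \<bar>v \<Lambda> x - v_bar \<Lambda> (\<omega> \<Lambda>)\<bar>)"
      unfolding exp_decay_bound_def
    proof (intro exI[of _ "L + 9"] conjI)
      show "\<forall>\<^sub>F \<Lambda> in at_right 1. \<forall>x\<in>{..<0}.
          \<bar>\<bar>u \<Lambda> x - u_bar \<Lambda> (\<omega> \<Lambda>)\<bar> + \<bar>v \<Lambda> x - v_bar \<Lambda> (\<omega> \<Lambda>)\<bar>\<bar> \<le> (L + 9) * 1 *
          exp (- (sqrt (1 - 4 * c\<^sub>0\<^sup>2) * sqrt (\<Lambda> - 1) - (L + 9) * (\<Lambda> - 1)) * \<bar>x\<bar>)"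
        using good
      proof eventually_elim
        case g: (elim \<Lambda>)
        show ?case
        proof
          fix x :: real assume "x \<in> {..<0}"
          then have x: "x \<le> 0" by simp
          have "\<bar>\<bar>u \<Lambda> x - u_bar \<Lambda> (\<omega> \<Lambda>)\<bar> + \<bar>v \<Lambda> x - v_bar \<Lambda> (\<omega> \<Lambda>)\<bar>\<bar>
              = \<bar>u \<Lambda> x - u_bar \<Lambda> (\<omega> \<Lambda>)\<bar> + \<bar>v \<Lambda> x - v_bar \<Lambda> (\<omega> \<Lambda>)\<bar>" by simp
          also have "\<dots> \<le> 6 * exp (- (het_rate (c \<Lambda>) * \<epsilon> \<Lambda> * (1 - 50 * (\<epsilon> \<Lambda>)\<^sup>2) * \<bar>x\<bar>))"
            using uv[OF g] x unfolding front_def par(1,3)[OF g] by blast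
          also have "\<dots> \<le> (L + 9) * 1 *
              exp (- (sqrt (1 - 4 * c\<^sub>0\<^sup>2) * sqrt (\<Lambda> - 1) - (L + 9) * (\<Lambda> - 1)) * \<bar>x\<bar>)"
            using L by (intro mult_mono rate[OF g]) auto
          finally show "\<bar>\<bar>u \<Lambda> x - u_bar \<Lambda> (\<omega> \<Lambda>)\<bar> + \<bar>v \<Lambda> x - v_bar \<Lambda> (\<omega> \<Lambda>)\<bar>\<bar> \<le> (L + 9) * 1 *
              exp (- (sqrt (1 - 4 * c\<^sub>0\<^sup>2) * sqrt (\<Lambda> - 1) - (L + 9) * (\<Lambda> - 1)) * \<bar>x\<bar>)" .
        qed
      qed
    qed (use L in simp)
  qed
qed

end
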